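(* Let $\mathbb F$ be a field of characteristic $0$ and let $\mathcal L=(\mathfrak g\otimes A)\oplus(W\otimes B)\oplus\langle\mathfrak a,\mathfrak a\rangle$ be a Lie algebra over $\mathbb F$ graded by a finite (irreducible) reduced root system $\Delta$ with coordinate algebra $\mathfrak a=A\oplus B$. Then $\operatorname{Cent}(\mathcal L)\cong\mathfrak Z_{\mathfrak a}$, where $\mathfrak Z_{\mathfrak a}$ is the set of elements $\mathfrak z\in Z(\mathfrak a)\cap A$ satisfying: (a) $\langle\mathfrak z\alpha,\beta\rangle=\langle\alpha,\mathfrak z\beta\rangle$ for all $\alpha,\beta\in\mathfrak a$; (b) $\sum_t\langle\alpha_t,\beta_t\rangle=0$ implies $\sum_t\langle\mathfrak z\alpha_t,\beta_t\rangle=0$ (finite sums, $\alpha_t,\beta_t\in\mathfrak a$). More specifically, if $\mathfrak z\in Z(\mathfrak a)\cap A$ satisfies (a) and (b), and if $\Psi\in\operatorname{End}_{\mathbb F}(\mathcal L)$ is given by $$\Psi(x\otimes a)=x\otimes\mathfrak za,\qquad \Psi(w\otimes b)=w\otimes\mathfrak zb,\qquad \Psi(\langle\alpha,\beta\rangle)=\langle\mathfrak z\alpha,\beta\rangle=\langle\alpha,\mathfrak z\beta\rangle$$ for all $x\in\mathfrak g$, $a\in A$, $w\in W$, $b\in B$, $\alpha,\beta\in\mathfrak a$, then $\Psi\in\operatorname{Cent}(\mathcal L)$; and every element of $\operatorname{Cent}(\mathcal L)$ has this form.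
   Context: $\operatorname{Cent}(\mathcal L)=\{\chi\in\operatorname{End}_{\mathbb F}(\mathcal L)\mid\chi([x,y])=[x,\chi(y)]=[\chi(x),y]\}$. The centre $Z(\mathfrak a)$ of a (not necessarily associative) algebra is the set of $z$ with $za=az$ and $(a,b,z)=(a,z,b)=(z,a,b)=0$ for all $a,b$, where $(a,b,c)=(ab)c-a(bc)$. $\Delta$-graded Lie algebra ($\Delta$ finite irreducible reduced): a Lie algebra $\mathcal L$ over $\mathbb F$ containing a finite-dimensional split simple Lie algebra $\mathfrak g$ (the grading subalgebra) with split Cartan subalgebra $\mathfrak h$ and root system $\Delta$, such that $\mathcal L=\bigoplus_{\alpha\in\Delta\cup\{0\}}\mathcal L_\alpha$ with $\mathcal L_\alpha=\{x\mid[h,x]=\alpha(h)x\ \forall h\in\mathfrak h\}$, and $\mathcal L_0=\sum_{\alpha\in\Delta}[\mathcal L_\alpha,\mathcal L_{-\alpha}]$. Known structure (taken as given): $\mathcal L=(\mathfrak g\otimes A)\oplus(W\otimes B)\oplus D$ as a $\mathfrak g$-module, where $W$ is the irreducible $\mathfrak g$-module whose highest weight is the highest short root ($W=0$, $B=0$ if $\Delta$ is simply laced), and $D$ is the sum of the trivial $\mathfrak g$-submodules. $\mathfrak a=A\oplus B$ is a unital algebra (the coordinate algebra; associative, alternative or Jordan depending on $\Delta$, except for type $C_2$), $1\in A$, $\mathfrak g=\mathfrak g\otimes1$. There is a bilinear map $\langle\cdot,\cdot\rangle:\mathfrak a\times\mathfrak a\to D$ with $\langle A,B\rangle=0=\langle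 B,A\rangle$ and $D=\langle\mathfrak a,\mathfrak a\rangle=\langle A,A\rangle+\langle B,B\rangle$. $D$ acts on $\mathfrak a$ by derivations preserving $A$ and $B$: $\langle\alpha,\beta\rangle(\gamma)=D_{\alpha,\beta}(\gamma)$ with $D_{\alpha,\beta}$ the inner derivation of $\mathfrak a$ determined by $\alpha,\beta$ (a certain expression in left and right multiplication operators). If $\Delta$ is of type $C_r$, $\mathfrak a$ has an involution with symmetric elements $A$ and skew elements $B$. If $\Delta$ is of type $F_4$ or $G_2$, $\mathfrak a$ is an algebra over the commutative associative algebra $A$, and $B$ is the kernel of an $A$-linear trace $\mathfrak a\to A$. The brackets ($a,a'\in A$, $b,b'\in B$, $x,y\in\mathfrak g$, $u,v\in W$, $d\in D$) always satisfy $[d,x\otimes a]=x\otimes da$, $[d,u\otimes b]=u\otimes db$, and: Types $A_1$, $B_r$ ($r\ge3$), $D_r$ ($r\ge4$), $E_6,E_7,E_8,F_4,G_2$: $[x\otimes a,y\otimes a']=[x,y]\otimes aa'+(x|y)\langle a,a'\rangle$; $[x\otimes a,u\otimes b]=xu\otimes ab$; $[u\otimes b,v\otimes b']=\partial_{u,v}\otimes(b,b')+(u*v)\otimes(b*b')+(u|v)\langle b,b'\rangle$, with $\partial\in\operatorname{Hom}_{\mathfrak g}(W\otimes W,\mathfrak g)$, $*\in\operatorname{Hom}_{\mathfrak g}(W\otimes W,W)$ (unique up to scalars), and product in $\mathfrak a$: $(a+b)(a'+b')=(aa'+(b,b'))+(ab'+a'b+b*b')$, where $aa',(b,b')\in A$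 and $ab',a'b,b*b'\in B$. Types $A_r$ ($r\ge2$), $C_r$ ($r\ge2$): $\mathfrak g$ is realized as the matrix Lie algebra $\mathfrak{sl}_{r+1}$ resp. $\mathfrak{sp}_{2r}$ (and $W$ by matrices); for matrices $w\circ z=wz+zw-\frac2n\mathrm{tr}(wz)I$, $n=r+1$ resp. $2r$. Then $[x\otimes a,y\otimes a']=[x,y]\otimes\frac12(aa'+a'a)+(x\circ y)\otimes\frac12(aa'-a'a)+(x|y)\langle a,a'\rangle$; $[x\otimes a,u\otimes b]=(x\circ u)\otimes\frac12(ab-ba)+[x,u]\otimes\frac12(ab+ba)$; $[u\otimes b,v\otimes b']=[u,v]\otimes\frac12(bb'+b'b)+(u\circ v)\otimes\frac12(bb'-b'b)+(u|v)\langle b,b'\rangle$. Here $(\cdot|\cdot)$ is the Killing form on $\mathfrak g$ and the ($\mathfrak g$-invariant, unique up to scalar) bilinear form on $W$.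
   Formalization: For type B_r the product b*b' is taken to be 0, and for type C_2 the algebra 𝔞 is assumed either alternative or with bb'=b'b on B; these B-components do not enter the bracket, and without such a convention the claim about Z(𝔞) can fail. *)

theory Defs
  imports "HOL-Library.FuncSet" "Jordan_Normal_Form.Matrix"
begin

section \<open>Linear algebra over an arbitrary field\<close>

text \<open>Vector spaces are the library's locale \<^locale>\<open>vector_space\<close>: an explicit scalar
  multiplication on an abelian-group type.  Ambient spaces are whole types; subspaces are sets.\<close>

definition bilinear_on ::
  "('f \<Rightarrow> 'u \<Rightarrow> 'u) \<Rightarrow> ('f \<Rightarrow> 'v \<Rightarrow> 'v) \<Rightarrow> ('f \<Rightarrow> 't \<Rightarrow> 't) \<Rightarrow> 'u set \<Rightarrow> 'v set \<Rightarrow>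
   ('u::ab_group_add \<Rightarrow> 'v::ab_group_add \<Rightarrow> 't::ab_group_add) \<Rightarrow> bool" where
  "bilinear_on sU sV sT U V \<phi> \<longleftrightarrow>
     (\<forall>u\<in>U. \<forall>u'\<in>U. \<forall>v\<in>V. \<phi> (u + u') v = \<phi> u v + \<phi> u' v) \<and>
     (\<forall>u\<in>U. \<forall>v\<in>V. \<forall>v'\<in>V. \<phi> u (v + v') = \<phi> u v + \<phi> u v') \<and>
     (\<forall>c. \<forall>u\<in>U. \<forall>v\<in>V. \<phi> (sU c u) v = sT c (\<phi> u v) \<and> \<phi> u (sV c v) = sT c (\<phi> u v))"

text \<open>The bilinear map \<open>\<phi>\<close> exhibits the span of its image as the tensor product of \<open>U\<close> and \<open>V\<close>:
  for bases \<open>E\<close> of \<open>U\<close> and \<open>F\<close> of \<open>V\<close>, the products \<open>\<phi> e f\<close> form a basis of that span.\<close>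

definition tensor_map ::
  "('f::field \<Rightarrow> 'u \<Rightarrow> 'u) \<Rightarrow> ('f \<Rightarrow> 'v \<Rightarrow> 'v) \<Rightarrow> ('f \<Rightarrow> 't \<Rightarrow> 't) \<Rightarrow> 'u set \<Rightarrow> 'v set \<Rightarrow>
   ('u::ab_group_add \<Rightarrow> 'v::ab_group_add \<Rightarrow> 't::ab_group_add) \<Rightarrow> bool" where
  "tensor_map sU sV sT U V \<phi> \<longleftrightarrow>
     bilinear_on sU sV sT U V \<phi> \<and>
     (\<forall>E F. \<not> module.dependent sU E \<and> module.span sU E = U \<and>
            \<not> module.dependent sV F \<and> module.span sV F = V \<longrightarrow>
        inj_on (\<lambda>(e, f). \<phi> e f) (E \<times> F) \<and>
        \<not> module.dependent sT ((\<lambda>(e, f). \<phi> e f) ` (E \<times> F)))"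


section \<open>Types of finite irreducible reduced root systems\<close>

datatype cartan_type = TypeA nat | TypeB nat | TypeC nat | TypeD nat | TypeE nat | TypeF4 | TypeG2

fun valid_type :: "cartan_type \<Rightarrow> bool" where
  "valid_type (TypeA r) = (r \<ge> 1)"
| "valid_type (TypeB r) = (r \<ge> 3)"
| "valid_type (TypeC r) = (r \<ge> 2)"
| "valid_type (TypeD r) = (r \<ge> 4)"
| "valid_type (TypeE r) = (r \<in> {6, 7, 8})"
| "valid_type TypeF4 = True"
| "valid_type TypeG2 = True"

fun type_rank :: "cartan_type \<Rightarrow> nat" where
  "type_rank (TypeA r) = r"
| "type_rank (TypeB r) = r"
| "type_rank (TypeC r) = r"
| "type_rank (TypeD r) = r"
| "type_rank (TypeE r) = r"
| "type_rank TypeF4 = 4"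
| "type_rank TypeG2 = 2"

fun simply_laced :: "cartan_type \<Rightarrow> bool" where
  "simply_laced (TypeA r) = True"
| "simply_laced (TypeD r) = True"
| "simply_laced (TypeE r) = True"
| "simply_laced _ = False"

text \<open>Dynkin diagrams in Bourbaki's numbering, shifted to start at \<open>0\<close>.\<close>

definition chain_edge :: "nat \<Rightarrow> nat \<Rightarrow> bool" where
  "chain_edge i j \<longleftrightarrow> j = Suc i \<or> i = Suc j"

fun joined :: "cartan_type \<Rightarrow> nat \<Rightarrow> nat \<Rightarrow> bool" where
  "joined (TypeD r) i j =
     (i < r - 1 \<and> j < r - 1 \<and> chain_edge i j \<or> {i, j} = {r - 3, r - 1})"
| "joined (TypeE r) i j =
     ({i, j} = {0, 2} \<or> {i, j} = {1, 3} \<or> i \<ge> 2 \<and> j \<ge> 2 \<and> chain_edge i j)"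
| "joined _ i j = chain_edge i j"

text \<open>The entry \<open>(i, j)\<close> is the Cartan integer \<open>2 (\<alpha>\<^sub>i | \<alpha>\<^sub>j) / (\<alpha>\<^sub>j | \<alpha>\<^sub>j)\<close>.\<close>

definition cartan_int :: "cartan_type \<Rightarrow> nat \<Rightarrow> nat \<Rightarrow> int" where
  "cartan_int T i j =
     (if i = j then 2
      else if \<not> joined T i j then 0
      else case T of
          TypeB r \<Rightarrow> if i = r - 2 \<and> j = r - 1 then -2 else -1
        | TypeC r \<Rightarrow> if i = r - 1 \<and> j = r - 2 then -2 else -1
        | TypeF4 \<Rightarrow> if i = 1 \<and> j = 2 then -2 else -1
        | TypeG2 \<Rightarrow> if i = 1 \<and> j = 0 then -3 else -1
        | _ \<Rightarrow> -1)"


section \<open>Lie algebras\<close>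

locale lie_algebra = vector_space scale
  for scale :: "'f::field \<Rightarrow> 'l::ab_group_add \<Rightarrow> 'l" +
  fixes br :: "'l \<Rightarrow> 'l \<Rightarrow> 'l"
  assumes br_bilinear: "bilinear_on scale scale scale UNIV UNIV br"
    and br_alternating: "br x x = 0"
    and jacobi: "br x (br y z) + br y (br z x) + br z (br x y) = 0"
begin

definition bracket_span :: "'l set \<Rightarrow> 'l set \<Rightarrow> 'l set" where
  "bracket_span U V = span {br x y |x y. x \<in> U \<and> y \<in> V}"

definition lie_subalgebra :: "'l set \<Rightarrow> bool" where
  "lie_subalgebra S \<longleftrightarrow> subspace S \<and> (\<forall>x\<in>S. \<forall>y\<in>S. br x y \<in> S)"

definition lie_ideal :: "'l set \<Rightarrow> 'l set \<Rightarrow> bool" where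
  "lie_ideal S I \<longleftrightarrow> subspace I \<and> I \<subseteq> S \<and> (\<forall>x\<in>S. \<forall>y\<in>I. br x y \<in> I)"

definition simple_subalgebra :: "'l set \<Rightarrow> bool" where
  "simple_subalgebra S \<longleftrightarrow>
     lie_subalgebra S \<and> (\<exists>x\<in>S. \<exists>y\<in>S. br x y \<noteq> 0) \<and>
     (\<forall>I. lie_ideal S I \<longrightarrow> I = {0} \<or> I = S)"

primrec lower_central :: "'l set \<Rightarrow> nat \<Rightarrow> 'l set" where
  "lower_central S 0 = S"
| "lower_central S (Suc n) = bracket_span S (lower_central S n)"

definition cartan_subalgebra :: "'l set \<Rightarrow> 'l set \<Rightarrow> bool" where
  "cartan_subalgebra S h \<longleftrightarrow>
     lie_subalgebra h \<and> h \<subseteq> S \<and> (\<exists>n. lower_central h n = {0}) \<and>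
     {x\<in>S. \<forall>t\<in>h. br x t \<in> h} = h"

text \<open>The dual space of a subspace \<open>h\<close>; its elements are extended by \<open>0\<close> outside \<open>h\<close>, so that
  equal functionals are equal as functions.\<close>

definition functionals :: "'l set \<Rightarrow> ('l \<Rightarrow> 'f) set" where
  "functionals h =
     {\<alpha>. (\<forall>s\<in>h. \<forall>t\<in>h. \<alpha> (s + t) = \<alpha> s + \<alpha> t) \<and>
         (\<forall>c. \<forall>t\<in>h. \<alpha> (scale c t) = c * \<alpha> t) \<and>
         (\<forall>t. t \<notin> h \<longrightarrow> \<alpha> t = 0)}"

definition weight_space :: "'l set \<Rightarrow> 'l set \<Rightarrow> ('l \<Rightarrow> 'f) \<Rightarrow> 'l set" where
  "weight_space h S \<alpha> = {x\<in>S. \<forall>t\<in>h. br t x = scale (\<alpha> t) x}"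

definition roots :: "'l set \<Rightarrow> 'l set \<Rightarrow> ('l \<Rightarrow> 'f) set" where
  "roots g h = {\<alpha>\<in>functionals h. \<alpha> \<noteq> (\<lambda>_. 0) \<and> weight_space h g \<alpha> \<noteq> {0}}"

definition internal_direct_sum :: "'l set \<Rightarrow> 'i set \<Rightarrow> ('i \<Rightarrow> 'l set) \<Rightarrow> bool" where
  "internal_direct_sum V I U \<longleftrightarrow>
     finite I \<and> (\<forall>i\<in>I. subspace (U i) \<and> U i \<subseteq> V) \<and>
     (\<forall>v\<in>V. \<exists>!f. f \<in> (\<Pi>\<^sub>E i\<in>I. U i) \<and> v = (\<Sum>i\<in>I. f i))"

definition split_cartan_subalgebra :: "'l set \<Rightarrow> 'l set \<Rightarrow> bool" where
  "split_cartan_subalgebra g h \<longleftrightarrow>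
     cartan_subalgebra g h \<and>
     internal_direct_sum g (insert (\<lambda>_. 0) (roots g h)) (weight_space h g)"

text \<open>\<open>trace (ad x \<circ> ad y)\<close> on the finite-dimensional subalgebra \<open>g\<close>, computed in some basis.\<close>

definition killing_form :: "'l set \<Rightarrow> 'l \<Rightarrow> 'l \<Rightarrow> 'f" where
  "killing_form g x y =
     (let E = (SOME E. independent E \<and> span E = g)
      in \<Sum>e\<in>E. representation E (br x (br y e)) e)"

text \<open>The form on the dual of \<open>h\<close> transported from the Killing form.\<close>

definition dual_vector :: "'l set \<Rightarrow> 'l set \<Rightarrow> ('l \<Rightarrow> 'f) \<Rightarrow> 'l" where
  "dual_vector g h \<alpha> = (THE t. t \<in> h \<and> (\<forall>s\<in>h. killing_form g t s = \<alpha> s))"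

definition root_form :: "'l set \<Rightarrow> 'l set \<Rightarrow> ('l \<Rightarrow> 'f) \<Rightarrow> ('l \<Rightarrow> 'f) \<Rightarrow> 'f" where
  "root_form g h \<alpha> \<beta> = killing_form g (dual_vector g h \<alpha>) (dual_vector g h \<beta>)"

definition nonneg_comb :: "nat \<Rightarrow> (nat \<Rightarrow> 'l \<Rightarrow> 'f) \<Rightarrow> ('l \<Rightarrow> 'f) \<Rightarrow> bool" where
  "nonneg_comb r \<pi> \<alpha> \<longleftrightarrow> (\<exists>n :: nat \<Rightarrow> nat. \<alpha> = (\<lambda>t. \<Sum>i<r. of_nat (n i) * \<pi> i t))"

definition root_base :: "'l set \<Rightarrow> 'l set \<Rightarrow> nat \<Rightarrow> (nat \<Rightarrow> 'l \<Rightarrow> 'f) \<Rightarrow> bool" where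
  "root_base g h r \<pi> \<longleftrightarrow>
     (\<forall>i<r. \<pi> i \<in> roots g h) \<and>
     (\<forall>c :: nat \<Rightarrow> 'f. (\<forall>t. (\<Sum>i<r. c i * \<pi> i t) = 0) \<longrightarrow> (\<forall>i<r. c i = 0)) \<and>
     (\<forall>\<alpha>\<in>roots g h. nonneg_comb r \<pi> \<alpha> \<or> nonneg_comb r \<pi> (\<lambda>t. - \<alpha> t))"

definition root_system_of_type ::
  "'l set \<Rightarrow> 'l set \<Rightarrow> (nat \<Rightarrow> 'l \<Rightarrow> 'f) \<Rightarrow> cartan_type \<Rightarrow> bool" where
  "root_system_of_type g h \<pi> T \<longleftrightarrow>
     root_base g h (type_rank T) \<pi> \<and>
     (\<forall>i<type_rank T. \<forall>j<type_rank T.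
        2 * root_form g h (\<pi> i) (\<pi> j) = of_int (cartan_int T i j) * root_form g h (\<pi> j) (\<pi> j))"

text \<open>The field carries no order; squared root lengths are compared through their ratio, which
  is rational.\<close>

definition short_roots :: "'l set \<Rightarrow> 'l set \<Rightarrow> ('l \<Rightarrow> 'f) set" where
  "short_roots g h =
     {\<alpha>\<in>roots g h. \<exists>\<beta>\<in>roots g h. \<exists>p q :: nat. 0 < p \<and> p < q \<and>
        of_nat q * root_form g h \<alpha> \<alpha> = of_nat p * root_form g h \<beta> \<beta>}"

definition highest_short_root ::
  "'l set \<Rightarrow> 'l set \<Rightarrow> nat \<Rightarrow> (nat \<Rightarrow> 'l \<Rightarrow> 'f) \<Rightarrow> ('l \<Rightarrow> 'f) \<Rightarrow> bool" where
  "highest_short_root g h r \<pi> \<theta> \<longleftrightarrow>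
     \<theta> \<in> short_roots g h \<and> (\<forall>\<beta>\<in>short_roots g h. nonneg_comb r \<pi> (\<lambda>t. \<theta> t - \<beta> t))"

text \<open>The sum of the trivial \<open>g\<close>-submodules.\<close>

definition invariants :: "'l set \<Rightarrow> 'l set" where
  "invariants g = {d. \<forall>x\<in>g. br x d = 0}"

definition root_graded :: "'l set \<Rightarrow> 'l set \<Rightarrow> bool" where
  "root_graded g h \<longleftrightarrow>
     (\<exists>E. finite E \<and> span E = g) \<and> simple_subalgebra g \<and> split_cartan_subalgebra g h \<and>
     internal_direct_sum UNIV (insert (\<lambda>_. 0) (roots g h)) (weight_space h UNIV) \<and>
     weight_space h UNIV (\<lambda>_. 0) =
       span (\<Union>\<alpha>\<in>roots g h.
         {br x y |x y. x \<in> weight_space h UNIV \<alpha> \<and> y \<in> weight_space h UNIV (\<lambda>t. - \<alpha> t)})"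

end

definition centroid :: "('f::field \<Rightarrow> 'l::ab_group_add \<Rightarrow> 'l) \<Rightarrow> ('l \<Rightarrow> 'l \<Rightarrow> 'l) \<Rightarrow> ('l \<Rightarrow> 'l) set" where
  "centroid scale br =
     {\<chi>. Vector_Spaces.linear scale scale \<chi> \<and>
         (\<forall>x y. \<chi> (br x y) = br x (\<chi> y) \<and> \<chi> (br x y) = br (\<chi> x) y)}"


section \<open>Nonassociative algebras\<close>

definition associator :: "('a \<Rightarrow> 'a \<Rightarrow> 'a) \<Rightarrow> 'a::ab_group_add \<Rightarrow> 'a \<Rightarrow> 'a \<Rightarrow> 'a" where
  "associator mu a b c = mu (mu a b) c - mu a (mu b c)"

definition algebra_centre :: "('a \<Rightarrow> 'a \<Rightarrow> 'a) \<Rightarrow> 'a::ab_group_add set" where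
  "algebra_centre mu =
     {z. (\<forall>a. mu z a = mu a z) \<and>
         (\<forall>a b. associator mu a b z = 0 \<and> associator mu a z b = 0 \<and> associator mu z a b = 0)}"

definition associative_alg :: "('a \<Rightarrow> 'a \<Rightarrow> 'a) \<Rightarrow> bool" where
  "associative_alg mu \<longleftrightarrow> (\<forall>a b c. mu (mu a b) c = mu a (mu b c))"

definition commutative_alg :: "('a \<Rightarrow> 'a \<Rightarrow> 'a) \<Rightarrow> bool" where
  "commutative_alg mu \<longleftrightarrow> (\<forall>a b. mu a b = mu b a)"

definition alternative_alg :: "('a \<Rightarrow> 'a \<Rightarrow> 'a) \<Rightarrow> bool" where
  "alternative_alg mu \<longleftrightarrow>
     (\<forall>a b. mu (mu a a) b = mu a (mu a b) \<and> mu (mu b a) a = mu b (mu a a))"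

definition jordan_alg :: "('a \<Rightarrow> 'a \<Rightarrow> 'a) \<Rightarrow> bool" where
  "jordan_alg mu \<longleftrightarrow>
     commutative_alg mu \<and> (\<forall>a b. mu (mu (mu a a) b) a = mu (mu a a) (mu b a))"

locale coordinate_algebra = vector_space scale
  for scale :: "'f::field \<Rightarrow> 'a::ab_group_add \<Rightarrow> 'a" +
  fixes mu :: "'a \<Rightarrow> 'a \<Rightarrow> 'a" and one :: 'a and A B :: "'a set"
  assumes mu_bilinear: "bilinear_on scale scale scale UNIV UNIV mu"
    and unit: "mu one a = a" "mu a one = a"
    and one_in_A: "one \<in> A"
    and subspace_A: "subspace A" and subspace_B: "subspace B"
    and A_plus_B: "\<exists>!p. p \<in> A \<times> B \<and> c = fst p + snd p"
begin

definition A_part :: "'a \<Rightarrow> 'a" where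
  "A_part c = fst (THE p. p \<in> A \<times> B \<and> c = fst p + snd p)"

definition B_part :: "'a \<Rightarrow> 'a" where
  "B_part c = snd (THE p. p \<in> A \<times> B \<and> c = fst p + snd p)"

text \<open>Half of the symmetrised product, and half of the commutator.\<close>

definition sym :: "'a \<Rightarrow> 'a \<Rightarrow> 'a" where
  "sym a b = scale (1 / 2) (mu a b + mu b a)"

definition skew :: "'a \<Rightarrow> 'a \<Rightarrow> 'a" where
  "skew a b = scale (1 / 2) (mu a b - mu b a)"

text \<open>The product \<open>(a+b)(a'+b') = (aa' + (b,b')) + (ab' + a'b + b*b')\<close>.\<close>

definition product_respects_parts :: bool where
  "product_respects_parts \<longleftrightarrow>
     (\<forall>a\<in>A. \<forall>a'\<in>A. mu a a' \<in> A) \<and> (\<forall>a\<in>A. \<forall>b\<in>B. mu a b \<in> B \<and> mu b a = mu a b)"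

definition has_involution :: bool where
  "has_involution \<longleftrightarrow>
     (\<exists>\<eta>. Vector_Spaces.linear scale scale \<eta> \<and> (\<forall>a. \<eta> (\<eta> a) = a) \<and>
          (\<forall>a b. \<eta> (mu a b) = mu (\<eta> b) (\<eta> a)) \<and>
          A = {a. \<eta> a = a} \<and> B = {b. \<eta> b = - b})"

definition algebra_over_A_with_trace :: bool where
  "algebra_over_A_with_trace \<longleftrightarrow>
     (\<forall>a\<in>A. \<forall>a'\<in>A. mu a a' = mu a' a) \<and>
     (\<forall>a\<in>A. \<forall>a'\<in>A. \<forall>c. mu (mu a a') c = mu a (mu a' c)) \<and>
     (\<forall>a\<in>A. \<forall>c c'. mu a (mu c c') = mu (mu a c) c' \<and> mu a (mu c c') = mu c (mu a c')) \<and>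
     (\<exists>tr. (\<forall>c. tr c \<in> A) \<and> (\<forall>c c'. tr (c + c') = tr c + tr c') \<and>
           (\<forall>a\<in>A. \<forall>c. tr (mu a c) = mu a (tr c)) \<and> B = {c. tr c = 0})"

text \<open>For \<open>TypeB\<close> there is no nonzero invariant product on \<open>W\<close>, and for \<open>TypeC 2\<close> the product
  \<open>u \<circ> v\<close> vanishes on \<open>W\<close>.  In these cases the component of \<open>b b'\<close> in \<open>B\<close> does not enter the
  bracket of the Lie algebra.  For \<open>TypeB\<close> it is \<open>0\<close> (the Jordan algebra of a symmetric bilinear
  form).  For \<open>TypeC 2\<close> either it is \<open>0\<close>, or the algebra is alternative (for instance associative
  with involution).\<close>

definition coordinate_algebra_of_type :: "cartan_type \<Rightarrow> bool" where
  "coordinate_algebra_of_type T \<longleftrightarrow> (case T of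
       TypeA r \<Rightarrow> if r = 1 then jordan_alg mu
                  else if r = 2 then alternative_alg mu else associative_alg mu
     | TypeB r \<Rightarrow> jordan_alg mu \<and> (\<forall>b\<in>B. \<forall>b'\<in>B. mu b b' \<in> A)
     | TypeC r \<Rightarrow> has_involution \<and>
         (if r = 2 then (\<forall>b\<in>B. \<forall>b'\<in>B. mu b b' = mu b' b) \<or> alternative_alg mu
          else if r = 3 then alternative_alg mu else associative_alg mu)
     | TypeD r \<Rightarrow> commutative_alg mu \<and> associative_alg mu
     | TypeE r \<Rightarrow> commutative_alg mu \<and> associative_alg mu
     | TypeF4 \<Rightarrow> alternative_alg mu \<and> algebra_over_A_with_trace
     | TypeG2 \<Rightarrow> jordan_alg mu \<and> algebra_over_A_with_trace)"

text \<open>The linear combination, with coefficients \<open>k\<close>, of the values at \<open>c\<close> of the operators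
  \<open>L\<^sub>aL\<^sub>b\<close>, \<open>L\<^sub>bL\<^sub>a\<close>, \<open>R\<^sub>aR\<^sub>b\<close>, \<open>R\<^sub>bR\<^sub>a\<close>, \<open>L\<^sub>aR\<^sub>b\<close>, \<open>R\<^sub>bL\<^sub>a\<close>, \<open>L\<^sub>bR\<^sub>a\<close>, \<open>R\<^sub>aL\<^sub>b\<close> and of left and right
  multiplication by \<open>ab\<close> and by \<open>ba\<close>: all operators built from left and right multiplications
  that are of degree one in each of \<open>a\<close> and \<open>b\<close>.\<close>

definition mult_operators :: "'a \<Rightarrow> 'a \<Rightarrow> 'a \<Rightarrow> 'a list" where
  "mult_operators a b c =
     [mu a (mu b c), mu b (mu a c), mu (mu c b) a, mu (mu c a) b,
      mu a (mu c b), mu (mu a c) b, mu b (mu c a), mu (mu b c) a,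
      mu (mu a b) c, mu (mu b a) c, mu c (mu a b), mu c (mu b a)]"

definition mult_expression :: "(nat \<Rightarrow> 'f) \<Rightarrow> 'a \<Rightarrow> 'a \<Rightarrow> 'a \<Rightarrow> 'a" where
  "mult_expression k a b c = (\<Sum>i<12. scale (k i) (mult_operators a b c ! i))"

definition derivation :: "('a \<Rightarrow> 'a) \<Rightarrow> bool" where
  "derivation d \<longleftrightarrow>
     Vector_Spaces.linear scale scale d \<and> (\<forall>a b. d (mu a b) = mu (d a) b + mu a (d b))"

end


section \<open>Matrix realisations\<close>

definition mat_trace :: "'f::comm_ring_1 mat \<Rightarrow> 'f" where
  "mat_trace M = (\<Sum>i<dim_row M. M $$ (i, i))"

definition mat_bracket :: "'f::comm_ring_1 mat \<Rightarrow> 'f mat \<Rightarrow> 'f mat" where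
  "mat_bracket X Y = X * Y - Y * X"

definition mat_circ :: "nat \<Rightarrow> 'f::field mat \<Rightarrow> 'f mat \<Rightarrow> 'f mat" where
  "mat_circ n X Y = X * Y + Y * X - (2 / of_nat n * mat_trace (X * Y)) \<cdot>\<^sub>m 1\<^sub>m n"

definition sl_mat :: "nat \<Rightarrow> 'f::field mat set" where
  "sl_mat n = {X \<in> carrier_mat n n. mat_trace X = 0}"

definition symplectic_mat :: "nat \<Rightarrow> 'f::field mat" where
  "symplectic_mat r = four_block_mat (0\<^sub>m r r) (1\<^sub>m r) (- 1\<^sub>m r) (0\<^sub>m r r)"

definition sp_mat :: "nat \<Rightarrow> 'f::field mat set" where
  "sp_mat r = {X \<in> carrier_mat (2 * r) (2 * r).
     transpose_mat X * symplectic_mat r = - (symplectic_mat r * X)}"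

text \<open>The trace-zero matrices that are self-adjoint for the symplectic form: the irreducible
  \<open>sp\<^sub>2\<^sub>r\<close>-module whose highest weight is the highest short root.\<close>

definition sp_module_mat :: "nat \<Rightarrow> 'f::field mat set" where
  "sp_module_mat r = {X \<in> carrier_mat (2 * r) (2 * r).
     transpose_mat X * symplectic_mat r = symplectic_mat r * X \<and> mat_trace X = 0}"

definition linear_bij_mat ::
  "('f::field \<Rightarrow> 'v::ab_group_add \<Rightarrow> 'v) \<Rightarrow> 'v set \<Rightarrow> 'f mat set \<Rightarrow> ('v \<Rightarrow> 'f mat) \<Rightarrow> bool" where
  "linear_bij_mat scale V S \<rho> \<longleftrightarrow>
     bij_betw \<rho> V S \<and> (\<forall>x\<in>V. \<forall>y\<in>V. \<rho> (x + y) = \<rho> x + \<rho> y) \<and>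
     (\<forall>c. \<forall>x\<in>V. \<rho> (scale c x) = c \<cdot>\<^sub>m \<rho> x)"


section \<open>Root-graded Lie algebras in coordinates\<close>

text \<open>The Lie algebra is the type \<open>'l\<close>, its coordinate algebra \<open>\<aa> = A \<oplus> B\<close> the type \<open>'a\<close>, and the
  module \<open>W\<close> the type \<open>'w\<close> (with \<open>act x w\<close> for \<open>x \<in> g\<close>).  \<open>gA x a\<close> is \<open>x \<otimes> a\<close> and \<open>WB w b\<close> is
  \<open>w \<otimes> b\<close>; \<open>ang \<alpha> \<beta>\<close> is \<open>\<langle>\<alpha>, \<beta>\<rangle>\<close>; \<open>dact d\<close> is the action of \<open>d \<in> D\<close> on \<open>\<aa>\<close>; \<open>wf\<close> is the form
  \<open>(u|v)\<close> on \<open>W\<close>; \<open>\<pi>\<close> enumerates a base of the root system, which has type \<open>T\<close>.\<close>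

locale root_graded_data =
  lie_algebra sL br + \<aa>: coordinate_algebra sA mu one A B + W: vector_space sW
  for sL :: "'f::field_char_0 \<Rightarrow> 'l::ab_group_add \<Rightarrow> 'l" and br
    and sA :: "'f \<Rightarrow> 'a::ab_group_add \<Rightarrow> 'a" and mu and one and A and B
    and sW :: "'f \<Rightarrow> 'w::ab_group_add \<Rightarrow> 'w" +
  fixes act :: "'l \<Rightarrow> 'w \<Rightarrow> 'w"
    and g h :: "'l set"
    and T :: cartan_type
    and \<pi> :: "nat \<Rightarrow> 'l \<Rightarrow> 'f"
    and gA :: "'l \<Rightarrow> 'a \<Rightarrow> 'l"
    and WB :: "'w \<Rightarrow> 'a \<Rightarrow> 'l"
    and ang :: "'a \<Rightarrow> 'a \<Rightarrow> 'l"
    and dact :: "'l \<Rightarrow> 'a \<Rightarrow> 'a"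
    and wf :: "'w \<Rightarrow> 'w \<Rightarrow> 'f"
begin

definition module_W :: bool where
  "module_W \<longleftrightarrow>
     bilinear_on sL sW sW g UNIV act \<and>
     (\<forall>x\<in>g. \<forall>y\<in>g. \<forall>w. act (br x y) w = act x (act y w) - act y (act x w))"

definition zero_W :: bool where
  "zero_W \<longleftrightarrow> (UNIV :: 'w set) = {0}"

definition irreducible_W :: bool where
  "irreducible_W \<longleftrightarrow>
     \<not> zero_W \<and>
     (\<forall>N. W.subspace N \<and> (\<forall>x\<in>g. \<forall>w\<in>N. act x w \<in> N) \<longrightarrow> N = {0} \<or> N = UNIV)"

definition W_has_highest_weight :: "('l \<Rightarrow> 'f) \<Rightarrow> bool" where
  "W_has_highest_weight \<theta> \<longleftrightarrow>
     (\<exists>w. w \<noteq> 0 \<and> (\<forall>t\<in>h. act t w = sW (\<theta> t) w) \<and>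
        (\<forall>\<alpha>\<in>roots g h. nonneg_comb (type_rank T) \<pi> \<alpha> \<longrightarrow>
           (\<forall>x\<in>weight_space h g \<alpha>. act x w = 0)))"

definition invariant_form_W :: bool where
  "invariant_form_W \<longleftrightarrow>
     bilinear_on sW sW (*) UNIV UNIV wf \<and>
     (\<forall>x\<in>g. \<forall>u v. wf (act x u) v + wf u (act x v) = 0)"

text \<open>Brackets for the types other than \<open>TypeA r\<close> with \<open>r \<ge> 2\<close> and \<open>TypeC r\<close>.  The maps \<open>der\<close> and
  \<open>star\<close> are nonzero elements of \<open>Hom\<^sub>g(W \<otimes> W, g)\<close> and \<open>Hom\<^sub>g(W \<otimes> W, W)\<close> whenever these spaces
  are nonzero, that is, for \<open>der\<close> when \<open>W \<noteq> 0\<close> and for \<open>star\<close> in types \<open>TypeF4\<close> and \<open>TypeG2\<close>.\<close>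

definition brackets_general :: bool where
  "brackets_general \<longleftrightarrow>
     \<aa>.product_respects_parts \<and>
     (\<forall>x\<in>g. \<forall>y\<in>g. \<forall>a\<in>A. \<forall>a'\<in>A.
        br (gA x a) (gA y a') = gA (br x y) (mu a a') + sL (killing_form g x y) (ang a a')) \<and>
     (\<forall>x\<in>g. \<forall>u. \<forall>a\<in>A. \<forall>b\<in>B. br (gA x a) (WB u b) = WB (act x u) (mu a b)) \<and>
     (\<exists>(der :: 'w \<Rightarrow> 'w \<Rightarrow> 'l) (star :: 'w \<Rightarrow> 'w \<Rightarrow> 'w).
        (\<forall>u v. der u v \<in> g) \<and>
        bilinear_on sW sW sL UNIV UNIV der \<and> bilinear_on sW sW sW UNIV UNIV star \<and>
        (\<forall>x\<in>g. \<forall>u v. br x (der u v) = der (act x u) v + der u (act x v)) \<and>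
        (\<forall>x\<in>g. \<forall>u v. act x (star u v) = star (act x u) v + star u (act x v)) \<and>
        (\<not> simply_laced T \<longrightarrow> (\<exists>u v. der u v \<noteq> 0)) \<and>
        (T = TypeF4 \<or> T = TypeG2 \<longrightarrow> (\<exists>u v. star u v \<noteq> 0)) \<and>
        (\<forall>u v. \<forall>b\<in>B. \<forall>b'\<in>B.
           br (WB u b) (WB v b') =
             gA (der u v) (\<aa>.A_part (mu b b')) + WB (star u v) (\<aa>.B_part (mu b b'))
             + sL (wf u v) (ang b b')))"

text \<open>Brackets for \<open>TypeA r\<close>, \<open>r \<ge> 2\<close>; \<open>\<rho>\<close> realises \<open>g\<close> as \<open>sl\<^sub>n\<close>, \<open>n = r + 1\<close>.\<close>

definition brackets_A :: "nat \<Rightarrow> bool" where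
  "brackets_A r \<longleftrightarrow>
     (\<exists>\<rho>. linear_bij_mat sL g (sl_mat (r + 1)) \<rho> \<and>
        (\<forall>x\<in>g. \<forall>y\<in>g. \<rho> (br x y) = mat_bracket (\<rho> x) (\<rho> y)) \<and>
        (\<forall>x\<in>g. \<forall>y\<in>g. \<forall>a\<in>A. \<forall>a'\<in>A.
           br (gA x a) (gA y a') =
             gA (br x y) (\<aa>.sym a a')
             + gA (inv_into g \<rho> (mat_circ (r + 1) (\<rho> x) (\<rho> y))) (\<aa>.skew a a')
             + sL (killing_form g x y) (ang a a')))"

text \<open>Brackets for \<open>TypeC r\<close>; \<open>\<rho>\<close> realises \<open>g\<close> as \<open>sp\<^sub>2\<^sub>r\<close> and \<open>\<sigma>\<close> realises \<open>W\<close> by matrices.\<close>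

definition brackets_C :: "nat \<Rightarrow> bool" where
  "brackets_C r \<longleftrightarrow>
     (\<exists>\<rho> \<sigma>. linear_bij_mat sL g (sp_mat r) \<rho> \<and> linear_bij_mat sW UNIV (sp_module_mat r) \<sigma> \<and>
        (\<forall>x\<in>g. \<forall>y\<in>g. \<rho> (br x y) = mat_bracket (\<rho> x) (\<rho> y)) \<and>
        (\<forall>x\<in>g. \<forall>u. \<sigma> (act x u) = mat_bracket (\<rho> x) (\<sigma> u)) \<and>
        (\<forall>x\<in>g. \<forall>y\<in>g. \<forall>a\<in>A. \<forall>a'\<in>A.
           br (gA x a) (gA y a') =
             gA (br x y) (\<aa>.sym a a')
             + WB (inv_into UNIV \<sigma> (mat_circ (2 * r) (\<rho> x) (\<rho> y))) (\<aa>.skew a a')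
             + sL (killing_form g x y) (ang a a')) \<and>
        (\<forall>x\<in>g. \<forall>u. \<forall>a\<in>A. \<forall>b\<in>B.
           br (gA x a) (WB u b) =
             gA (inv_into g \<rho> (mat_circ (2 * r) (\<rho> x) (\<sigma> u))) (\<aa>.skew a b)
             + WB (act x u) (\<aa>.sym a b)) \<and>
        (\<forall>u v. \<forall>b\<in>B. \<forall>b'\<in>B.
           br (WB u b) (WB v b') =
             gA (inv_into g \<rho> (mat_bracket (\<sigma> u) (\<sigma> v))) (\<aa>.sym b b')
             + WB (inv_into UNIV \<sigma> (mat_circ (2 * r) (\<sigma> u) (\<sigma> v))) (\<aa>.skew b b')
             + sL (wf u v) (ang b b')))"

definition brackets_of_type :: bool where
  "brackets_of_type \<longleftrightarrow> (case T of
       TypeA r \<Rightarrow> if r = 1 then brackets_general else brackets_A r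
     | TypeC r \<Rightarrow> brackets_C r
     | _ \<Rightarrow> brackets_general)"

end

locale root_graded_lie_algebra = root_graded_data +
  assumes valid: "valid_type T"
    and graded: "root_graded g h"
    and type_T: "root_system_of_type g h \<pi> T"
    and coordinates: "\<aa>.coordinate_algebra_of_type T"
    and W_module: module_W
    and W_simply_laced: "simply_laced T \<Longrightarrow> zero_W \<and> B = {0}"
    and W_irreducible: "\<not> simply_laced T \<Longrightarrow> irreducible_W"
    and W_highest_weight:
      "\<not> simply_laced T \<Longrightarrow>
         \<exists>\<theta>. highest_short_root g h (type_rank T) \<pi> \<theta> \<and> W_has_highest_weight \<theta>"
    and W_form: invariant_form_W
    and W_form_nonzero: "\<not> simply_laced T \<Longrightarrow> \<exists>u v. wf u v \<noteq> 0"
    and gA_tensor: "tensor_map sL sA sL g A gA"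
    and WB_tensor: "tensor_map sW sA sL UNIV B WB"
    and decomposition:
      "\<exists>!p. p \<in> span {gA x a |x a. x \<in> g \<and> a \<in> A} \<times> span {WB w b |w b. b \<in> B} \<times> invariants g \<and>
            v = fst p + fst (snd p) + snd (snd p)"
    and g_embedded: "x \<in> g \<Longrightarrow> gA x one = x"
    and g_on_gA: "\<lbrakk>x \<in> g; y \<in> g; a \<in> A\<rbrakk> \<Longrightarrow> br x (gA y a) = gA (br x y) a"
    and g_on_WB: "\<lbrakk>x \<in> g; b \<in> B\<rbrakk> \<Longrightarrow> br x (WB w b) = WB (act x w) b"
    and ang_bilinear: "bilinear_on sA sA sL UNIV UNIV ang"
    and ang_mixed: "\<lbrakk>a \<in> A; b \<in> B\<rbrakk> \<Longrightarrow> ang a b = 0 \<and> ang b a = 0"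
    and ang_span: "span {ang \<alpha> \<beta> |\<alpha> \<beta>. True} = invariants g"
    and D_action: "bilinear_on sL sA sA (invariants g) UNIV dact"
    and D_action_bracket:
      "\<lbrakk>d \<in> invariants g; d' \<in> invariants g\<rbrakk> \<Longrightarrow>
         dact (br d d') \<gamma> = dact d (dact d' \<gamma>) - dact d' (dact d \<gamma>)"
    and D_derivation: "d \<in> invariants g \<Longrightarrow> \<aa>.derivation (dact d)"
    and D_preserves: "d \<in> invariants g \<Longrightarrow> dact d ` A \<subseteq> A \<and> dact d ` B \<subseteq> B"
    and D_inner_A:
      "\<exists>k. \<forall>\<alpha>\<in>A. \<forall>\<beta>\<in>A. \<forall>\<gamma>. dact (ang \<alpha> \<beta>) \<gamma> = \<aa>.mult_expression k \<alpha> \<beta> \<gamma>"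
    and D_inner_B:
      "\<exists>k. \<forall>\<alpha>\<in>B. \<forall>\<beta>\<in>B. \<forall>\<gamma>. dact (ang \<alpha> \<beta>) \<gamma> = \<aa>.mult_expression k \<alpha> \<beta> \<gamma>"
    and D_on_gA: "\<lbrakk>d \<in> invariants g; x \<in> g; a \<in> A\<rbrakk> \<Longrightarrow> br d (gA x a) = gA x (dact d a)"
    and D_on_WB: "\<lbrakk>d \<in> invariants g; b \<in> B\<rbrakk> \<Longrightarrow> br d (WB w b) = WB w (dact d b)"
    and brackets: brackets_of_type


section \<open>The scalars realised on the coordinate algebra\<close>

definition centroid_scalars ::
  "('a \<Rightarrow> 'a \<Rightarrow> 'a) \<Rightarrow> 'a::ab_group_add set \<Rightarrow> ('a \<Rightarrow> 'a \<Rightarrow> 'l::ab_group_add) \<Rightarrow> 'a set" where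
  "centroid_scalars mu A ang =
     {z \<in> algebra_centre mu \<inter> A.
        (\<forall>\<alpha> \<beta>. ang (mu z \<alpha>) \<beta> = ang \<alpha> (mu z \<beta>)) \<and>
        (\<forall>(n::nat) \<alpha> \<beta>. (\<Sum>t<n. ang (\<alpha> t) (\<beta> t)) = 0 \<longrightarrow> (\<Sum>t<n. ang (mu z (\<alpha> t)) (\<beta> t)) = 0)}"

definition multiplies_by ::
  "'l set \<Rightarrow> 'a set \<Rightarrow> 'a set \<Rightarrow> ('a \<Rightarrow> 'a \<Rightarrow> 'a) \<Rightarrow> ('l \<Rightarrow> 'a \<Rightarrow> 'l) \<Rightarrow> ('w \<Rightarrow> 'a \<Rightarrow> 'l) \<Rightarrow>
   ('a \<Rightarrow> 'a \<Rightarrow> 'l) \<Rightarrow> 'a \<Rightarrow> ('l \<Rightarrow> 'l) \<Rightarrow> bool" where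
  "multiplies_by g A B mu gA WB ang z \<Psi> \<longleftrightarrow>
     (\<forall>x\<in>g. \<forall>a\<in>A. \<Psi> (gA x a) = gA x (mu z a)) \<and>
     (\<forall>w. \<forall>b\<in>B. \<Psi> (WB w b) = WB w (mu z b)) \<and>
     (\<forall>\<alpha> \<beta>. \<Psi> (ang \<alpha> \<beta>) = ang (mu z \<alpha>) \<beta> \<and> ang (mu z \<alpha>) \<beta> = ang \<alpha> (mu z \<beta>))"

text \<open>\<open>\<Theta>\<close> restricts to an isomorphism of unital algebras from \<open>Z\<close> (under \<open>mu\<close>) onto \<open>C\<close> (under
  composition).\<close>

definition algebra_isomorphism ::
  "('f \<Rightarrow> 'a \<Rightarrow> 'a) \<Rightarrow> ('a \<Rightarrow> 'a \<Rightarrow> 'a) \<Rightarrow> 'a \<Rightarrow> ('f \<Rightarrow> 'l \<Rightarrow> 'l) \<Rightarrow> 'a::ab_group_add set \<Rightarrow>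
   ('l::ab_group_add \<Rightarrow> 'l) set \<Rightarrow> ('a \<Rightarrow> 'l \<Rightarrow> 'l) \<Rightarrow> bool" where
  "algebra_isomorphism sA mu e sL Z C \<Theta> \<longleftrightarrow>
     bij_betw \<Theta> Z C \<and>
     e \<in> Z \<and> \<Theta> e = id \<and>
     (\<forall>z\<in>Z. \<forall>z'\<in>Z. z + z' \<in> Z \<and> \<Theta> (z + z') = (\<lambda>v. \<Theta> z v + \<Theta> z' v)) \<and>
     (\<forall>c. \<forall>z\<in>Z. sA c z \<in> Z \<and> \<Theta> (sA c z) = (\<lambda>v. sL c (\<Theta> z v))) \<and>
     (\<forall>z\<in>Z. \<forall>z'\<in>Z. mu z z' \<in> Z \<and> \<Theta> (mu z z') = \<Theta> z \<circ> \<Theta> z')"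

end

theory Submission
  imports Defs
begin

text \<open>A centroid element commutes with \<open>ad g\<close>.  The algebra is a sum of copies of the pairwise
  non-isomorphic \<open>g\<close>-modules \<open>g\<close>, \<open>W\<close> and the trivial module, and the endomorphisms of \<open>g\<close> and of
  \<open>W\<close> are scalars; so a centroid element has the form \<open>x \<otimes> a \<mapsto> x \<otimes> \<phi> a\<close>, \<open>w \<otimes> b \<mapsto> w \<otimes> \<psi> b\<close> and
  preserves \<open>D\<close>.  Comparing coefficients in the brackets turns \<open>\<phi>\<close> and \<open>\<psi>\<close> into multiplication by
  \<open>z = \<phi> 1\<close>, which has to be central.  Conversely, multiplication by \<open>z\<close> commutes with the adjoint
  action of \<open>g \<otimes> A\<close> and \<open>W \<otimes> B\<close>, and these generate the algebra.

  That \<open>g\<close> and \<open>W\<close> are not isomorphic is the statement that the highest root of \<open>g\<close> is long.\<close>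

section \<open>Weights of a split simple Lie algebra\<close>

text \<open>The field is neither ordered nor algebraically closed, and this shapes three arguments.
  In place of Schur's lemma an eigenvalue is exhibited, on a root vector of g or on the
  one-dimensional highest weight space of W. In place of Cartan's criterion the Killing form is
  nonzero because a coroot has integral eigenvalues, so that its norm is a sum of integer squares.
  Root lengths turn out to be positive rationals, and inequalities between them are read in the
  rationals. Since A and B may be infinite-dimensional, a homomorphism into g \<otimes> A or W
  \<otimes> B is cut into coordinates along a basis of A or B. Comparing coefficients meets one
  obstacle: for \<open>TypeC 2\<close> the skew part of b b' is invisible in the bracket, and the
  structure of the coordinate algebra has to make z central there. Conversely, condition (b) is what
  makes \<Psi> well defined on D, and \<Psi> respects the action of D because inner derivations are
  built from multiplications, through which a central element slides.\<close>

context lie_algebra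
begin

lemma br_add_left: "br (x + y) z = br x z + br y z"
  and br_add_right: "br x (y + z) = br x y + br x z"
  and br_scale_left: "br (scale c x) y = scale c (br x y)"
  and br_scale_right: "br x (scale c y) = scale c (br x y)"
  using br_bilinear by (auto simp: bilinear_on_def)

lemma linear_br: "Vector_Spaces.linear scale scale (br x)"
  by (simp add: Vector_Spaces.linear_iff vector_space_axioms br_add_right br_scale_right)

lemma br_anti: "br x y = - br y x"
proof -
  have "br x x + br y x + (br x y + br y y) = 0"
    using br_alternating[of "x + y"] by (simp only: br_add_left br_add_right)
  then show ?thesis by (simp add: br_alternating eq_neg_iff_add_eq_0 add.commute)
qed

lemma br_zero_right [simp]: "br x 0 = 0"
  by (metis br_scale_right scale_zero_left)

lemma br_zero_left [simp]: "br 0 x = 0"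
  by (metis br_scale_left scale_zero_left)

lemma br_minus_right: "br x (- y) = - br x y"
  using br_scale_right[of x "-1" y] by simp

lemma br_diff_right: "br x (y - z) = br x y - br x z"
  using br_add_right[of x y "- z"] by (simp add: br_minus_right)

lemma br_sum_right: "br x (sum f I) = (\<Sum>i\<in>I. br x (f i))"
  by (induction I rule: infinite_finite_induct) (auto simp: br_add_right)

lemma br_sum_left: "br (sum f I) x = (\<Sum>i\<in>I. br (f i) x)"
  by (induction I rule: infinite_finite_induct) (auto simp: br_add_left)

lemma br_br: "br (br x y) z = br x (br y z) - br y (br x z)"
proof -
  have "br x (br y z) + br y (br z x) + br z (br x y) = 0" by (rule jacobi)
  moreover have "br y (br z x) = - br y (br x z)"
    by (subst br_anti[of z x]) (rule br_minus_right)
  moreover have "br z (br x y) = - br (br x y) z" by (rule br_anti)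
  ultimately show ?thesis by (simp add: algebra_simps)
qed

lemma functionals_add:
  "\<lbrakk>\<alpha> \<in> functionals S; \<beta> \<in> functionals S\<rbrakk> \<Longrightarrow> (\<lambda>t. \<alpha> t + \<beta> t) \<in> functionals S"
  by (auto simp: functionals_def algebra_simps)

lemma functionals_mult: "\<alpha> \<in> functionals S \<Longrightarrow> (\<lambda>t. c * \<alpha> t) \<in> functionals S"
  by (auto simp: functionals_def algebra_simps)

lemma functionals_zero: "(\<lambda>t. 0) \<in> functionals S"
  by (auto simp: functionals_def)

lemma functionals_sum:
  "(\<And>i. i \<in> I \<Longrightarrow> f i \<in> functionals S) \<Longrightarrow> (\<lambda>t. \<Sum>i\<in>I. f i t) \<in> functionals S"
  by (induction I rule: infinite_finite_induct) (auto simp: functionals_zero functionals_add)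

end

section \<open>Linear independence of weight vectors\<close>

locale weight_module = M: vector_space sM
  for sM :: "'f::field \<Rightarrow> 'm::ab_group_add \<Rightarrow> 'm" +
  fixes h :: "'l set" and M :: "'m set" and act :: "'l \<Rightarrow> 'm \<Rightarrow> 'm"
  assumes M_subspace: "M.subspace M"
    and h_act_closed: "\<lbrakk>t \<in> h; v \<in> M\<rbrakk> \<Longrightarrow> act t v \<in> M"
    and h_act_add: "\<lbrakk>t \<in> h; u \<in> M; v \<in> M\<rbrakk> \<Longrightarrow> act t (u + v) = act t u + act t v"
    and h_act_scale: "\<lbrakk>t \<in> h; v \<in> M\<rbrakk> \<Longrightarrow> act t (sM c v) = sM c (act t v)"
begin

definition weight_vectors :: "('l \<Rightarrow> 'f) \<Rightarrow> 'm set" where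
  "weight_vectors \<mu> = {v \<in> M. \<forall>t\<in>h. act t v = sM (\<mu> t) v}"

lemma h_act_zero: "t \<in> h \<Longrightarrow> act t 0 = 0"
  using h_act_scale[of t 0 0] M.subspace_0[OF M_subspace] by simp

lemma weight_subspace: "M.subspace (weight_vectors \<mu>)"
  unfolding weight_vectors_def
  by (rule M.subspaceI)
    (auto simp: h_act_zero h_act_add h_act_scale M.scale_right_distrib M.scale_left_commute
      M.subspace_0[OF M_subspace] M.subspace_add[OF M_subspace] M.subspace_scale[OF M_subspace])

lemma h_act_sum: "\<lbrakk>t \<in> h; \<And>i. i \<in> I \<Longrightarrow> f i \<in> M\<rbrakk> \<Longrightarrow> act t (sum f I) = (\<Sum>i\<in>I. act t (f i))"
proof (induction I rule: infinite_finite_induct)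
  case (insert i I)
  then show ?case using M.subspace_sum[OF M_subspace, of I f] by (simp add: h_act_add)
qed (simp_all add: h_act_zero)

text \<open>Induction on the number of summands: applying \<open>act t\<close> and subtracting
  \<open>\<sigma> j t\<close> times the equation removes \<open>f j\<close> and rescales the other
  terms, while v is multiplied by the nonzero number \<open>\<mu> t - \<sigma> j t\<close>. The
  weights \<open>\<sigma> i\<close> may coincide with one another; what counts is that each differs
  from \<mu>.\<close>

lemma weight_vector_sum_zero:
  assumes "finite I" "\<And>i. i \<in> I \<Longrightarrow> f i \<in> weight_vectors (\<sigma> i)"
    and "\<And>i. i \<in> I \<Longrightarrow> \<exists>t\<in>h. \<sigma> i t \<noteq> \<mu> t" "v \<in> weight_vectors \<mu>" "v = sum f I"
  shows "v = 0"
  using assms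
proof (induction I arbitrary: f v rule: finite_induct)
  case (insert j I)
  obtain t where t: "t \<in> h" "\<sigma> j t \<noteq> \<mu> t" using insert.prems by blast
  have fM: "f i \<in> M" if "i \<in> insert j I" for i
    using insert.prems(1)[OF that] by (simp add: weight_vectors_def)
  have "act t v = sM (\<mu> t) v" using insert.prems t by (simp add: weight_vectors_def)
  moreover have "act t v = (\<Sum>i\<in>insert j I. act t (f i))"
    unfolding insert.prems(4) by (rule h_act_sum) (use t fM in auto)
  moreover have "\<dots> = (\<Sum>i\<in>insert j I. sM (\<sigma> i t) (f i))"
    by (rule sum.cong) (use insert.prems(1) t in \<open>auto simp: weight_vectors_def\<close>)
  ultimately have 1: "sM (\<mu> t) v = (\<Sum>i\<in>insert j I. sM (\<sigma> i t) (f i))" by simp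
  have 2: "sM (\<sigma> j t) v = (\<Sum>i\<in>insert j I. sM (\<sigma> j t) (f i))"
    unfolding insert.prems(4) by (rule M.scale_sum_right)
  have "sM (\<mu> t - \<sigma> j t) v = (\<Sum>i\<in>insert j I. sM (\<sigma> i t - \<sigma> j t) (f i))"
    by (simp add: 1 2 M.scale_left_diff_distrib sum_subtractf del: sum.insert)
  also have "\<dots> = (\<Sum>i\<in>I. sM (\<sigma> i t - \<sigma> j t) (f i))"
    using insert.hyps by simp
  finally have eq: "sM (\<mu> t - \<sigma> j t) v = (\<Sum>i\<in>I. sM (\<sigma> i t - \<sigma> j t) (f i))" .
  have "sM (\<mu> t - \<sigma> j t) v = 0"
  proof (rule insert.IH[OF _ _ _ eq])
    show "sM (\<mu> t - \<sigma> j t) v \<in> weight_vectors \<mu>"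
      by (rule M.subspace_scale[OF weight_subspace insert.prems(3)])
  qed (use insert.prems M.subspace_scale[OF weight_subspace] in blast)+
  then show ?case using t by simp
qed simp

text \<open>In this form the independence applies to spanning sets of weight vectors, where several
  generators may share a weight. It identifies the weights of a highest weight module below.\<close>

lemma weight_vector_span_zero:
  assumes "v \<in> weight_vectors \<mu>" "v \<in> M.span Y"
    and "\<And>y. y \<in> Y \<Longrightarrow> \<exists>\<sigma>. y \<in> weight_vectors \<sigma> \<and> (\<exists>t\<in>h. \<sigma> t \<noteq> \<mu> t)"
  shows "v = 0"
proof -
  obtain \<sigma> where \<sigma>: "\<And>y. y \<in> Y \<Longrightarrow> y \<in> weight_vectors (\<sigma> y) \<and> (\<exists>t\<in>h. \<sigma> y t \<noteq> \<mu> t)"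
    using assms(3) by metis
  obtain I c where "finite I" "I \<subseteq> Y" "v = (\<Sum>y\<in>I. sM (c y) y)"
    using assms(2) by (auto simp: M.span_explicit)
  then show ?thesis
    using \<sigma> assms(1) M.subspace_scale[OF weight_subspace]
    by (intro weight_vector_sum_zero[of I "\<lambda>y. sM (c y) y" \<sigma>]) (auto simp: subset_iff)
qed

lemma weight_vectors_independent:
  assumes "finite I" "\<And>i. i \<in> I \<Longrightarrow> f i \<in> weight_vectors (\<sigma> i)"
    and "\<And>i j. \<lbrakk>i \<in> I; j \<in> I; i \<noteq> j\<rbrakk> \<Longrightarrow> \<exists>t\<in>h. \<sigma> i t \<noteq> \<sigma> j t" "sum f I = 0" "i \<in> I"
  shows "f i = 0"
proof (rule weight_vector_sum_zero[where I = "I - {i}" and f = "\<lambda>j. - f j" and \<sigma> = \<sigma> and \<mu> = "\<sigma> i"])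
  show "f i = (\<Sum>j\<in>I - {i}. - f j)"
    using assms by (simp add: sum_negf sum_diff1)
qed (use assms M.subspace_neg[OF weight_subspace] in auto)

end

section \<open>Root space decomposition of a split simple Lie algebra\<close>

locale split_simple = lie_algebra scale br
  for scale :: "'f::field_char_0 \<Rightarrow> 'l::ab_group_add \<Rightarrow> 'l" and br +
  fixes g h :: "'l set"
  assumes finite_dim: "\<exists>E. finite E \<and> span E = g"
    and simple: "simple_subalgebra g"
    and split_cartan: "split_cartan_subalgebra g h"
begin

abbreviation rootset where "rootset \<equiv> roots g h"
abbreviation gspace where "gspace \<equiv> weight_space h g"
abbreviation weightset where "weightset \<equiv> insert (\<lambda>_. 0) rootset"

lemma g_subspace: "subspace g" and g_br: "\<lbrakk>x \<in> g; y \<in> g\<rbrakk> \<Longrightarrow> br x y \<in> g"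
  using simple by (auto simp: simple_subalgebra_def lie_subalgebra_def)

lemma h_subspace: "subspace h" and h_subset: "h \<subseteq> g"
  and h_nilpotent: "\<exists>n. lower_central h n = {0}"
  and h_normalizer: "{x \<in> g. \<forall>t\<in>h. br x t \<in> h} = h"
  using split_cartan
  by (auto simp: split_cartan_subalgebra_def cartan_subalgebra_def lie_subalgebra_def)

lemma ideal_cases: "lie_ideal g I \<Longrightarrow> I = {0} \<or> I = g"
  and not_abelian: "\<exists>x\<in>g. \<exists>y\<in>g. br x y \<noteq> 0"
  using simple by (auto simp: simple_subalgebra_def)

lemma finite_roots: "finite rootset"
  using split_cartan by (simp add: split_cartan_subalgebra_def internal_direct_sum_def)

lemma weight_decomposition:
  assumes "x \<in> g"
  shows "\<exists>f. (\<forall>\<mu>\<in>weightset. f \<mu> \<in> gspace \<mu>) \<and> x = (\<Sum>\<mu>\<in>weightset. f \<mu>)"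
  using split_cartan assms unfolding split_cartan_subalgebra_def internal_direct_sum_def
  by (metis PiE_mem)

sublocale adj: weight_module scale h g br
  rewrites "adj.weight_vectors = gspace"
proof -
  show *: "weight_module scale h g br"
    by unfold_locales (use g_subspace g_br h_subset br_add_right br_scale_right in auto)
  show "weight_module.weight_vectors scale h g br = gspace"
    by (simp add: weight_module.weight_vectors_def[OF *] weight_space_def fun_eq_iff)
qed

lemma gspace_D: "x \<in> gspace \<mu> \<Longrightarrow> t \<in> h \<Longrightarrow> br t x = scale (\<mu> t) x"
  and gspace_g: "x \<in> gspace \<mu> \<Longrightarrow> x \<in> g"
  by (auto simp: weight_space_def)

lemma gspace_br: "\<lbrakk>x \<in> gspace \<mu>; y \<in> gspace \<nu>\<rbrakk> \<Longrightarrow> br x y \<in> gspace (\<lambda>t. \<mu> t + \<nu> t)"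
proof -
  assume x: "x \<in> gspace \<mu>" and y: "y \<in> gspace \<nu>"
  have "br t (br x y) = scale (\<mu> t + \<nu> t) (br x y)" if t: "t \<in> h" for t
  proof -
    have "br t (br x y) = br (br t x) y + br x (br t y)" by (simp add: br_br)
    also have "\<dots> = scale (\<mu> t + \<nu> t) (br x y)"
      using t x y by (simp add: gspace_D br_scale_left br_scale_right scale_left_distrib)
    finally show ?thesis .
  qed
  then show ?thesis using x y by (auto simp: weight_space_def g_br)
qed

lemma weight_in_weightset:
  "\<lbrakk>\<mu> \<in> functionals h; v \<in> gspace \<mu>; v \<noteq> 0\<rbrakk> \<Longrightarrow> \<mu> \<in> weightset"
  by (auto simp: roots_def)

lemma weightset_functionals: "\<mu> \<in> weightset \<Longrightarrow> \<mu> \<in> functionals h"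
  by (auto simp: roots_def functionals_zero)

lemma functional_eqI:
  "\<lbrakk>\<mu> \<in> functionals h; \<nu> \<in> functionals h; \<And>t. t \<in> h \<Longrightarrow> \<mu> t = \<nu> t\<rbrakk> \<Longrightarrow> \<mu> = \<nu>"
  unfolding functionals_def by (auto simp: fun_eq_iff) metis

lemma functional_neq: "\<lbrakk>\<mu> \<in> functionals h; \<nu> \<in> functionals h; \<mu> \<noteq> \<nu>\<rbrakk> \<Longrightarrow> \<exists>t\<in>h. \<mu> t \<noteq> \<nu> t"
  using functional_eqI by blast

text \<open>A Cartan subalgebra is only nilpotent by definition. Nilpotency gives
  \<open>(br t ^^ n) s = 0\<close>; on the component of s of weight \<mu> this reads
  \<open>\<mu> t ^ n = 0\<close> unless the component vanishes. Hence already the first power of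
  \<open>br t\<close> kills every component.\<close>

lemma h_abelian:
  assumes t: "t \<in> h" and s: "s \<in> h"
  shows "br t s = 0"
proof -
  obtain f where f: "\<forall>\<mu>\<in>weightset. f \<mu> \<in> gspace \<mu>" and sf: "s = (\<Sum>\<mu>\<in>weightset. f \<mu>)"
    using weight_decomposition s h_subset by (meson subsetD)
  obtain n where n: "lower_central h n = {0}" using h_nilpotent by blast
  have "(br t ^^ k) s \<in> lower_central h k" for k
  proof (induction k)
    case (Suc k)
    then show ?case using t by (auto simp: bracket_span_def intro: span_base)
  qed (use s in simp)
  then have nil: "(br t ^^ n) s = 0" using n by auto
  have pow: "(br t ^^ k) s = (\<Sum>\<mu>\<in>weightset. scale (\<mu> t ^ k) (f \<mu>))" for k
  proof (induction k)
    case (Suc k)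
    have "br t (scale (\<mu> t ^ k) (f \<mu>)) = scale (\<mu> t ^ Suc k) (f \<mu>)" if "\<mu> \<in> weightset" for \<mu>
      unfolding br_scale_right gspace_D[OF bspec[OF f that] t] by (simp add: mult.commute)
    then show ?case using Suc by (simp add: br_sum_right del: insert_iff)
  qed (simp add: sf)
  have "scale (\<mu> t ^ n) (f \<mu>) = 0" if "\<mu> \<in> weightset" for \<mu>
  proof (rule adj.weight_vectors_independent[where \<sigma> = id and I = weightset])
    show "(\<Sum>\<mu>\<in>weightset. scale (\<mu> t ^ n) (f \<mu>)) = 0" using pow nil by metis
    show "\<exists>t\<in>h. id \<mu> t \<noteq> id \<nu> t" if "\<mu> \<in> weightset" "\<nu> \<in> weightset" "\<mu> \<noteq> \<nu>" for \<mu> \<nu>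
      using functional_neq weightset_functionals that by auto
  qed (use that f finite_roots subspace_scale[OF adj.weight_subspace] in auto)
  then have "scale (\<mu> t) (f \<mu>) = 0" if "\<mu> \<in> weightset" for \<mu>
    using that by (metis power_eq_0_iff scale_eq_0_iff scale_zero_left)
  then have "(br t ^^ 1) s = 0" unfolding pow by (intro sum.neutral) (auto simp del: insert_iff)
  then show ?thesis by simp
qed

text \<open>An element of weight 0 commutes with h, so it normalises h, and h is its own
  normaliser.\<close>

lemma h_eq: "h = gspace (\<lambda>_. 0)"
proof
  show "h \<subseteq> gspace (\<lambda>_. 0)" using h_abelian h_subset by (auto simp: weight_space_def)
  show "gspace (\<lambda>_. 0) \<subseteq> h"
  proof
    fix x assume x: "x \<in> gspace (\<lambda>_. 0)"
    then have "br x t \<in> h" if "t \<in> h" for t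
      using gspace_D[OF x that] br_anti[of x t] subspace_0[OF h_subspace] by simp
    then show "x \<in> h" using h_normalizer gspace_g[OF x] by blast
  qed
qed

lemma rootsD:
  assumes "\<alpha> \<in> rootset"
  shows "\<alpha> \<in> functionals h" "\<exists>t\<in>h. \<alpha> t \<noteq> 0" "\<exists>x. x \<in> gspace \<alpha> \<and> x \<noteq> 0"
proof -
  show f: "\<alpha> \<in> functionals h" using assms by (simp add: roots_def)
  show "\<exists>t\<in>h. \<alpha> t \<noteq> 0" using functional_neq[OF f functionals_zero] assms by (simp add: roots_def)
  show "\<exists>x. x \<in> gspace \<alpha> \<and> x \<noteq> 0"
    using assms subspace_0[OF adj.weight_subspace] by (auto simp: roots_def)
qed

lemma functional_add: "\<lbrakk>\<alpha> \<in> functionals h; s \<in> h; t \<in> h\<rbrakk> \<Longrightarrow> \<alpha> (s + t) = \<alpha> s + \<alpha> t"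
  and functional_scale: "\<lbrakk>\<alpha> \<in> functionals h; t \<in> h\<rbrakk> \<Longrightarrow> \<alpha> (scale c t) = c * \<alpha> t"
  by (auto simp: functionals_def)

lemma centre_zero:
  assumes "x \<in> g" "\<And>y. y \<in> g \<Longrightarrow> br y x = 0"
  shows "x = 0"
proof -
  have "lie_ideal g {x \<in> g. \<forall>y\<in>g. br y x = 0}"
    unfolding lie_ideal_def
    by (auto intro!: subspaceI simp: subspace_0[OF g_subspace] subspace_add[OF g_subspace]
        subspace_scale[OF g_subspace] br_add_right br_scale_right)
  moreover have "{x \<in> g. \<forall>y\<in>g. br y x = 0} \<noteq> g" using not_abelian by blast
  ultimately have "{x \<in> g. \<forall>y\<in>g. br y x = 0} = {0}" using ideal_cases by blast
  then show ?thesis using assms by blast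
qed

lemma perfect: "span {br x y |x y. x \<in> g \<and> y \<in> g} = g"
proof -
  let ?D = "span {br x y |x y. x \<in> g \<and> y \<in> g}"
  have sub: "?D \<subseteq> g" by (rule span_minimal) (use g_br g_subspace in auto)
  have "br x y \<in> ?D" if "x \<in> g" "y \<in> ?D" for x y
    by (rule span_base) (use that sub in blast)
  then have "lie_ideal g ?D"
    unfolding lie_ideal_def using sub by blast
  moreover obtain x y where xy: "x \<in> g" "y \<in> g" "br x y \<noteq> 0" using not_abelian by blast
  then have "br x y \<in> ?D" by (intro span_base) blast
  then have "?D \<noteq> {0}" using xy(3) by blast
  ultimately show ?thesis using ideal_cases by blast
qed

lemma g_span_weights: "g = span (\<Union>\<mu>\<in>weightset. gspace \<mu>)"
proof
  show "g \<subseteq> span (\<Union>\<mu>\<in>weightset. gspace \<mu>)"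
  proof
    fix x assume "x \<in> g"
    obtain f where f: "\<forall>\<mu>\<in>weightset. f \<mu> \<in> gspace \<mu>" "x = (\<Sum>\<mu>\<in>weightset. f \<mu>)"
      using weight_decomposition[OF \<open>x \<in> g\<close>] by (elim exE conjE) (rule that)
    show "x \<in> span (\<Union>\<mu>\<in>weightset. gspace \<mu>)"
      unfolding f(2) by (intro span_sum span_base UN_I) (use f(1) in auto)
  qed
  show "span (\<Union>\<mu>\<in>weightset. gspace \<mu>) \<subseteq> g"
    by (rule span_minimal) (use gspace_g g_subspace in auto)
qed

text \<open>Such a t commutes with all weight spaces, so it is central in g.\<close>

lemma roots_vanish_zero:
  assumes t: "t \<in> h" and "\<And>\<alpha>. \<alpha> \<in> rootset \<Longrightarrow> \<alpha> t = 0"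
  shows "t = 0"
proof (rule centre_zero)
  show "t \<in> g" using t h_subset by blast
  fix y assume "y \<in> g"
  then have "y \<in> span (\<Union>\<mu>\<in>weightset. gspace \<mu>)" using g_span_weights by blast
  then show "br y t = 0"
  proof (induction rule: span_induct_alt)
    case (step c x y)
    then have "br t x = 0" using gspace_D t assms(2) by fastforce
    then show ?case using step br_anti[of x t] by (simp add: br_add_left br_scale_left)
  qed simp
qed

text \<open>As g is perfect, t is a sum of brackets of weight vectors: those of opposite weights lie
  in h, all others in root spaces. The root spaces stay in the spanning set; the independence of
  weight vectors disposes of them where the lemma is applied.\<close>

lemma h_span_brackets:
  assumes "t \<in> h"
  shows "t \<in> span ({br x y |x y \<alpha>. \<alpha> \<in> rootset \<and> x \<in> gspace \<alpha> \<and> y \<in> gspace (\<lambda>t. - \<alpha> t)}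
    \<union> (\<Union>\<alpha>\<in>rootset. gspace \<alpha>))" (is "t \<in> span ?R")
proof -
  have base: "br x y \<in> span ?R" if "\<mu> \<in> weightset" "\<nu> \<in> weightset" "x \<in> gspace \<mu>" "y \<in> gspace \<nu>"
    for x y \<mu> \<nu>
  proof (cases "br x y = 0")
    case False
    have xy: "br x y \<in> gspace (\<lambda>t. \<mu> t + \<nu> t)" using gspace_br that by blast
    have w: "(\<lambda>t. \<mu> t + \<nu> t) \<in> weightset"
      using weight_in_weightset[OF _ xy False] functionals_add weightset_functionals that by blast
    show ?thesis
    proof (cases "(\<lambda>t. \<mu> t + \<nu> t) = (\<lambda>t. 0)")
      case True
      then have \<nu>: "\<nu> = (\<lambda>t. - \<mu> t)" by (auto simp: fun_eq_iff eq_neg_iff_add_eq_0 add.commute)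
      have "\<mu> \<in> rootset"
      proof (rule ccontr)
        assume "\<mu> \<notin> rootset"
        then have "x \<in> h" "y \<in> h" using that \<nu> h_eq by auto
        then show False using False h_abelian by blast
      qed
      then have "br x y \<in> ?R" using that(3,4) unfolding \<nu> by blast
      then show ?thesis by (rule span_base)
    next
      case False
      then have "br x y \<in> ?R" using w xy by blast
      then show ?thesis by (rule span_base)
    qed
  qed (simp add: span_zero)
  have "br x y \<in> span ?R" if "x \<in> g" "y \<in> g" for x y
  proof -
    obtain f where f: "\<forall>\<mu>\<in>weightset. f \<mu> \<in> gspace \<mu>" "x = (\<Sum>\<mu>\<in>weightset. f \<mu>)"
      using weight_decomposition[OF \<open>x \<in> g\<close>] by (elim exE conjE) (rule that)
    obtain f' where f': "\<forall>\<mu>\<in>weightset. f' \<mu> \<in> gspace \<mu>" "y = (\<Sum>\<mu>\<in>weightset. f' \<mu>)"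
      using weight_decomposition[OF \<open>y \<in> g\<close>] by (elim exE conjE) (rule that)
    have "br x y = (\<Sum>\<mu>\<in>weightset. \<Sum>\<nu>\<in>weightset. br (f \<nu>) (f' \<mu>))"
      unfolding f(2) f'(2) by (simp only: br_sum_left br_sum_right)
    also have "\<dots> \<in> span ?R" by (intro span_sum base[OF _ _ bspec[OF f(1)] bspec[OF f'(1)]])
    finally show ?thesis .
  qed
  then have "span {br x y |x y. x \<in> g \<and> y \<in> g} \<subseteq> span ?R"
    by (intro span_minimal subspace_span subsetI) blast
  then show ?thesis using assms h_subset unfolding perfect by blast
qed

lemma roots_nonempty: "\<exists>\<alpha>. \<alpha> \<in> rootset"
proof (rule ccontr)
  assume "\<nexists>\<alpha>. \<alpha> \<in> rootset"
  then have "g = h" using g_span_weights h_eq h_subspace by (simp add: span_eq_iff[THEN iffD2])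
  then show False using h_abelian not_abelian by blast
qed

lemma weight_nonzero:
  assumes "\<mu> \<in> weightset"
  shows "\<exists>v. v \<in> gspace \<mu> \<and> v \<noteq> 0"
proof (cases "\<mu> \<in> rootset")
  case False
  then have "\<mu> = (\<lambda>_. 0)" using assms by blast
  moreover have "h \<noteq> {0}" using roots_nonempty rootsD functional_scale[of _ 0 0] by fastforce
  ultimately show ?thesis using h_eq subspace_0[OF h_subspace] by blast
qed (use rootsD in blast)

section \<open>Root strings\<close>

lemma gspace_shift_iterate:
  assumes y: "y \<in> gspace \<delta>" and v: "v \<in> gspace \<mu>"
  shows "(br y ^^ k) v \<in> gspace (\<lambda>t. \<mu> t + of_nat k * \<delta> t)"
proof (induction k)
  case (Suc k)
  then show ?case using gspace_br[OF y Suc] by (simp add: algebra_simps)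
qed (use v in simp)

text \<open>If no iterate vanished, all \<open>\<mu> + k \<delta>\<close> would be weights; in
  characteristic 0 they are pairwise distinct, and there are only finitely many weights.\<close>

lemma gspace_shift_nilpotent:
  assumes y: "y \<in> gspace \<delta>" and v: "v \<in> gspace \<mu>" and \<delta>: "\<delta> \<in> functionals h" "\<delta> \<noteq> (\<lambda>_. 0)"
    and \<mu>: "\<mu> \<in> functionals h"
  shows "\<exists>k. (br y ^^ k) v = 0"
proof (rule ccontr)
  assume *: "\<nexists>k. (br y ^^ k) v = 0"
  let ?f = "\<lambda>k t. \<mu> t + of_nat k * \<delta> t"
  have "range ?f \<subseteq> weightset"
  proof (rule image_subsetI)
    fix k
    show "?f k \<in> weightset"
      using weight_in_weightset[OF _ gspace_shift_iterate[OF y v, of k]] *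
        functionals_add[OF \<mu> functionals_mult[OF \<delta>(1)]] by blast
  qed
  then have "finite (range ?f)" using finite_roots finite_subset by blast
  moreover have "inj ?f"
  proof (rule injI)
    fix k l assume eq: "?f k = ?f l"
    obtain t where "\<delta> t \<noteq> 0" using \<delta>(2) by blast
    then show "k = l" using fun_cong[OF eq, of t] by simp
  qed
  ultimately show False using finite_imageD[of ?f UNIV] by auto
qed

lemma last_nonzero_iterate:
  assumes "v \<noteq> 0" "\<exists>k. (f ^^ k) v = 0"
  obtains j where "(f ^^ j) v \<noteq> 0" "f ((f ^^ j) v) = 0"
proof -
  obtain k where "(f ^^ k) v = 0" "\<forall>i<k. (f ^^ i) v \<noteq> 0"
    using assms(2) exists_least_iff[of "\<lambda>k. (f ^^ k) v = 0"] by blast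
  then show ?thesis using assms(1) that by (cases k) auto
qed

text \<open>Lower \<open>v \<in> g\<^sub>\<beta>\<close> by \<open>y\<close> to the last nonzero \<open>w = y\<^sup>j v\<close>, then raise \<open>w\<close> by \<open>x\<close> to the last nonzero
  \<open>x\<^sup>N w\<close>; applying \<open>y\<close> to \<open>x\<^bsup>N+1\<^esup> w = 0\<close> gives the equation.  The case \<open>\<alpha> [x, y] = 0\<close> is included.\<close>

lemma root_string:
  assumes \<alpha>: "\<alpha> \<in> functionals h" "\<alpha> \<noteq> (\<lambda>_. 0)" and x: "x \<in> gspace \<alpha>" and y: "y \<in> gspace (\<lambda>t. - \<alpha> t)"
    and \<beta>: "\<beta> \<in> weightset"
  shows "\<exists>j N :: nat. 2 * \<beta> (br x y) = (2 * of_nat j - of_nat N) * \<alpha> (br x y) \<and>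
    (\<forall>i\<le>N. (\<lambda>t. \<beta> t + (of_nat i - of_nat j) * \<alpha> t) \<in> weightset)"
proof -
  have \<beta>f: "\<beta> \<in> functionals h" using weightset_functionals \<beta> by blast
  have \<alpha>': "(\<lambda>t. - \<alpha> t) \<in> functionals h" using functionals_mult[OF \<alpha>(1), of "-1"] by simp
  obtain v where v: "v \<in> gspace \<beta>" "v \<noteq> 0" using weight_nonzero \<beta> by blast
  have "\<exists>k. (br y ^^ k) v = 0"
    by (rule gspace_shift_nilpotent[OF y v(1) \<alpha>' _ \<beta>f]) (use \<alpha>(2) in \<open>auto simp: fun_eq_iff\<close>)
  then obtain j where j: "(br y ^^ j) v \<noteq> 0" "br y ((br y ^^ j) v) = 0"
    using last_nonzero_iterate v(2) by metis
  define w where "w = (br y ^^ j) v"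
  define \<mu> where "\<mu> = (\<lambda>t. \<beta> t + of_nat j * (- \<alpha> t))"
  have w: "w \<in> gspace \<mu>" unfolding w_def \<mu>_def by (rule gspace_shift_iterate[OF y v(1)])
  have \<mu>: "\<mu> \<in> functionals h" unfolding \<mu>_def by (rule functionals_add[OF \<beta>f functionals_mult[OF \<alpha>']])
  obtain N where N: "(br x ^^ N) w \<noteq> 0" "br x ((br x ^^ N) w) = 0"
    using last_nonzero_iterate[of w] gspace_shift_nilpotent[OF x w \<alpha> \<mu>] j(1) w_def by metis
  define u where "u k = (br x ^^ k) w" for k
  have u: "u k \<in> gspace (\<lambda>t. \<mu> t + of_nat k * \<alpha> t)" for k
    unfolding u_def by (rule gspace_shift_iterate[OF x w])
  have u_Suc: "u (Suc k) = br x (u k)" for k by (simp add: u_def)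
  let ?t = "br x y"
  have "?t \<in> gspace (\<lambda>t. \<alpha> t + - \<alpha> t)" by (rule gspace_br[OF x y])
  then have t: "?t \<in> h" using h_eq by simp
  have step: "br y (u (Suc k)) = br x (br y (u k)) - scale (\<mu> ?t + of_nat k * \<alpha> ?t) (u k)" for k
    using br_br[of x y "u k"] gspace_D[OF u t, of k] by (simp add: u_Suc algebra_simps)
  \<comment> \<open>The coefficient is the sum of \<open>\<mu> + i \<alpha>\<close> over
    \<open>i \<le> k\<close>, evaluated at \<open>[x, y]\<close>; the factor 2 clears the
    denominator of this arithmetic progression.\<close>
  have formula: "scale 2 (br y (u (Suc k))) =
      - scale (of_nat (Suc k) * (2 * \<mu> ?t + of_nat k * \<alpha> ?t)) (u k)" for k
  proof (induction k)
    case 0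
    have "br y (u 0) = 0" using j(2) by (simp add: u_def w_def)
    then show ?case unfolding step by (simp add: scale_minus_right)
  next
    case (Suc k)
    have "scale 2 (br y (u (Suc (Suc k)))) = br x (scale 2 (br y (u (Suc k))))
        - scale (2 * (\<mu> ?t + of_nat (Suc k) * \<alpha> ?t)) (u (Suc k))"
      unfolding step[of "Suc k"] by (simp add: br_scale_right scale_right_diff_distrib)
    also have "\<dots> = - scale (of_nat (Suc k) * (2 * \<mu> ?t + of_nat k * \<alpha> ?t)
        + 2 * (\<mu> ?t + of_nat (Suc k) * \<alpha> ?t)) (u (Suc k))"
      unfolding Suc by (simp add: br_minus_right br_scale_right u_Suc scale_left_distrib)
    also have "of_nat (Suc k) * (2 * \<mu> ?t + of_nat k * \<alpha> ?t) + 2 * (\<mu> ?t + of_nat (Suc k) * \<alpha> ?t)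
        = of_nat (Suc (Suc k)) * (2 * \<mu> ?t + of_nat (Suc k) * \<alpha> ?t)"
      by (simp add: algebra_simps)
    finally show ?case .
  qed
  have "scale (of_nat (Suc N) * (2 * \<mu> ?t + of_nat N * \<alpha> ?t)) (u N) = 0"
    using formula[of N] N(2) by (simp add: u_def)
  then have "2 * \<mu> ?t + of_nat N * \<alpha> ?t = 0"
    using N(1) by (simp add: u_def del: of_nat_Suc)
  then have "2 * \<beta> ?t = (2 * of_nat j - of_nat N) * \<alpha> ?t"
    by (simp add: \<mu>_def algebra_simps add_eq_0_iff)
  moreover have "(\<lambda>t. \<beta> t + (of_nat i - of_nat j) * \<alpha> t) \<in> weightset" if "i \<le> N" for i
  proof -
    have "u i \<noteq> 0"
    proof
      assume "u i = 0"
      moreover have "u (i + k) = (br x ^^ k) (u i)" for k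
        by (induction k) (auto simp: u_Suc)
      moreover have "(br x ^^ k) 0 = 0" for k by (induction k) auto
      ultimately have "u N = 0" using that by (metis le_Suc_ex)
      then show False using N(1) by (simp add: u_def)
    qed
    then have "(\<lambda>t. \<mu> t + of_nat i * \<alpha> t) \<in> weightset"
      using weight_in_weightset[OF functionals_add[OF \<mu> functionals_mult[OF \<alpha>(1)]] u] by blast
    then show ?thesis by (simp add: \<mu>_def algebra_simps)
  qed
  ultimately show ?thesis by blast
qed

end

section \<open>The Killing form\<close>

context vector_space
begin

text \<open>This is \<open>tr (f' f) = tr (f f')\<close> for maps between two different spaces with
  bases E and E'. It yields all that is needed about traces: independence of the basis (f' the
  identity), symmetry of the Killing form, and cyclicity for three factors.\<close>

lemma trace_swap:
  assumes E: "finite E" "independent E" and E': "finite E'" "independent E'"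
    and f: "Vector_Spaces.linear scale scale f" "\<And>e. e \<in> E \<Longrightarrow> f e \<in> span E'"
    and f': "Vector_Spaces.linear scale scale f'" "\<And>e. e \<in> E' \<Longrightarrow> f' e \<in> span E"
  shows "(\<Sum>e\<in>E. representation E (f' (f e)) e) = (\<Sum>e\<in>E'. representation E' (f (f' e)) e)"
proof -
  have half: "representation B (k (j e)) b =
      (\<Sum>c\<in>C. representation C (j e) c * representation B (k c) b)"
    if "independent B" "finite C" "independent C" "Vector_Spaces.linear scale scale k"
      "\<And>c. c \<in> C \<Longrightarrow> k c \<in> span B" "j e \<in> span C" for B C k j e b
  proof -
    interpret k: Vector_Spaces.linear scale scale k by fact
    have "k (j e) = k (\<Sum>c\<in>C. scale (representation C (j e) c) c)"
      using sum_representation_eq[of C "j e" C] that by simp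
    also have "\<dots> = (\<Sum>c\<in>C. scale (representation C (j e) c) (k c))"
      by (simp add: k.sum k.scale)
    finally show ?thesis
      using that by (simp add: representation_sum representation_scale span_scale)
  qed
  have "(\<Sum>e\<in>E. representation E (f' (f e)) e) =
      (\<Sum>e\<in>E. \<Sum>c\<in>E'. representation E' (f e) c * representation E (f' c) e)"
    by (intro sum.cong half) (use assms in auto)
  also have "\<dots> = (\<Sum>c\<in>E'. \<Sum>e\<in>E. representation E (f' c) e * representation E' (f e) c)"
    by (subst sum.swap) (simp add: mult.commute)
  also have "\<dots> = (\<Sum>c\<in>E'. representation E' (f (f' c)) c)"
    by (intro sum.cong half[symmetric]) (use assms in auto)
  finally show ?thesis .
qed

end

context split_simple
begin

abbreviation killing where "killing \<equiv> killing_form g"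

text \<open>The definition picks some basis G. With f' the identity, \<open>trace_swap\<close> moves
  the trace from G to the given E.\<close>

lemma killing_form_basis:
  assumes E: "independent E" "span E = g" and "x \<in> g" "y \<in> g"
  shows "killing x y = (\<Sum>e\<in>E. representation E (br x (br y e)) e)"
proof -
  obtain F where F: "finite F" "span F = g" using finite_dim by blast
  define G where "G = (SOME E. independent E \<and> span E = g)"
  have G: "independent G \<and> span G = g"
    unfolding G_def by (rule someI[of "\<lambda>E. independent E \<and> span E = g" E]) (use E in simp)
  have fin: "finite B" if "span B = g" "independent B" for B
    using independent_span_bound[OF F(1), of B] that F(2) span_superset by blast
  interpret vector_space_pair scale scale ..
  have comp: "Vector_Spaces.linear scale scale (\<lambda>e. br x (br y e))"
    using Vector_Spaces.linear_compose[OF linear_br[of y] linear_br[of x]] by (simp add: comp_def)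
  have mem: "e \<in> g" "br x (br y e) \<in> g" if "e \<in> G \<or> e \<in> E" for e
    using that G E assms(3,4) g_br span_superset[of G] span_superset[of E] by blast+
  have "(\<Sum>e\<in>G. representation G (br x (br y e)) e) = (\<Sum>e\<in>E. representation E (br x (br y e)) e)"
  proof (rule trace_swap[where f = "\<lambda>e. br x (br y e)" and f' = "\<lambda>e. e"])
    show "Vector_Spaces.linear scale scale (\<lambda>e. e)" using linear_id by (simp add: id_def)
  qed (use G E fin comp mem in auto)
  then show ?thesis by (simp add: killing_form_def G_def Let_def)
qed

lemma weight_basis:
  obtains E where "finite E" "independent E" "span E = g" "E \<subseteq> (\<Union>\<mu>\<in>weightset. gspace \<mu>)"
proof -
  obtain E where E: "E \<subseteq> (\<Union>\<mu>\<in>weightset. gspace \<mu>)" "independent E"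
    "(\<Union>\<mu>\<in>weightset. gspace \<mu>) \<subseteq> span E"
    using maximal_independent_subset by blast
  obtain F where F: "finite F" "span F = g" using finite_dim by blast
  have "span E = g"
    using E g_span_weights by (metis span_minimal span_mono subset_antisym subspace_span)
  then show ?thesis
    using that E independent_span_bound[OF F(1), of E] F(2) span_superset by blast
qed

lemma killing_sym: "\<lbrakk>x \<in> g; y \<in> g\<rbrakk> \<Longrightarrow> killing x y = killing y x"
proof -
  assume xy: "x \<in> g" "y \<in> g"
  obtain E where E: "finite E" "independent E" "span E = g" by (rule weight_basis)
  then have "E \<subseteq> g" using span_superset by blast
  then have "(\<Sum>e\<in>E. representation E (br x (br y e)) e) = (\<Sum>e\<in>E. representation E (br y (br x e)) e)"
    by (intro trace_swap linear_br) (use E xy g_br in auto)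
  then show ?thesis by (simp add: killing_form_basis[OF E(2,3)] xy)
qed

lemma killing_add_left: "\<lbrakk>x \<in> g; x' \<in> g; y \<in> g\<rbrakk> \<Longrightarrow> killing (x + x') y = killing x y + killing x' y"
proof -
  assume xy: "x \<in> g" "x' \<in> g" "y \<in> g"
  obtain E where E: "finite E" "independent E" "span E = g" by (rule weight_basis)
  then have "E \<subseteq> g" using span_superset by blast
  then have "br x (br y e) \<in> span E" "br x' (br y e) \<in> span E" if "e \<in> E" for e
    using E(3) that xy g_br by auto
  then show ?thesis
    using xy subspace_add[OF g_subspace] E
    by (simp add: killing_form_basis[OF E(2,3)] br_add_left representation_add sum.distrib)
qed

lemma killing_scale_left: "\<lbrakk>x \<in> g; y \<in> g\<rbrakk> \<Longrightarrow> killing (scale c x) y = c * killing x y"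
proof -
  assume xy: "x \<in> g" "y \<in> g"
  obtain E where E: "finite E" "independent E" "span E = g" by (rule weight_basis)
  then have "E \<subseteq> g" using span_superset by blast
  then have "br x (br y e) \<in> span E" if "e \<in> E" for e
    using E(3) that xy g_br by auto
  then show ?thesis
    using xy subspace_scale[OF g_subspace] E
    by (simp add: killing_form_basis[OF E(2,3)] br_scale_left representation_scale sum_distrib_left)
qed

lemma killing_add_right: "\<lbrakk>x \<in> g; y \<in> g; y' \<in> g\<rbrakk> \<Longrightarrow> killing x (y + y') = killing x y + killing x y'"
  using killing_add_left killing_sym subspace_add[OF g_subspace] by metis

lemma killing_scale_right: "\<lbrakk>x \<in> g; y \<in> g\<rbrakk> \<Longrightarrow> killing x (scale c y) = c * killing x y"
  using killing_scale_left killing_sym subspace_scale[OF g_subspace] by metis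

lemma killing_zero_right: "x \<in> g \<Longrightarrow> killing x 0 = 0"
  using killing_scale_right[of x 0 0] subspace_0[OF g_subspace] by simp

lemma killing_sum_right:
  "\<lbrakk>x \<in> g; \<And>i. i \<in> I \<Longrightarrow> f i \<in> g\<rbrakk> \<Longrightarrow> killing x (sum f I) = (\<Sum>i\<in>I. killing x (f i))"
proof (induction I rule: infinite_finite_induct)
  case (insert i I)
  then show ?case using subspace_sum[OF g_subspace, of I f] by (simp add: killing_add_right)
qed (simp_all add: killing_zero_right)

text \<open>Expanding both brackets leaves the common trace of \<open>x y z\<close> and, on either
  side, one more term; these two agree by cyclicity, \<open>tr (x z y) = tr (y x z)\<close>.\<close>

lemma killing_invariant:
  assumes xyz: "x \<in> g" "y \<in> g" "z \<in> g"
  shows "killing (br x y) z = killing x (br y z)"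
proof -
  obtain E where E: "finite E" "independent E" "span E = g" by (rule weight_basis)
  have Eg: "e \<in> E \<Longrightarrow> e \<in> g" for e using E span_superset by blast
  let ?r = "\<lambda>x y z. \<Sum>e\<in>E. representation E (br x (br y (br z e))) e"
  have in_span: "br a (br b (br c e)) \<in> span E" if "e \<in> E" "a \<in> g" "b \<in> g" "c \<in> g" for a b c e
    using E(3) g_br Eg that by simp
  have "killing (br x y) z = ?r x y z - ?r y x z"
    using xyz g_br in_span E
    by (simp add: killing_form_basis[OF E(2,3)] br_br representation_diff sum_subtractf)
  moreover have "killing x (br y z) = ?r x y z - ?r x z y"
    using xyz g_br in_span E
    by (simp add: killing_form_basis[OF E(2,3)] br_br br_diff_right representation_diff sum_subtractf)
  moreover have "?r x z y = ?r y x z"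
  proof (rule trace_swap[where f' = "\<lambda>e. br x (br z e)" and f = "br y"])
    show "Vector_Spaces.linear scale scale (\<lambda>e. br x (br z e))"
      using Vector_Spaces.linear_compose[OF linear_br[of z] linear_br[of x]] by (simp add: comp_def)
  qed (use E xyz g_br Eg linear_br in auto)
  ultimately show ?thesis by simp
qed

text \<open>In a basis of weight vectors the trace of \<open>(ad t)^2\<close> is a sum of integer
  squares, so positivity can be argued in the integers although the field has no order. If the sum
  were zero, t would be central.\<close>

lemma killing_diagonal_pos:
  assumes t: "t \<in> h" "t \<noteq> 0" and int: "\<And>\<alpha>. \<alpha> \<in> rootset \<Longrightarrow> \<alpha> t \<in> \<int>"
  shows "\<exists>n::nat. 0 < n \<and> killing t t = of_nat n"
proof -
  obtain E where E: "finite E" "independent E" "span E = g" "E \<subseteq> (\<Union>\<mu>\<in>weightset. gspace \<mu>)"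
    by (rule weight_basis)
  then have "\<forall>e\<in>E. \<exists>\<mu>. \<mu> \<in> weightset \<and> e \<in> gspace \<mu>" by blast
  then obtain wt where wt: "\<And>e. e \<in> E \<Longrightarrow> wt e \<in> weightset \<and> e \<in> gspace (wt e)"
    by (drule_tac bchoice) blast
  have "\<exists>k::int. wt e t = of_int k" if "e \<in> E" for e
    using wt[OF that] int by (auto elim!: Ints_cases intro: exI[of _ 0])
  then obtain k :: "'l \<Rightarrow> int" where k: "\<And>e. e \<in> E \<Longrightarrow> wt e t = of_int (k e)" by metis
  have tg: "t \<in> g" using t h_subset by blast
  have diag: "br t e = scale (of_int (k e)) e" if "e \<in> E" for e
    using gspace_D[of e "wt e" t] wt[OF that] t k[OF that] by simp
  have rep: "representation E (br t (br t e)) e = of_int ((k e)\<^sup>2)" if "e \<in> E" for e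
    using that E span_base[OF that]
    by (simp add: diag br_scale_right representation_scale span_scale representation_basis power2_eq_square)
  have "killing t t = of_int (\<Sum>e\<in>E. (k e)\<^sup>2)"
    by (simp add: killing_form_basis[OF E(2,3) tg tg] rep)
  moreover have "(\<Sum>e\<in>E. (k e)\<^sup>2) > 0"
  proof (rule ccontr)
    assume "\<not> 0 < (\<Sum>e\<in>E. (k e)\<^sup>2)"
    then have "(\<Sum>e\<in>E. (k e)\<^sup>2) = 0" using sum_nonneg[of E "\<lambda>e. (k e)\<^sup>2"] by force
    then have k0: "k e = 0" if "e \<in> E" for e using that E(1) by (simp add: sum_nonneg_eq_0_iff)
    have "br y t = 0" if "y \<in> g" for y
    proof -
      have "y \<in> span E" using that E(3) by simp
      then show ?thesis
      proof (induction rule: span_induct_alt)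
        case (step c x y)
        then have "br x t = 0" using diag[of x] k0[of x] br_anti[of x t] by simp
        then show ?case using step by (simp add: br_add_left br_scale_left)
      qed simp
    qed
    then show False using centre_zero tg t by blast
  qed
  ultimately show ?thesis
    by (intro exI[of _ "nat (\<Sum>e\<in>E. (k e)\<^sup>2)"]) simp
qed

text \<open>The string equation at \<open>\<alpha> (br x y) = 2\<close> reads
  \<open>\<beta> (br x y) = 2 j - N\<close>.\<close>

lemma sl2_weights_integral:
  assumes "\<alpha> \<in> rootset" "x \<in> gspace \<alpha>" "y \<in> gspace (\<lambda>t. - \<alpha> t)" "\<alpha> (br x y) = 2" "\<beta> \<in> rootset"
  shows "\<beta> (br x y) \<in> \<int>"
proof -
  have "\<alpha> \<in> functionals h" "\<alpha> \<noteq> (\<lambda>_. 0)" using assms(1) by (auto simp: roots_def)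
  then obtain j N :: nat where "2 * \<beta> (br x y) = (2 * of_nat j - of_nat N) * \<alpha> (br x y)"
    using root_string[of \<alpha> x y \<beta>] assms by blast
  then have "2 * \<beta> (br x y) = 2 * of_int (2 * int j - int N)"
    using assms(4) by (simp add: algebra_simps)
  then have "\<beta> (br x y) = of_int (2 * int j - int N)" by (metis mult_left_cancel zero_neq_numeral)
  then show ?thesis by (metis Ints_of_int)
qed

lemma br_opposite_h: "\<lbrakk>x \<in> gspace \<alpha>; y \<in> gspace (\<lambda>t. - \<alpha> t)\<rbrakk> \<Longrightarrow> br x y \<in> h"
  using gspace_br[of x \<alpha> y "\<lambda>t. - \<alpha> t"] h_eq by simp

text \<open>By the string equation every root takes at \<open>br x y\<close> a rational multiple of
  the value of \<alpha>, which is 0; and the roots separate the points of h.\<close>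

lemma br_opposite_zero:
  assumes "\<alpha> \<in> rootset" "x \<in> gspace \<alpha>" "y \<in> gspace (\<lambda>t. - \<alpha> t)" "\<alpha> (br x y) = 0"
  shows "br x y = 0"
proof (rule roots_vanish_zero)
  show "br x y \<in> h" using assms br_opposite_h by blast
  fix \<beta> assume "\<beta> \<in> rootset"
  moreover have "\<alpha> \<in> functionals h" "\<alpha> \<noteq> (\<lambda>_. 0)" using assms(1) by (auto simp: roots_def)
  ultimately obtain j N :: nat where "2 * \<beta> (br x y) = (2 * of_nat j - of_nat N) * \<alpha> (br x y)"
    using root_string[of \<alpha> x y \<beta>] assms by blast
  then show "\<beta> (br x y) = 0" using assms by simp
qed

lemma sl2_rescale:
  assumes "\<alpha> \<in> functionals h" "x \<in> gspace \<alpha>" "y \<in> gspace (\<lambda>t. - \<alpha> t)" "\<alpha> (br x y) \<noteq> 0"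
  shows "\<exists>z \<in> gspace (\<lambda>t. - \<alpha> t). \<alpha> (br x z) = 2"
proof (rule bexI)
  show "scale (2 / \<alpha> (br x y)) y \<in> gspace (\<lambda>t. - \<alpha> t)"
    using subspace_scale[OF adj.weight_subspace] assms by blast
  show "\<alpha> (br x (scale (2 / \<alpha> (br x y)) y)) = 2"
    using assms br_opposite_h by (simp add: br_scale_right functional_scale)
qed

text \<open>This takes the place of Cartan's criterion. If \<alpha> vanished on
  \<open>[g_\<alpha>, g_-\<alpha>]\<close> for every root, these brackets would be 0 and h would lie
  in the span of the root spaces, hence be 0. So some \<open>br x y\<close> has \<alpha>-value 2;
  the roots are integral on it and its Killing norm is a positive integer.\<close>

lemma killing_nonzero: "\<exists>x\<in>g. \<exists>y\<in>g. killing x y \<noteq> 0"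
proof -
  have "\<exists>\<alpha>\<in>rootset. \<exists>x\<in>gspace \<alpha>. \<exists>y\<in>gspace (\<lambda>t. - \<alpha> t). \<alpha> (br x y) \<noteq> 0"
  proof (rule ccontr)
    assume "\<not> ?thesis"
    then have *: "br x y = 0" if "\<alpha> \<in> rootset" "x \<in> gspace \<alpha>" "y \<in> gspace (\<lambda>t. - \<alpha> t)" for x y \<alpha>
      using br_opposite_zero that by blast
    have "t = 0" if t: "t \<in> h" for t
    proof (rule adj.weight_vector_span_zero)
      show "t \<in> gspace (\<lambda>_. 0)" using t h_eq by blast
      show "t \<in> span ({br x y |x y \<alpha>. \<alpha> \<in> rootset \<and> x \<in> gspace \<alpha> \<and> y \<in> gspace (\<lambda>t. - \<alpha> t)}
          \<union> (\<Union>\<alpha>\<in>rootset. gspace \<alpha>))" by (rule h_span_brackets[OF t])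
      fix y assume "y \<in> {br x y |x y \<alpha>. \<alpha> \<in> rootset \<and> x \<in> gspace \<alpha> \<and> y \<in> gspace (\<lambda>t. - \<alpha> t)}
          \<union> (\<Union>\<alpha>\<in>rootset. gspace \<alpha>)"
      then have "y = 0 \<or> (\<exists>\<alpha>\<in>rootset. y \<in> gspace \<alpha>)" using * by blast
      moreover obtain \<beta> where "\<beta> \<in> rootset" using roots_nonempty by blast
      ultimately obtain \<alpha> where "\<alpha> \<in> rootset" "y \<in> gspace \<alpha>"
        using subspace_0[OF adj.weight_subspace] by blast
      then show "\<exists>\<sigma>. y \<in> gspace \<sigma> \<and> (\<exists>t\<in>h. \<sigma> t \<noteq> 0)" using rootsD(2) by blast
    qed
    moreover obtain \<beta> where "\<beta> \<in> rootset" using roots_nonempty by blast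
    ultimately show False using rootsD(1,2)[of \<beta>] functional_scale[of \<beta> 0 0] h_subspace subspace_0
      by (metis mult_zero_left scale_zero_left)
  qed
  then obtain \<alpha> x y where a: "\<alpha> \<in> rootset" "x \<in> gspace \<alpha>" "y \<in> gspace (\<lambda>t. - \<alpha> t)" "\<alpha> (br x y) = 2"
    using sl2_rescale rootsD(1) by metis
  have "br x y \<noteq> 0" using a(4) functional_scale[of \<alpha> 0 0] rootsD(1)[OF a(1)] subspace_0[OF h_subspace]
    by auto
  then have "killing (br x y) (br x y) \<noteq> 0"
    using killing_diagonal_pos[of "br x y"] br_opposite_h sl2_weights_integral a by fastforce
  then show ?thesis using br_opposite_h a h_subset by blast
qed

text \<open>The radical of an invariant form is an ideal, and it is not all of g.\<close>

lemma killing_nondegenerate: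
  assumes "x \<in> g" "\<And>y. y \<in> g \<Longrightarrow> killing x y = 0"
  shows "x = 0"
proof -
  let ?I = "{x \<in> g. \<forall>y\<in>g. killing x y = 0}"
  have "br z x \<in> ?I" if "z \<in> g" "x \<in> ?I" for x z
  proof -
    have "killing (br z x) y = 0" if "y \<in> g" for y
      using killing_invariant[of x z y] killing_scale_left[of "br x z" y "-1"] br_anti[of z x]
        \<open>z \<in> g\<close> \<open>x \<in> ?I\<close> \<open>y \<in> g\<close> g_br by simp
    then show ?thesis using that g_br by blast
  qed
  then have "lie_ideal g ?I"
    unfolding lie_ideal_def
    by (auto intro!: subspaceI simp: subspace_0[OF g_subspace] subspace_add[OF g_subspace]
        subspace_scale[OF g_subspace] killing_add_left killing_scale_left)
      (use killing_zero_right killing_sym subspace_0[OF g_subspace] in metis)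
  moreover have "?I \<noteq> g" using killing_nonzero by blast
  ultimately have "?I = {0}" using ideal_cases by blast
  then show ?thesis using assms by blast
qed

lemma killing_weights:
  assumes "x \<in> gspace \<alpha>" "y \<in> gspace \<beta>" "t \<in> h" "\<alpha> t + \<beta> t \<noteq> 0"
  shows "killing x y = 0"
proof -
  have g: "x \<in> g" "y \<in> g" "t \<in> g" using assms gspace_g h_subset by auto
  have "\<alpha> t * killing x y = killing (br t x) y"
    using assms g by (simp add: gspace_D killing_scale_left)
  also have "\<dots> = - killing (br x t) y"
    using killing_scale_left[of "br x t" y "-1"] g g_br br_anti[of t x] by simp
  also have "\<dots> = - killing x (br t y)" using killing_invariant g by simp
  also have "\<dots> = - (\<beta> t * killing x y)" using assms g by (simp add: gspace_D killing_scale_right)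
  finally have "(\<alpha> t + \<beta> t) * killing x y = 0" by (simp add: algebra_simps)
  then show ?thesis using assms by simp
qed

text \<open>h is orthogonal to every root space, so an element of h orthogonal to h is orthogonal to
  g.\<close>

lemma killing_nondegenerate_h:
  assumes t: "t \<in> h" "\<And>s. s \<in> h \<Longrightarrow> killing t s = 0"
  shows "t = 0"
proof (rule killing_nondegenerate)
  show tg: "t \<in> g" using t h_subset by blast
  fix y assume "y \<in> g"
  then have "y \<in> span (\<Union>\<mu>\<in>weightset. gspace \<mu>)" using g_span_weights by blast
  then have "y \<in> g \<and> killing t y = 0"
  proof (induction rule: span_induct_alt)
    case base then show ?case using killing_zero_right[OF tg] subspace_0[OF g_subspace] by blast
  next
    case (step c x y)
    then obtain \<mu> where \<mu>: "\<mu> \<in> weightset" "x \<in> gspace \<mu>" by blast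
    have "killing t x = 0"
    proof (cases "\<mu> \<in> rootset")
      case True
      then obtain s where "s \<in> h" "\<mu> s \<noteq> 0" using rootsD by blast
      then show ?thesis using killing_weights[of t "\<lambda>_. 0" x \<mu> s] t \<mu> h_eq by auto
    next
      case False
      then show ?thesis using \<mu> h_eq t by blast
    qed
    moreover have "x \<in> g" using gspace_g \<mu>(2) .
    ultimately show ?case
      using step(2) tg subspace_scale[OF g_subspace] subspace_add[OF g_subspace]
      by (simp add: killing_add_right killing_scale_right)
  qed
  then show "killing t y = 0" ..
qed

text \<open>A nonzero x in \<open>g_\<alpha>\<close> pairs nontrivially with some y, and only the
  component of weight -\<alpha> can contribute. If \<alpha> vanished at the resulting bracket, the
  bracket would be 0, and invariance would give
  \<open>\<alpha> s * killing x y = killing s (br x y) = 0\<close> for this component.\<close>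

lemma coroot:
  assumes \<alpha>: "\<alpha> \<in> rootset"
  obtains x y where "x \<in> gspace \<alpha>" "y \<in> gspace (\<lambda>t. - \<alpha> t)" "\<alpha> (br x y) = 2"
proof -
  obtain x where x: "x \<in> gspace \<alpha>" "x \<noteq> 0" using rootsD \<alpha> by blast
  then obtain y where y: "y \<in> g" "killing x y \<noteq> 0" using killing_nondegenerate gspace_g by blast
  obtain f where f: "\<forall>\<mu>\<in>weightset. f \<mu> \<in> gspace \<mu>" "y = (\<Sum>\<mu>\<in>weightset. f \<mu>)"
    using weight_decomposition[OF y(1)] by (elim exE conjE) (rule that)
  have "f \<mu> \<in> g" if "\<mu> \<in> weightset" for \<mu> using gspace_g bspec[OF f(1) that] .
  then have *: "killing x y = (\<Sum>\<mu>\<in>weightset. killing x (f \<mu>))"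
    unfolding f(2) using killing_sum_right gspace_g[OF x(1)] by blast
  have "\<not> (\<forall>\<mu>\<in>weightset. killing x (f \<mu>) = 0)"
  proof
    assume "\<forall>\<mu>\<in>weightset. killing x (f \<mu>) = 0"
    then have "killing x y = 0" unfolding * by (rule sum.neutral)
    then show False using y(2) by contradiction
  qed
  then obtain \<mu> where \<mu>: "\<mu> \<in> weightset" "killing x (f \<mu>) \<noteq> 0" by blast
  have z: "f \<mu> \<in> gspace \<mu>" using f(1) \<mu>(1) by blast
  have zg: "f \<mu> \<in> g" and xg: "x \<in> g" using z x gspace_g by blast+
  have "\<mu> t = - \<alpha> t" if "t \<in> h" for t
    using killing_weights[OF x(1) z that] \<mu>(2) by (metis add.commute eq_neg_iff_add_eq_0)
  then have "f \<mu> \<in> gspace (\<lambda>t. - \<alpha> t)" using z by (simp add: weight_space_def)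
  moreover have "\<alpha> (br x (f \<mu>)) \<noteq> 0"
  proof
    assume "\<alpha> (br x (f \<mu>)) = 0"
    then have 0: "br x (f \<mu>) = 0" using br_opposite_zero \<alpha> x(1) calculation by blast
    obtain s where s: "s \<in> h" "\<alpha> s \<noteq> 0" using rootsD \<alpha> by blast
    have "\<alpha> s * killing x (f \<mu>) = killing (br s x) (f \<mu>)"
      using s x(1) zg xg by (simp add: gspace_D killing_scale_left)
    also have "\<dots> = killing s (br x (f \<mu>))"
      using killing_invariant[of s x "f \<mu>"] s h_subset zg xg by blast
    finally show False using 0 killing_zero_right s h_subset \<mu>(2) by auto
  qed
  ultimately show ?thesis using sl2_rescale[OF rootsD(1)[OF \<alpha>] x(1)] that x(1) by metis
qed

end

section \<open>Root lengths\<close>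

context split_simple
begin

abbreviation dual where "dual \<equiv> dual_vector g h"

text \<open>\<open>dual_vector\<close> is a definite description; this predicate says that the
  description is met. It is established for the roots, through their coroots, and is inherited by
  the combinations used below.\<close>

definition has_dual :: "('l \<Rightarrow> 'f) \<Rightarrow> bool" where
  "has_dual \<alpha> \<longleftrightarrow> dual \<alpha> \<in> h \<and> (\<forall>s\<in>h. killing (dual \<alpha>) s = \<alpha> s)"

lemma dual_vector_eqI:
  assumes "t \<in> h" "\<And>s. s \<in> h \<Longrightarrow> killing t s = \<alpha> s"
  shows "dual \<alpha> = t" "has_dual \<alpha>"
proof -
  show "dual \<alpha> = t"
    unfolding dual_vector_def
  proof (rule the_equality)
    fix t' assume t': "t' \<in> h \<and> (\<forall>s\<in>h. killing t' s = \<alpha> s)"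
    have "t' + scale (- 1) t = 0"
    proof (rule killing_nondegenerate_h)
      show "t' + scale (- 1) t \<in> h"
        using t' assms subspace_add[OF h_subspace] subspace_scale[OF h_subspace] by blast
      fix s assume s: "s \<in> h"
      have "t' \<in> g" "scale (- 1) t \<in> g" "s \<in> g" "t \<in> g"
        using t' assms h_subset s subspace_scale[OF h_subspace] by blast+
      then show "killing (t' + scale (- 1) t) s = 0"
        using t' assms s by (simp add: killing_add_left killing_scale_left del: scale_minus_left)
    qed
    then show "t' = t" by simp
  qed (use assms in blast)
  then show "has_dual \<alpha>" using assms by (simp add: has_dual_def)
qed

lemma dual_combination:
  assumes "has_dual \<alpha>" "has_dual \<beta>"
  shows "has_dual (\<lambda>t. \<alpha> t + c * \<beta> t)" "dual (\<lambda>t. \<alpha> t + c * \<beta> t) = dual \<alpha> + scale c (dual \<beta>)"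
proof -
  have t: "dual \<alpha> + scale c (dual \<beta>) \<in> h"
    using assms subspace_add[OF h_subspace] subspace_scale[OF h_subspace] by (simp add: has_dual_def)
  have s: "killing (dual \<alpha> + scale c (dual \<beta>)) s = \<alpha> s + c * \<beta> s" if "s \<in> h" for s
  proof -
    have "dual \<alpha> \<in> g" "scale c (dual \<beta>) \<in> g" "s \<in> g" "dual \<beta> \<in> g"
      using assms h_subset that subspace_scale[OF h_subspace] unfolding has_dual_def by blast+
    then show ?thesis
      using assms that by (simp add: has_dual_def killing_add_left killing_scale_left)
  qed
  show "has_dual (\<lambda>t. \<alpha> t + c * \<beta> t)" "dual (\<lambda>t. \<alpha> t + c * \<beta> t) = dual \<alpha> + scale c (dual \<beta>)"
    using dual_vector_eqI[OF t, of "\<lambda>t. \<alpha> t + c * \<beta> t"] s by auto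
qed

lemma root_form_eval:
  assumes "has_dual \<alpha>" "has_dual \<beta>"
  shows "root_form g h \<alpha> \<beta> = \<alpha> (dual \<beta>)" "root_form g h \<alpha> \<beta> = \<beta> (dual \<alpha>)"
  using assms killing_sym[of "dual \<alpha>" "dual \<beta>"] h_subset
  by (auto simp: root_form_def has_dual_def)

text \<open>The witness t is the coroot \<open>br x y\<close>. Invariance gives
  \<open>killing t s = killing x y * \<alpha> s\<close>; at s = t this is
  \<open>n = 2 * killing x y\<close> with \<open>n = killing t t\<close>. So the dual vector of
  \<alpha> is t divided by \<open>killing x y = n / 2\<close>, which is where the factor
  \<open>2 / n\<close> comes from.\<close>

lemma coroot_properties:
  assumes \<alpha>: "\<alpha> \<in> rootset"
  shows "\<exists>t\<in>h. \<exists>n::nat. 0 < n \<and> \<alpha> t = 2 \<and> has_dual \<alpha> \<and> dual \<alpha> = scale (2 / of_nat n) t \<and>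
    (\<forall>\<beta>\<in>weightset. \<exists>j N :: nat. \<beta> t = 2 * of_nat j - of_nat N \<and>
      (\<forall>i\<le>N. (\<lambda>t. \<beta> t + (of_nat i - of_nat j) * \<alpha> t) \<in> weightset))"
proof -
  obtain x y where xy: "x \<in> gspace \<alpha>" "y \<in> gspace (\<lambda>t. - \<alpha> t)" "\<alpha> (br x y) = 2"
    by (rule coroot[OF \<alpha>])
  define t where "t = br x y"
  have t: "t \<in> h" unfolding t_def by (rule br_opposite_h[OF xy(1,2)])
  have g: "x \<in> g" "y \<in> g" using xy gspace_g by blast+
  have \<alpha>f: "\<alpha> \<in> functionals h" "\<alpha> \<noteq> (\<lambda>_. 0)" using \<alpha> by (auto simp: roots_def)
  have kt: "killing t s = killing x y * \<alpha> s" if "s \<in> h" for s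
  proof -
    have "killing t s = killing x (br y s)"
      unfolding t_def using killing_invariant g that h_subset by blast
    also have "br y s = scale (\<alpha> s) y"
      using br_anti[of y s] gspace_D[OF xy(2) that] by simp
    finally show ?thesis using g by (simp add: killing_scale_right mult.commute)
  qed
  have "t \<noteq> 0" using xy(3) functional_scale[OF \<alpha>f(1), of 0 0] subspace_0[OF h_subspace]
    by (auto simp: t_def)
  then obtain n :: nat where n: "0 < n" "killing t t = of_nat n"
    using killing_diagonal_pos[OF t] sl2_weights_integral[OF \<alpha> xy] t_def by metis
  have kxy: "killing x y = of_nat n / 2" using kt[OF t] n xy(3) by (simp add: t_def field_simps)
  have st: "scale (2 / of_nat n) t \<in> h" using t subspace_scale[OF h_subspace] by blast
  have "killing (scale (2 / of_nat n) t) s = \<alpha> s" if "s \<in> h" for s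
    using kt[OF that] kxy n(1) subsetD[OF h_subset t] subsetD[OF h_subset that]
    by (simp add: killing_scale_left field_simps)
  then have dual: "has_dual \<alpha>" "dual \<alpha> = scale (2 / of_nat n) t"
    using dual_vector_eqI[OF st] by auto
  have str: "\<exists>j N :: nat. \<beta> t = 2 * of_nat j - of_nat N \<and>
      (\<forall>i\<le>N. (\<lambda>t. \<beta> t + (of_nat i - of_nat j) * \<alpha> t) \<in> weightset)" if \<beta>: "\<beta> \<in> weightset" for \<beta>
  proof -
    obtain j N :: nat where jN: "2 * \<beta> t = (2 * of_nat j - of_nat N) * \<alpha> t"
      "\<forall>i\<le>N. (\<lambda>t. \<beta> t + (of_nat i - of_nat j) * \<alpha> t) \<in> weightset"
      using root_string[OF \<alpha>f xy(1,2) \<beta>] unfolding t_def[symmetric] by blast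
    have "2 * \<beta> t = 2 * (2 * of_nat j - of_nat N)" using jN(1) xy(3) by (simp add: t_def)
    then have "\<beta> t = 2 * of_nat j - of_nat N" by (metis mult_left_cancel zero_neq_numeral)
    then show ?thesis using jN(2) by blast
  qed
  show ?thesis
  proof (intro bexI exI conjI)
    show "\<alpha> t = 2" using xy(3) by (simp add: t_def)
  qed (use t n dual str in blast)+
qed

lemma root_has_dual: "\<alpha> \<in> rootset \<Longrightarrow> has_dual \<alpha>"
  using coroot_properties by blast

text \<open>Substitute for the relation "at least 0" in a field without order: the rationals embed
  in characteristic 0, and the inner products that matter are rational.\<close>

definition nonneg_rational :: "'f set" where
  "nonneg_rational = of_rat ` {q. 0 \<le> q}"

lemma nonneg_rational_add: "\<lbrakk>x \<in> nonneg_rational; y \<in> nonneg_rational\<rbrakk> \<Longrightarrow> x + y \<in> nonneg_rational"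
  unfolding nonneg_rational_def by (auto simp: of_rat_add[symmetric] simp del: of_rat_add)

lemma nonneg_rational_mult: "\<lbrakk>x \<in> nonneg_rational; y \<in> nonneg_rational\<rbrakk> \<Longrightarrow> x * y \<in> nonneg_rational"
  unfolding nonneg_rational_def by (auto simp: of_rat_mult[symmetric])

lemma nonneg_rational_of_nat: "of_nat n \<in> nonneg_rational"
  unfolding nonneg_rational_def by (intro image_eqI[of _ _ "of_nat n"]) auto

lemma nonneg_rational_sum: "(\<And>i. i \<in> I \<Longrightarrow> f i \<in> nonneg_rational) \<Longrightarrow> sum f I \<in> nonneg_rational"
  using nonneg_rational_of_nat[of 0]
  by (induction I rule: infinite_finite_induct) (auto intro: nonneg_rational_add)

lemma root_form_positive:
  assumes \<alpha>: "\<alpha> \<in> rootset"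
  obtains q where "q > 0" "root_form g h \<alpha> \<alpha> = of_rat q"
proof -
  obtain t and n :: nat where t: "t \<in> h" "0 < n" "\<alpha> t = 2" "has_dual \<alpha>" "dual \<alpha> = scale (2 / of_nat n) t"
    using coroot_properties[OF \<alpha>] by blast
  have "root_form g h \<alpha> \<alpha> = of_rat (4 / of_nat n)"
    using t root_form_eval(1)[OF t(4,4)] functional_scale[OF rootsD(1)[OF \<alpha>] t(1)]
    by (simp add: of_rat_divide)
  then show ?thesis using that[of "4 / of_nat n"] t(2) by simp
qed

lemma root_form_eval_coroot:
  assumes "\<alpha> \<in> rootset" "\<beta> \<in> rootset" "t \<in> h" "dual \<alpha> = scale c t"
  shows "root_form g h \<beta> \<alpha> = c * \<beta> t"
  using assms root_form_eval(1)[OF root_has_dual root_has_dual, of \<beta> \<alpha>]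
    functional_scale[OF rootsD(1)[of \<beta>]] by simp

text \<open>The \<alpha>-string through \<beta> reaches up to
  \<open>\<beta> + (N - j) \<alpha>\<close>. If \<open>\<beta> + \<alpha>\<close> is no weight then
  \<open>N \<le> j\<close>, and \<beta> takes the value \<open>2 j - N\<close>, a natural number, at
  the coroot.\<close>

lemma root_form_nonneg:
  assumes \<alpha>: "\<alpha> \<in> rootset" and \<beta>: "\<beta> \<in> rootset" and no: "(\<lambda>t. \<beta> t + \<alpha> t) \<notin> weightset"
  shows "root_form g h \<beta> \<alpha> \<in> nonneg_rational"
proof -
  obtain t and n :: nat where t: "t \<in> h" "0 < n" "\<alpha> t = 2" "dual \<alpha> = scale (2 / of_nat n) t"
    and str: "\<forall>\<beta>\<in>weightset. \<exists>j N :: nat. \<beta> t = 2 * of_nat j - of_nat N \<and>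
      (\<forall>i\<le>N. (\<lambda>t. \<beta> t + (of_nat i - of_nat j) * \<alpha> t) \<in> weightset)"
    using coroot_properties[OF \<alpha>] by blast
  obtain j N :: nat where jN: "\<beta> t = 2 * of_nat j - of_nat N"
    "\<forall>i\<le>N. (\<lambda>t. \<beta> t + (of_nat i - of_nat j) * \<alpha> t) \<in> weightset"
    using str \<beta> by blast
  have "N \<le> j"
  proof (rule ccontr)
    assume "\<not> N \<le> j"
    then have "(\<lambda>t. \<beta> t + (of_nat (Suc j) - of_nat j) * \<alpha> t) \<in> weightset"
      using jN(2) by (simp only: not_le Suc_le_eq)
    moreover have "of_nat (Suc j) - of_nat j = (1 :: 'f)" by simp
    ultimately show False using no by (simp only: mult_1_left)
  qed
  then have "\<beta> t = of_nat (2 * j - N)" using jN(1) by (simp add: of_nat_diff)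
  moreover have "(2 / of_nat n :: 'f) \<in> nonneg_rational"
    unfolding nonneg_rational_def by (intro image_eqI[of _ _ "2 / of_nat n"]) (auto simp: of_rat_divide)
  ultimately show ?thesis
    using root_form_eval_coroot[OF \<alpha> \<beta> t(1,4)]
    by (simp only:) (intro nonneg_rational_mult nonneg_rational_of_nat)
qed

text \<open>The new root is the image of \<beta> under the reflection in \<alpha>, with m the
  negative of the value of \<beta> at the coroot; a reflection preserves the form.\<close>

lemma root_form_negative_reflect:
  assumes \<alpha>: "\<alpha> \<in> rootset" and \<beta>: "\<beta> \<in> rootset" and neg: "root_form g h \<beta> \<alpha> \<notin> nonneg_rational"
  shows "\<exists>m::nat. 0 < m \<and> (\<lambda>t. \<beta> t + of_nat m * \<alpha> t) \<in> rootset \<and>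
    root_form g h (\<lambda>t. \<beta> t + of_nat m * \<alpha> t) (\<lambda>t. \<beta> t + of_nat m * \<alpha> t) = root_form g h \<beta> \<beta>"
proof -
  obtain t and n :: nat where t: "t \<in> h" "0 < n" "\<alpha> t = 2" "dual \<alpha> = scale (2 / of_nat n) t"
    and str: "\<forall>\<beta>\<in>weightset. \<exists>j N :: nat. \<beta> t = 2 * of_nat j - of_nat N \<and>
      (\<forall>i\<le>N. (\<lambda>t. \<beta> t + (of_nat i - of_nat j) * \<alpha> t) \<in> weightset)"
    using coroot_properties[OF \<alpha>] by blast
  obtain j N :: nat where jN: "\<beta> t = 2 * of_nat j - of_nat N"
    "\<forall>i\<le>N. (\<lambda>t. \<beta> t + (of_nat i - of_nat j) * \<alpha> t) \<in> weightset"
    using str \<beta> by blast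
  have c: "(2 / of_nat n :: 'f) \<in> nonneg_rational"
    unfolding nonneg_rational_def by (intro image_eqI[of _ _ "2 / of_nat n"]) (auto simp: of_rat_divide)
  note form = root_form_eval_coroot[OF \<alpha> _ t(1,4)]
  have lt: "2 * j < N"
  proof (rule ccontr)
    assume "\<not> 2 * j < N"
    then have "\<beta> t = of_nat (2 * j - N)" using jN(1) by (simp add: of_nat_diff)
    then show False using neg form[OF \<beta>] nonneg_rational_mult[OF c nonneg_rational_of_nat] by metis
  qed
  define m where "m = N - 2 * j"
  have m: "0 < m" "\<beta> t = - of_nat m" using lt jN(1) by (auto simp: m_def of_nat_diff)
  let ?\<beta> = "\<lambda>t. \<beta> t + of_nat m * \<alpha> t"
  \<comment> \<open>The reflection reverses the string. Position \<open>i = N - j\<close> carries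
    the coefficient \<open>i - j = N - 2 j = m\<close>.\<close>
  have "(of_nat (N - j) - of_nat j :: 'f) = of_nat m" using lt by (simp add: m_def of_nat_diff)
  then have w: "?\<beta> \<in> weightset" using jN(2)[rule_format, of "N - j"] by simp
  have "?\<beta> t = of_nat m" using m t by simp
  then have "?\<beta> \<noteq> (\<lambda>_. 0)" using m(1) by (metis of_nat_eq_0_iff less_irrefl)
  then have root: "?\<beta> \<in> rootset" using w by blast
  note d = root_has_dual[OF \<alpha>] root_has_dual[OF \<beta>]
  have "root_form g h ?\<beta> ?\<beta> = ?\<beta> (dual \<beta> + scale (of_nat m) (dual \<alpha>))"
    using root_form_eval(1)[OF root_has_dual root_has_dual] root dual_combination(2)[OF d(2,1)] by simp
  also have "\<dots> = \<beta> (dual \<beta>) + of_nat m * \<alpha> (dual \<beta>)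
      + of_nat m * (\<beta> (dual \<alpha>) + of_nat m * \<alpha> (dual \<alpha>))"
    using d rootsD(1)[OF \<alpha>] rootsD(1)[OF \<beta>]
    by (simp add: has_dual_def functional_add functional_scale subspace_scale[OF h_subspace]
        algebra_simps)
  also have "\<alpha> (dual \<beta>) = \<beta> (dual \<alpha>)" using root_form_eval[OF d] by simp
  also have "\<beta> (dual \<alpha>) = (2 / of_nat n) * (- of_nat m)"
    using form[OF \<beta>] root_form_eval(1)[OF d(2,1)] m(2) by simp
  also have "\<alpha> (dual \<alpha>) = (2 / of_nat n) * 2"
    using form[OF \<alpha>] root_form_eval(1)[OF d(1,1)] t(3) by simp
  also have "\<beta> (dual \<beta>) = root_form g h \<beta> \<beta>" using root_form_eval(1)[OF d(2,2)] by simp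
  finally have "root_form g h ?\<beta> ?\<beta> = root_form g h \<beta> \<beta>" by (simp add: field_simps)
  then show ?thesis using m root by blast
qed

end

section \<open>The highest root is long\<close>

locale based_simple = split_simple scale br g h
  for scale :: "'f::field_char_0 \<Rightarrow> 'l::ab_group_add \<Rightarrow> 'l" and br g h +
  fixes r :: nat and \<pi> :: "nat \<Rightarrow> 'l \<Rightarrow> 'f"
  assumes base: "root_base g h r \<pi>"
begin

lemma simple_root: "i < r \<Longrightarrow> \<pi> i \<in> rootset"
  using base by (simp add: root_base_def)

lemma simple_roots_independent:
  assumes "\<And>t. (\<Sum>i<r. c i * \<pi> i t) = (\<Sum>i<r. d i * \<pi> i t)" "i < r"
  shows "c i = d i"
proof -
  have "\<forall>t. (\<Sum>i<r. (c i - d i) * \<pi> i t) = 0"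
    using assms(1) by (simp add: left_diff_distrib sum_subtractf)
  moreover have "(\<forall>t. (\<Sum>i<r. (c i - d i) * \<pi> i t) = 0) \<longrightarrow> (\<forall>i<r. c i - d i = 0)"
    using base unfolding root_base_def by meson
  ultimately show ?thesis using assms(2) by simp
qed

lemma root_sign: "\<alpha> \<in> rootset \<Longrightarrow> nonneg_comb r \<pi> \<alpha> \<or> nonneg_comb r \<pi> (\<lambda>t. - \<alpha> t)"
  using base by (simp add: root_base_def)

text \<open>Reflecting \<open>\<beta>\<close> upwards in simple roots preserves its length and ends at a dominant root \<open>\<beta>\<close>; then
  \<open>(\<theta> - \<beta> | \<theta>)\<close> and \<open>(\<theta> - \<beta> | \<beta>)\<close> are nonnegative, and so is their sum.\<close>

lemma highest_root_longest:
  assumes \<theta>: "\<theta> \<in> rootset" and highest: "\<And>\<mu>. \<mu> \<in> weightset \<Longrightarrow> nonneg_comb r \<pi> (\<lambda>t. \<theta> t - \<mu> t)"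
    and "\<beta> \<in> rootset"
  shows "root_form g h \<theta> \<theta> - root_form g h \<beta> \<beta> \<in> nonneg_rational"
proof -
  have dominant: "root_form g h \<theta> (\<pi> i) \<in> nonneg_rational" if i: "i < r" for i
  proof (rule root_form_nonneg[OF simple_root[OF i] \<theta>])
    show "(\<lambda>t. \<theta> t + \<pi> i t) \<notin> weightset"
    proof
      assume "(\<lambda>t. \<theta> t + \<pi> i t) \<in> weightset"
      then obtain n :: "nat \<Rightarrow> nat"
        where n: "(\<lambda>t. \<theta> t - (\<theta> t + \<pi> i t)) = (\<lambda>t. \<Sum>i<r. of_nat (n i) * \<pi> i t)"
        using highest unfolding nonneg_comb_def by blast
      have "(\<Sum>k<r. of_nat (n k) * \<pi> k t) = (\<Sum>k<r. (if k = i then - 1 else 0) * \<pi> k t)" for t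
        using fun_cong[OF n, of t] i by (simp add: if_distrib[of "\<lambda>x. x * _"] sum.delta cong: if_cong)
      then have "of_nat (n i) = (- 1 :: 'f)"
        using simple_roots_independent[of "\<lambda>k. of_nat (n k)" "\<lambda>k. if k = i then - 1 else 0" i] i by simp
      then have "of_nat (Suc (n i)) = (0 :: 'f)" by simp
      then show False by (simp only: of_nat_eq_0_iff)
    qed
  qed
  have "root_form g h \<theta> \<theta> - root_form g h \<beta> \<beta> \<in> nonneg_rational"
    if "\<beta> \<in> rootset" "(\<lambda>t. \<theta> t - \<beta> t) = (\<lambda>t. \<Sum>i<r. of_nat (n i) * \<pi> i t)"
    for \<beta> and n :: "nat \<Rightarrow> nat"
    using that
  \<comment> \<open>The measure is the height of \<open>\<theta> - \<beta>\<close>; a reflection of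
    \<beta> in the simple root \<open>\<pi> i\<close> lowers it by m.\<close>
  proof (induction "\<Sum>i<r. n i" arbitrary: \<beta> n rule: less_induct)
    case less
    note \<beta> = \<open>\<beta> \<in> rootset\<close> and n = less.prems(2)
    show ?case
    proof (cases "\<forall>i<r. root_form g h \<beta> (\<pi> i) \<in> nonneg_rational")
      case True
      note d = root_has_dual[OF \<theta>] root_has_dual[OF \<beta>]
      have ev: "root_form g h \<gamma> (\<pi> i) = \<pi> i (dual \<gamma>)" if "\<gamma> \<in> rootset" "i < r" for \<gamma> i
        using root_form_eval(2) root_has_dual simple_root that by blast
      have sum: "(\<Sum>i<r. of_nat (n i) * \<pi> i (dual \<gamma>)) \<in> nonneg_rational"
        if "\<gamma> \<in> rootset" "\<forall>i<r. root_form g h \<gamma> (\<pi> i) \<in> nonneg_rational" for \<gamma>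
        using that ev by (intro nonneg_rational_sum nonneg_rational_mult nonneg_rational_of_nat) auto
      have "root_form g h \<theta> \<theta> - root_form g h \<beta> \<beta>
          = (\<theta> (dual \<theta>) - \<beta> (dual \<theta>)) + (\<theta> (dual \<beta>) - \<beta> (dual \<beta>))"
        using root_form_eval[OF d] root_form_eval[OF d(1,1)] root_form_eval[OF d(2,2)] by simp
      also have "\<dots> \<in> nonneg_rational"
        using fun_cong[OF n, of "dual \<theta>"] fun_cong[OF n, of "dual \<beta>"] sum \<theta> \<beta> True dominant
        by (simp only:) (intro nonneg_rational_add sum; simp)
      finally show ?thesis .
    next
      case False
      then obtain i where i: "i < r" "root_form g h \<beta> (\<pi> i) \<notin> nonneg_rational" by blast
      obtain m :: nat where m: "0 < m" "(\<lambda>t. \<beta> t + of_nat m * \<pi> i t) \<in> rootset"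
        "root_form g h (\<lambda>t. \<beta> t + of_nat m * \<pi> i t) (\<lambda>t. \<beta> t + of_nat m * \<pi> i t) = root_form g h \<beta> \<beta>"
        using root_form_negative_reflect[OF simple_root[OF i(1)] \<beta> i(2)] by blast
      obtain n' :: "nat \<Rightarrow> nat"
        where n': "(\<lambda>t. \<theta> t - (\<beta> t + of_nat m * \<pi> i t)) = (\<lambda>t. \<Sum>i<r. of_nat (n' i) * \<pi> i t)"
        using highest m(2) unfolding nonneg_comb_def by blast
      have "(\<Sum>k<r. of_nat (n k) * \<pi> k t) = (\<Sum>k<r. of_nat (n' k + (if k = i then m else 0)) * \<pi> k t)" for t
      proof -
        have "(\<Sum>k<r. of_nat (n' k + (if k = i then m else 0)) * \<pi> k t)
            = (\<Sum>k<r. of_nat (n' k) * \<pi> k t) + (\<Sum>k<r. if k = i then of_nat m * \<pi> k t else 0)"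
          unfolding sum.distrib[symmetric] by (intro sum.cong) (auto simp: algebra_simps)
        also have "\<dots> = (\<theta> t - (\<beta> t + of_nat m * \<pi> i t)) + of_nat m * \<pi> i t"
          using fun_cong[OF n', of t] i(1) by simp
        also have "\<dots> = \<theta> t - \<beta> t" by simp
        finally show ?thesis using fun_cong[OF n, of t] by simp
      qed
      then have eq: "n k = n' k + (if k = i then m else 0)" if "k < r" for k
        using simple_roots_independent[of "\<lambda>k. of_nat (n k)" "\<lambda>k. of_nat (n' k + (if k = i then m else 0))" k]
          that of_nat_eq_iff by blast
      have "(\<Sum>k<r. n k) = (\<Sum>k<r. n' k) + m"
        using i(1) by (simp add: eq sum.distrib)
      then have "(\<Sum>k<r. n' k) < (\<Sum>k<r. n k)" using m(1) by simp
      then show ?thesis using less.hyps[OF _ m(2) n'] m(3) by simp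
    qed
  qed
  moreover obtain n :: "nat \<Rightarrow> nat" where "(\<lambda>t. \<theta> t - \<beta> t) = (\<lambda>t. \<Sum>i<r. of_nat (n i) * \<pi> i t)"
    using highest assms(3) unfolding nonneg_comb_def by blast
  ultimately show ?thesis using assms(3) by blast
qed

text \<open>With \<open>(\<theta>|\<theta>) = a\<close> and \<open>(\<beta>|\<beta>) = b\<close>
  positive rationals, shortness says \<open>q a = p b\<close> for some \<open>p < q\<close>, against
  \<open>b \<le> a\<close>.\<close>

lemma highest_root_not_short:
  assumes highest: "\<And>\<mu>. \<mu> \<in> weightset \<Longrightarrow> nonneg_comb r \<pi> (\<lambda>t. \<theta> t - \<mu> t)"
  shows "\<theta> \<notin> short_roots g h"
proof
  assume "\<theta> \<in> short_roots g h"
  then obtain \<beta> p q where \<theta>: "\<theta> \<in> rootset" and \<beta>: "\<beta> \<in> rootset" and pq: "0 < (p::nat)" "p < (q::nat)"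
    and eq: "of_nat q * root_form g h \<theta> \<theta> = of_nat p * root_form g h \<beta> \<beta>"
    by (auto simp: short_roots_def)
  obtain a where a: "a > 0" "root_form g h \<theta> \<theta> = of_rat a" using root_form_positive[OF \<theta>] .
  obtain b where b: "b > 0" "root_form g h \<beta> \<beta> = of_rat b" using root_form_positive[OF \<beta>] .
  have "of_rat (a - b) \<in> nonneg_rational"
    using highest_root_longest[OF \<theta> highest \<beta>] a b by (simp add: of_rat_diff)
  then have "b \<le> a" by (auto simp: nonneg_rational_def)
  have "of_rat (of_nat q * a) = (of_rat (of_nat p * b) :: 'f)"
    using eq a b by (simp add: of_rat_mult)
  then have "of_nat q * a = of_nat p * b" by (simp only: of_rat_eq_iff)
  moreover have "of_nat p * b \<le> of_nat p * a" using \<open>b \<le> a\<close> by (simp add: mult_left_mono)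
  moreover have "of_nat p * a < of_nat q * a" using a pq by simp
  ultimately show False by simp
qed

end

section \<open>Highest weight modules\<close>

context split_simple
begin

text \<open>Without algebraic closure the eigenvalue must be produced by hand. For t in h,
  \<open>\<phi> t\<close> commutes with h and so lies in h; on a root vector x this gives
  \<open>\<alpha> t * \<phi> x = [\<phi> t, x] = \<alpha> (\<phi> t) * x\<close>. The eigenspace is
  a nonzero ideal, hence g.\<close>

lemma adjoint_endomorphism_scalar:
  assumes closed: "\<And>x. x \<in> g \<Longrightarrow> \<phi> x \<in> g"
    and add: "\<And>x y. \<lbrakk>x \<in> g; y \<in> g\<rbrakk> \<Longrightarrow> \<phi> (x + y) = \<phi> x + \<phi> y"
    and scl: "\<And>c x. x \<in> g \<Longrightarrow> \<phi> (scale c x) = scale c (\<phi> x)"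
    and hom: "\<And>x y. \<lbrakk>x \<in> g; y \<in> g\<rbrakk> \<Longrightarrow> \<phi> (br x y) = br x (\<phi> y)"
  shows "\<exists>c. \<forall>x\<in>g. \<phi> x = scale c x"
proof -
  have zero: "\<phi> 0 = 0" using scl[of 0 0] subspace_0[OF g_subspace] by simp
  obtain \<alpha> where \<alpha>: "\<alpha> \<in> rootset" using roots_nonempty by blast
  obtain t where t: "t \<in> h" "\<alpha> t \<noteq> 0" using rootsD(2)[OF \<alpha>] by blast
  obtain x where x: "x \<in> gspace \<alpha>" "x \<noteq> 0" using rootsD(3)[OF \<alpha>] by blast
  have g: "t \<in> g" "x \<in> g" using t x h_subset gspace_g by blast+
  have "br s (\<phi> t) = 0" if "s \<in> h" for s
    using hom[of s t] h_abelian[OF that t(1)] subsetD[OF h_subset that] g(1) zero by simp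
  then have ht: "\<phi> t \<in> h" using closed[OF g(1)] by (subst h_eq) (simp add: weight_space_def)
  \<comment> \<open>an endomorphism of the adjoint module also satisfies \<open>\<phi>[x, y] = [\<phi> x, y]\<close>\<close>
  have "scale (\<alpha> t) (\<phi> x) = \<phi> (br t x)" using scl[OF g(2)] gspace_D[OF x(1) t(1)] by simp
  also have "\<dots> = \<phi> (scale (- 1) (br x t))" using br_anti[of t x] by simp
  also have "\<dots> = - br x (\<phi> t)" using scl[OF g_br[OF g(2,1)], of "-1"] hom[OF g(2,1)] by simp
  also have "\<dots> = br (\<phi> t) x" by (simp add: br_anti[of "\<phi> t" x])
  also have "\<dots> = scale (\<alpha> (\<phi> t)) x" using gspace_D[OF x(1) ht] .
  finally have "scale (1 / \<alpha> t) (scale (\<alpha> t) (\<phi> x)) = scale (1 / \<alpha> t) (scale (\<alpha> (\<phi> t)) x)" by simp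
  then have eig: "\<phi> x = scale (\<alpha> (\<phi> t) / \<alpha> t) x" using t(2) by simp
  let ?c = "\<alpha> (\<phi> t) / \<alpha> t"
  have "lie_ideal g {x \<in> g. \<phi> x = scale ?c x}"
    unfolding lie_ideal_def
    by (auto intro!: subspaceI simp: subspace_0[OF g_subspace] subspace_add[OF g_subspace]
        subspace_scale[OF g_subspace] g_br zero add scl hom br_scale_right scale_right_distrib mult.commute)
  moreover have "{x \<in> g. \<phi> x = scale ?c x} \<noteq> {0}" using eig g(2) x(2) by blast
  ultimately have "{x \<in> g. \<phi> x = scale ?c x} = g" using ideal_cases by blast
  then show ?thesis by blast
qed

end

lemma (in lie_algebra) nonneg_comb_add:
  "\<lbrakk>nonneg_comb r \<pi> \<alpha>; nonneg_comb r \<pi> \<beta>\<rbrakk> \<Longrightarrow> nonneg_comb r \<pi> (\<lambda>t. \<alpha> t + \<beta> t)"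
  unfolding nonneg_comb_def
  by (elim exE, rule_tac x = "\<lambda>i. n i + na i" in exI)
    (simp add: algebra_simps sum.distrib)

context based_simple
begin

lemma nonneg_comb_functional: "nonneg_comb r \<pi> \<alpha> \<Longrightarrow> \<alpha> \<in> functionals h"
  unfolding nonneg_comb_def
  by (auto intro!: functionals_sum functionals_mult rootsD(1)[OF simple_root])

lemma nonneg_comb_sum_nonzero:
  assumes "nonneg_comb r \<pi> \<alpha>" "nonneg_comb r \<pi> \<beta>" "(\<lambda>t. \<alpha> t + \<beta> t) = (\<lambda>_. 0)"
  shows "\<alpha> = (\<lambda>_. 0)"
proof -
  obtain m n :: "nat \<Rightarrow> nat" where m: "\<alpha> = (\<lambda>t. \<Sum>i<r. of_nat (m i) * \<pi> i t)"
    and n: "\<beta> = (\<lambda>t. \<Sum>i<r. of_nat (n i) * \<pi> i t)"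
    using assms unfolding nonneg_comb_def by blast
  have "(\<Sum>i<r. of_nat (m i + n i) * \<pi> i t) = (\<Sum>i<r. 0 * \<pi> i t)" for t
    using fun_cong[OF assms(3), of t] by (simp add: m n sum.distrib algebra_simps)
  then have "of_nat (m i + n i) = (0 :: 'f)" if "i < r" for i
    using simple_roots_independent[of "\<lambda>i. of_nat (m i + n i)" "\<lambda>_. 0"] that by blast
  then have "m i = 0" if "i < r" for i using that by (metis add_is_0 of_nat_eq_0_iff)
  then show ?thesis by (simp add: m)
qed

end

section \<open>Irreducible modules with a highest vector, covering both g and W\<close>

locale irreducible_module = based_simple scale br g h r \<pi> + M: vector_space sM
  for scale :: "'f::field_char_0 \<Rightarrow> 'l::ab_group_add \<Rightarrow> 'l" and br g h r \<pi>
    and sM :: "'f \<Rightarrow> 'm::ab_group_add \<Rightarrow> 'm" +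
  fixes M :: "'m set" and act :: "'l \<Rightarrow> 'm \<Rightarrow> 'm"
  assumes M_sub: "M.subspace M"
    and act_closed: "\<lbrakk>x \<in> g; v \<in> M\<rbrakk> \<Longrightarrow> act x v \<in> M"
    and act_add_left: "\<lbrakk>x \<in> g; y \<in> g; v \<in> M\<rbrakk> \<Longrightarrow> act (x + y) v = act x v + act y v"
    and act_add_right: "\<lbrakk>x \<in> g; u \<in> M; v \<in> M\<rbrakk> \<Longrightarrow> act x (u + v) = act x u + act x v"
    and act_scale_left: "\<lbrakk>x \<in> g; v \<in> M\<rbrakk> \<Longrightarrow> act (scale c x) v = sM c (act x v)"
    and act_scale_right: "\<lbrakk>x \<in> g; v \<in> M\<rbrakk> \<Longrightarrow> act x (sM c v) = sM c (act x v)"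
    and act_br: "\<lbrakk>x \<in> g; y \<in> g; v \<in> M\<rbrakk> \<Longrightarrow> act (br x y) v = act x (act y v) - act y (act x v)"
    and act_nontrivial: "\<exists>x\<in>g. \<exists>v\<in>M. act x v \<noteq> 0"
    and irreducible: "\<lbrakk>M.subspace N; N \<subseteq> M; \<And>x v. \<lbrakk>x \<in> g; v \<in> N\<rbrakk> \<Longrightarrow> act x v \<in> N\<rbrakk> \<Longrightarrow> N = {0} \<or> N = M"
begin

sublocale wm: weight_module sM h M act
  by unfold_locales (use M_sub act_closed act_add_right act_scale_right h_subset in auto)

lemma act_zero_right: "x \<in> g \<Longrightarrow> act x 0 = 0"
  using act_scale_right[of x 0 0] M.subspace_0[OF M_sub] by simp

lemma act_zero_left: "v \<in> M \<Longrightarrow> act 0 v = 0"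
  using act_scale_left[of 0 v 0] subspace_0[OF g_subspace] by simp

lemma act_sum_left:
  "\<lbrakk>v \<in> M; \<And>i. i \<in> I \<Longrightarrow> f i \<in> g\<rbrakk> \<Longrightarrow> act (sum f I) v = (\<Sum>i\<in>I. act (f i) v)"
proof (induction I rule: infinite_finite_induct)
  case (insert i I)
  then show ?case using subspace_sum[OF g_subspace, of I f] by (simp add: act_add_left)
qed (simp_all add: act_zero_left)

text \<open>Consequently every homomorphism from M to a trivial module is zero; this is how
  components in D are excluded.\<close>

lemma act_span: "M.span {act x v |x v. x \<in> g \<and> v \<in> M} = M"
proof -
  let ?N = "M.span {act x v |x v. x \<in> g \<and> v \<in> M}"
  have sub: "?N \<subseteq> M" by (rule M.span_minimal) (use act_closed M_sub in auto)
  have "?N = {0} \<or> ?N = M"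
    by (rule irreducible[OF M.subspace_span sub]) (use sub in \<open>blast intro: M.span_base\<close>)
  moreover obtain x v where xv: "x \<in> g" "v \<in> M" "act x v \<noteq> 0" using act_nontrivial by blast
  then have "act x v \<in> ?N" by (intro M.span_base) blast
  ultimately show ?thesis using xv(3) by blast
qed

definition highest_vector :: "('l \<Rightarrow> 'f) \<Rightarrow> 'm \<Rightarrow> bool" where
  "highest_vector \<theta> w \<longleftrightarrow> w \<in> wm.weight_vectors \<theta> \<and> w \<noteq> 0 \<and> \<theta> \<in> functionals h \<and>
     (\<forall>\<alpha>\<in>rootset. nonneg_comb r \<pi> \<alpha> \<longrightarrow> (\<forall>x\<in>gspace \<alpha>. act x w = 0))"

text \<open>Words in lowering operators applied to w. Their span plays the part of the submodule
  that the enveloping algebra of the negative root spaces generates from w. Taking \<alpha> nonzero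
  in the positive cone makes each letter strictly lower the weight.\<close>

inductive_set descendants :: "'m \<Rightarrow> 'm set" for w where
  top: "w \<in> descendants w"
| lower: "\<lbrakk>u \<in> descendants w; nonneg_comb r \<pi> \<alpha>; \<alpha> \<noteq> (\<lambda>_. 0); y \<in> gspace (\<lambda>t. - \<alpha> t)\<rbrakk>
    \<Longrightarrow> act y u \<in> descendants w"

lemma weight_vectors_D: "v \<in> wm.weight_vectors \<mu> \<Longrightarrow> t \<in> h \<Longrightarrow> act t v = sM (\<mu> t) v"
  and weight_vectors_M: "v \<in> wm.weight_vectors \<mu> \<Longrightarrow> v \<in> M"
  by (auto simp: wm.weight_vectors_def)

lemma act_weight:
  assumes x: "x \<in> gspace \<alpha>" and v: "v \<in> wm.weight_vectors \<mu>"
  shows "act x v \<in> wm.weight_vectors (\<lambda>t. \<mu> t + \<alpha> t)"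
proof -
  have xg: "x \<in> g" and vM: "v \<in> M" using x v gspace_g weight_vectors_M by blast+
  have "act t (act x v) = sM (\<mu> t + \<alpha> t) (act x v)" if t: "t \<in> h" for t
  proof -
    have tg: "t \<in> g" using t h_subset by blast
    have "act t (act x v) = act (br t x) v + act x (act t v)" using act_br[OF tg xg vM] by simp
    also have "\<dots> = sM (\<mu> t + \<alpha> t) (act x v)"
      using gspace_D[OF x t] weight_vectors_D[OF v t] xg vM
      by (simp add: act_scale_left act_scale_right M.scale_left_distrib)
    finally show ?thesis .
  qed
  then show ?thesis using act_closed[OF xg vM] by (simp add: wm.weight_vectors_def)
qed

lemma descendants_weight:
  assumes w: "highest_vector \<theta> w" and "u \<in> descendants w"
  shows "u \<in> M \<and> (u = w \<or> (\<exists>\<delta>. nonneg_comb r \<pi> \<delta> \<and> \<delta> \<noteq> (\<lambda>_. 0) \<and> u \<in> wm.weight_vectors (\<lambda>t. \<theta> t - \<delta> t)))"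
  using assms(2)
proof induction
  case top
  then show ?case using w weight_vectors_M by (auto simp: highest_vector_def)
next
  case (lower u \<alpha> y)
  from lower.IH consider "u \<in> wm.weight_vectors \<theta>"
    | \<delta> where "nonneg_comb r \<pi> \<delta>" "\<delta> \<noteq> (\<lambda>_. 0)" "u \<in> wm.weight_vectors (\<lambda>t. \<theta> t - \<delta> t)"
    using w by (auto simp: highest_vector_def)
  then have "\<exists>\<delta>. nonneg_comb r \<pi> \<delta> \<and> \<delta> \<noteq> (\<lambda>_. 0) \<and> act y u \<in> wm.weight_vectors (\<lambda>t. \<theta> t - \<delta> t)"
  proof cases
    case 1
    then have "act y u \<in> wm.weight_vectors (\<lambda>t. \<theta> t - \<alpha> t)"
      using act_weight[OF lower(4)] by fastforce
    then show ?thesis using lower by blast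
  next
    case 2
    have "act y u \<in> wm.weight_vectors (\<lambda>t. (\<theta> t - \<delta> t) + - \<alpha> t)"
      by (rule act_weight[OF lower(4) 2(3)])
    then have "act y u \<in> wm.weight_vectors (\<lambda>t. \<theta> t - (\<alpha> t + \<delta> t))"
      by (simp add: algebra_simps)
    moreover have "(\<lambda>t. \<alpha> t + \<delta> t) \<noteq> (\<lambda>_. 0)" using nonneg_comb_sum_nonzero lower(2,3) 2(1) by blast
    ultimately show ?thesis using nonneg_comb_add[OF lower(2) 2(1)]
      by (intro exI[of _ "\<lambda>t. \<alpha> t + \<delta> t"]) blast
  qed
  then show ?case using weight_vectors_M by blast
qed

text \<open>Induction on the length of the word, for all z at once:
  \<open>z y u = [z, y] u + y z u\<close>. The induction hypothesis for u covers
  \<open>[z, y]\<close> and z, and the span is stable under the lowering operator y. On w itself, z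
  is split into weight components: positive ones kill w, h scales it, negative ones give
  descendants.\<close>

lemma descendants_stable:
  assumes w: "highest_vector \<theta> w" and "u \<in> descendants w"
  shows "z \<in> g \<Longrightarrow> act z u \<in> M.span (descendants w)"
  using assms(2)
proof (induction arbitrary: z)
  case top
  have wM: "w \<in> M" using w by (auto simp: highest_vector_def wm.weight_vectors_def)
  obtain f where f: "\<forall>\<mu>\<in>weightset. f \<mu> \<in> gspace \<mu>" "z = (\<Sum>\<mu>\<in>weightset. f \<mu>)"
    using weight_decomposition[OF \<open>z \<in> g\<close>] by (elim exE conjE) (rule that)
  have fg: "f \<mu> \<in> g" if "\<mu> \<in> weightset" for \<mu> using gspace_g bspec[OF f(1) that] .
  have "act z w = (\<Sum>\<mu>\<in>weightset. act (f \<mu>) w)" unfolding f(2) using wM fg by (rule act_sum_left)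
  moreover have "act (f \<mu>) w \<in> M.span (descendants w)" if \<mu>: "\<mu> \<in> weightset" for \<mu>
  proof (cases "\<mu> \<in> rootset")
    case True
    then consider "nonneg_comb r \<pi> \<mu>" | "nonneg_comb r \<pi> (\<lambda>t. - \<mu> t)" using root_sign by blast
    then show ?thesis
    proof cases
      case 1
      then have "act (f \<mu>) w = 0" using w True bspec[OF f(1) \<mu>] unfolding highest_vector_def by blast
      then show ?thesis by (simp add: M.span_zero)
    next
      case 2
      have "(\<lambda>t. - \<mu> t) \<noteq> (\<lambda>_. 0)" using rootsD(2)[OF True] by (auto simp: fun_eq_iff)
      then have "act (f \<mu>) w \<in> descendants w"
        using descendants.lower[OF descendants.top 2, of "f \<mu>"] bspec[OF f(1) \<mu>] by simp
      then show ?thesis by (rule M.span_base)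
    qed
  next
    case False
    then have "f \<mu> \<in> h" using \<mu> bspec[OF f(1) \<mu>] h_eq by blast
    then have "act (f \<mu>) w = sM (\<theta> (f \<mu>)) w" using w weight_vectors_D by (simp add: highest_vector_def)
    then show ?thesis by (simp add: M.span_scale M.span_base descendants.top)
  qed
  ultimately show ?case by (simp only:) (rule M.span_sum)
next
  case (lower u \<alpha> y)
  have sub: "descendants w \<subseteq> M" using descendants_weight[OF w] by blast
  then have spM: "M.span (descendants w) \<subseteq> M" using M.span_minimal M_sub by blast
  have yg: "y \<in> g" using lower.hyps gspace_g by blast
  have yS: "act y v \<in> M.span (descendants w)" if "v \<in> M.span (descendants w)" for v
  proof -
    have "v \<in> M \<and> act y v \<in> M.span (descendants w)"
      using that
    proof (induction rule: M.span_induct_alt)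
      case base
      then show ?case by (simp add: act_zero_right yg M.span_zero M.subspace_0[OF M_sub])
    next
      case (step c x v)
      then have "act y x \<in> M.span (descendants w)"
        using lower.hyps by (intro M.span_base descendants.lower)
      moreover have "x \<in> M" using step sub by blast
      ultimately show ?case
        using step yg
        by (simp add: act_add_right act_scale_right M.subspace_scale[OF M_sub] M.subspace_add[OF M_sub]
            M.span_add M.span_scale)
    qed
    then show ?thesis ..
  qed
  have uM: "u \<in> M" using lower.hyps sub by blast
  have "act z (act y u) = act (br z y) u + act y (act z u)"
    using act_br[OF \<open>z \<in> g\<close> yg uM] by simp
  then show ?case
    using lower.IH[OF g_br[OF \<open>z \<in> g\<close> yg]] yS[OF lower.IH[OF \<open>z \<in> g\<close>]] by (simp add: M.span_add)
qed

lemma descendants_span: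
  assumes w: "highest_vector \<theta> w"
  shows "M.span (descendants w) = M"
proof -
  have sub: "descendants w \<subseteq> M" using descendants_weight[OF w] by blast
  then have spM: "M.span (descendants w) \<subseteq> M" using M.span_minimal M_sub by blast
  have "act x v \<in> M.span (descendants w)" if "x \<in> g" "v \<in> M.span (descendants w)" for x v
  proof -
    have "v \<in> M \<and> act x v \<in> M.span (descendants w)"
      using that(2)
    proof (induction rule: M.span_induct_alt)
      case base
      then show ?case by (simp add: act_zero_right that M.span_zero M.subspace_0[OF M_sub])
    next
      case (step c u v)
      then have "u \<in> M" "act x u \<in> M.span (descendants w)"
        using sub descendants_stable[OF w _ that(1)] by auto
      then show ?case
        using step that(1)
        by (simp add: act_add_right act_scale_right M.subspace_scale[OF M_sub] M.subspace_add[OF M_sub]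
            M.span_add M.span_scale)
    qed
    then show ?thesis ..
  qed
  then have "M.span (descendants w) = {0} \<or> M.span (descendants w) = M"
    using irreducible[OF M.subspace_span spM] by blast
  moreover have "w \<in> M.span (descendants w)" by (simp add: M.span_base descendants.top)
  moreover have "w \<noteq> 0" using w by (simp add: highest_vector_def)
  ultimately show ?thesis by blast
qed

text \<open>M is spanned by vectors of weights \<open>\<theta> - \<delta>\<close> with \<delta> in
  the positive cone. If \<mu> is not among these weights, a vector of weight \<mu> vanishes by
  independence.\<close>

lemma highest_weight_bound:
  assumes w: "highest_vector \<theta> w" and v: "v \<in> wm.weight_vectors \<mu>" "v \<noteq> 0" and \<mu>: "\<mu> \<in> functionals h"
  shows "nonneg_comb r \<pi> (\<lambda>t. \<theta> t - \<mu> t)"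
proof (rule ccontr)
  assume no: "\<not> ?thesis"
  have \<theta>: "\<theta> \<in> functionals h" "w \<in> wm.weight_vectors \<theta>" using w by (auto simp: highest_vector_def)
  have nc0: "nonneg_comb r \<pi> (\<lambda>_. 0)"
    unfolding nonneg_comb_def by (intro exI[of _ "\<lambda>_. 0"]) simp
  have "v = 0"
  proof (rule wm.weight_vector_span_zero[OF v(1)])
    show "v \<in> M.span (descendants w)" using weight_vectors_M[OF v(1)] descendants_span[OF w] by simp
    fix u assume "u \<in> descendants w"
    then obtain \<delta> where \<delta>: "nonneg_comb r \<pi> \<delta>" "u \<in> wm.weight_vectors (\<lambda>t. \<theta> t - \<delta> t)"
      using descendants_weight[OF w] nc0 \<theta>(2) by force
    have "\<exists>t\<in>h. \<theta> t - \<delta> t \<noteq> \<mu> t"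
    proof (rule ccontr)
      assume "\<not> ?thesis"
      then have "\<forall>t\<in>h. \<theta> t - \<mu> t = \<delta> t" by (auto simp: algebra_simps)
      moreover have "\<delta> \<in> functionals h" using nonneg_comb_functional \<delta>(1) .
      moreover have "(\<lambda>t. \<theta> t - \<mu> t) \<in> functionals h"
        using functionals_add[OF \<theta>(1) functionals_mult[OF \<mu>, of "-1"]] by simp
      ultimately have "(\<lambda>t. \<theta> t - \<mu> t) = \<delta>" by (intro functional_eqI) auto
      then show False using no \<delta>(1) by simp
    qed
    then show "\<exists>\<sigma>. u \<in> wm.weight_vectors \<sigma> \<and> (\<exists>t\<in>h. \<sigma> t \<noteq> \<mu> t)" using \<delta>(2) by blast
  qed
  then show False using v(2) by contradiction
qed

text \<open>All descendants other than w have weights strictly below \<theta>, so after splitting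
  off the w-coordinate the rest of v lies in the span of other weights.\<close>

lemma highest_weight_space:
  assumes w: "highest_vector \<theta> w" and v: "v \<in> wm.weight_vectors \<theta>"
  shows "\<exists>c. v = sM c w"
proof -
  have \<theta>: "\<theta> \<in> functionals h" "w \<in> wm.weight_vectors \<theta>" using w by (auto simp: highest_vector_def)
  let ?L = "descendants w - {w}"
  have "insert w ?L = descendants w" using descendants.top by blast
  then have "v \<in> M.span (insert w ?L)" using weight_vectors_M[OF v] descendants_span[OF w] by simp
  then obtain c where c: "v - sM c w \<in> M.span ?L" using M.span_insert[of w ?L] by blast
  have "v - sM c w = 0"
  proof (rule wm.weight_vector_span_zero[OF _ c])
    show "v - sM c w \<in> wm.weight_vectors \<theta>"
      using v \<theta>(2) M.subspace_diff[OF wm.weight_subspace] M.subspace_scale[OF wm.weight_subspace] by blast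
    fix u assume "u \<in> ?L"
    then obtain \<delta> where \<delta>: "nonneg_comb r \<pi> \<delta>" "\<delta> \<noteq> (\<lambda>_. 0)" "u \<in> wm.weight_vectors (\<lambda>t. \<theta> t - \<delta> t)"
      using descendants_weight[OF w] by blast
    have "\<exists>t\<in>h. \<delta> t \<noteq> 0"
      using functional_neq[OF nonneg_comb_functional[OF \<delta>(1)] functionals_zero \<delta>(2)] by simp
    then show "\<exists>\<sigma>. u \<in> wm.weight_vectors \<sigma> \<and> (\<exists>t\<in>h. \<sigma> t \<noteq> \<theta> t)" using \<delta>(3) by force
  qed
  then show ?thesis by (intro exI[of _ c]) simp
qed

text \<open>The one-dimensional highest weight space supplies the eigenvalue over an arbitrary
  field; the eigenspace is then a nonzero submodule.\<close>

lemma highest_weight_endomorphism_scalar: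
  assumes w: "highest_vector \<theta> w"
    and closed: "\<And>x. x \<in> M \<Longrightarrow> \<phi> x \<in> M"
    and add: "\<And>x y. \<lbrakk>x \<in> M; y \<in> M\<rbrakk> \<Longrightarrow> \<phi> (x + y) = \<phi> x + \<phi> y"
    and scl: "\<And>c x. x \<in> M \<Longrightarrow> \<phi> (sM c x) = sM c (\<phi> x)"
    and hom: "\<And>x y. \<lbrakk>x \<in> g; y \<in> M\<rbrakk> \<Longrightarrow> \<phi> (act x y) = act x (\<phi> y)"
  shows "\<exists>c. \<forall>x\<in>M. \<phi> x = sM c x"
proof -
  have wM: "w \<in> M" "w \<noteq> 0" using w by (auto simp: highest_vector_def wm.weight_vectors_def)
  have "act t (\<phi> w) = sM (\<theta> t) (\<phi> w)" if "t \<in> h" for t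
    using hom[of t w] w that h_subset scl[OF wM(1)] weight_vectors_D[of w \<theta> t] wM(1)
    by (auto simp: highest_vector_def)
  then have "\<phi> w \<in> wm.weight_vectors \<theta>" using closed[OF wM(1)] by (simp add: wm.weight_vectors_def)
  then obtain c where c: "\<phi> w = sM c w" using highest_weight_space[OF w] by blast
  let ?N = "{x \<in> M. \<phi> x = sM c x}"
  have zero: "\<phi> 0 = 0" using scl[OF wM(1), of 0] by simp
  have "M.subspace ?N"
    by (auto intro!: M.subspaceI simp: M.subspace_0[OF M_sub] M.subspace_add[OF M_sub]
        M.subspace_scale[OF M_sub] zero add scl M.scale_right_distrib mult.commute)
  then have "?N = {0} \<or> ?N = M"
    by (rule irreducible) (auto simp: act_closed hom act_scale_right)
  moreover have "?N \<noteq> {0}" using c wM by blast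
  ultimately show ?thesis by blast
qed

end

section \<open>The modules g and W are not isomorphic\<close>

context based_simple
begin

lemma adjoint_module: "irreducible_module scale br g h r \<pi> scale g br"
proof unfold_locales
  fix N assume N: "subspace N" "N \<subseteq> g" "\<And>x v. \<lbrakk>x \<in> g; v \<in> N\<rbrakk> \<Longrightarrow> br x v \<in> N"
  then show "N = {0} \<or> N = g" by (intro ideal_cases) (simp add: lie_ideal_def)
qed (use g_subspace g_br not_abelian in
    \<open>auto simp: br_add_left br_add_right br_scale_left br_scale_right br_br\<close>)

text \<open>Applied to the adjoint module, \<open>highest_weight_bound\<close> puts the weight of
  any highest vector of g above all weights of g.\<close>

lemma adjoint_highest_not_short:
  assumes x: "x \<in> gspace \<theta>" "x \<noteq> 0" and \<theta>: "\<theta> \<in> functionals h"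
    and top: "\<And>\<alpha> y. \<lbrakk>\<alpha> \<in> rootset; nonneg_comb r \<pi> \<alpha>; y \<in> gspace \<alpha>\<rbrakk> \<Longrightarrow> br y x = 0"
  shows "\<theta> \<notin> short_roots g h"
proof (rule highest_root_not_short)
  interpret ad: irreducible_module scale br g h r \<pi> scale g br by (rule adjoint_module)
  have eq: "weight_module.weight_vectors scale h g br \<mu> = gspace \<mu>" for \<mu>
    by (simp add: weight_module.weight_vectors_def[OF adj.weight_module_axioms] weight_space_def)
  have hv: "ad.highest_vector \<theta> x" unfolding ad.highest_vector_def eq using assms by blast
  fix \<mu> assume \<mu>: "\<mu> \<in> weightset"
  then obtain v where "v \<in> gspace \<mu>" "v \<noteq> 0" using weight_nonzero by blast
  then show "nonneg_comb r \<pi> (\<lambda>t. \<theta> t - \<mu> t)"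
    using ad.highest_weight_bound[OF hv] weightset_functionals[OF \<mu>] unfolding eq by blast
qed

end

context irreducible_module
begin

text \<open>A nonzero homomorphism would be injective and carry w to a highest vector of g whose
  weight is a short root.\<close>

lemma no_hom_to_adjoint:
  assumes w: "highest_vector \<theta> w" and short: "\<theta> \<in> short_roots g h"
    and closed: "\<And>v. v \<in> M \<Longrightarrow> \<phi> v \<in> g"
    and add: "\<And>x y. \<lbrakk>x \<in> M; y \<in> M\<rbrakk> \<Longrightarrow> \<phi> (x + y) = \<phi> x + \<phi> y"
    and scl: "\<And>c x. x \<in> M \<Longrightarrow> \<phi> (sM c x) = scale c (\<phi> x)"
    and hom: "\<And>x v. \<lbrakk>x \<in> g; v \<in> M\<rbrakk> \<Longrightarrow> \<phi> (act x v) = br x (\<phi> v)"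
    and "v \<in> M"
  shows "\<phi> v = 0"
proof -
  let ?N = "{v \<in> M. \<phi> v = 0}"
  have wM: "w \<in> M" "w \<in> wm.weight_vectors \<theta>" "w \<noteq> 0" "\<theta> \<in> functionals h"
    using w by (auto simp: highest_vector_def wm.weight_vectors_def)
  have zero: "\<phi> 0 = 0" using scl[OF wM(1), of 0] by simp
  have "M.subspace ?N"
    by (auto intro!: M.subspaceI simp: M.subspace_0[OF M_sub] M.subspace_add[OF M_sub]
        M.subspace_scale[OF M_sub] zero add scl)
  then have "?N = {0} \<or> ?N = M"
    by (rule irreducible) (auto simp: act_closed hom)
  moreover have "?N \<noteq> {0}"
  proof
    assume "?N = {0}"
    then have nz: "\<phi> w \<noteq> 0" using wM by blast
    have "\<phi> w \<in> gspace \<theta>"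
      using closed[OF wM(1)] hom[OF _ wM(1)] weight_vectors_D[OF wM(2)] scl[OF wM(1)] h_subset
      by (force simp: weight_space_def)
    moreover have "br y (\<phi> w) = 0" if "\<alpha> \<in> rootset" "nonneg_comb r \<pi> \<alpha>" "y \<in> gspace \<alpha>" for \<alpha> y
      using w that hom[OF gspace_g[OF that(3)] wM(1)] zero by (simp add: highest_vector_def)
    ultimately show False using adjoint_highest_not_short[OF _ nz wM(4)] short by blast
  qed
  ultimately show ?thesis using assms(7) by blast
qed

text \<open>The kernel is an ideal and the image a submodule, so a nonzero homomorphism is
  bijective; surjectivity lets w be pulled back to a highest vector of g of short weight.\<close>

lemma no_hom_from_adjoint:
  assumes w: "highest_vector \<theta> w" and short: "\<theta> \<in> short_roots g h"
    and closed: "\<And>x. x \<in> g \<Longrightarrow> \<phi> x \<in> M"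
    and add: "\<And>x y. \<lbrakk>x \<in> g; y \<in> g\<rbrakk> \<Longrightarrow> \<phi> (x + y) = \<phi> x + \<phi> y"
    and scl: "\<And>c x. x \<in> g \<Longrightarrow> \<phi> (scale c x) = sM c (\<phi> x)"
    and hom: "\<And>x y. \<lbrakk>x \<in> g; y \<in> g\<rbrakk> \<Longrightarrow> \<phi> (br x y) = act x (\<phi> y)"
    and "x \<in> g"
  shows "\<phi> x = 0"
proof (rule ccontr)
  assume nz: "\<phi> x \<noteq> 0"
  let ?N = "{x \<in> g. \<phi> x = 0}"
  have wM: "w \<in> M" "w \<in> wm.weight_vectors \<theta>" "w \<noteq> 0" "\<theta> \<in> functionals h"
    using w by (auto simp: highest_vector_def wm.weight_vectors_def)
  have zero: "\<phi> 0 = 0" using scl[of 0 0] subspace_0[OF g_subspace] by simp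
  have "lie_ideal g ?N"
    unfolding lie_ideal_def
    by (auto intro!: subspaceI simp: subspace_0[OF g_subspace] subspace_add[OF g_subspace]
        subspace_scale[OF g_subspace] zero add scl hom g_br act_zero_right)
  then have ker: "?N = {0}" using ideal_cases nz assms(7) by blast
  have inj: "x = y" if "x \<in> g" "y \<in> g" "\<phi> x = \<phi> y" for x y
  proof -
    have "x + scale (- 1) y \<in> ?N"
      using that add[OF that(1) subspace_scale[OF g_subspace that(2)]] scl[OF that(2)]
        subspace_add[OF g_subspace that(1) subspace_scale[OF g_subspace that(2)]]
      by (simp del: scale_minus_left M.scale_minus_left) simp
    then show ?thesis using ker by simp
  qed
  have "M.subspace (\<phi> ` g)"
  proof (rule M.subspaceI)
    show "0 \<in> \<phi> ` g" using zero subspace_0[OF g_subspace] by force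
    show "u + v \<in> \<phi> ` g" if "u \<in> \<phi> ` g" "v \<in> \<phi> ` g" for u v
    proof -
      obtain a b where "a \<in> g" "u = \<phi> a" "b \<in> g" "v = \<phi> b" using \<open>u \<in> \<phi> ` g\<close> \<open>v \<in> \<phi> ` g\<close> by blast
      then show ?thesis using add[of a b] subspace_add[OF g_subspace, of a b] by (metis imageI)
    qed
    show "sM c u \<in> \<phi> ` g" if "u \<in> \<phi> ` g" for c u
    proof -
      obtain a where "a \<in> g" "u = \<phi> a" using \<open>u \<in> \<phi> ` g\<close> by blast
      then show ?thesis using scl[of a c] subspace_scale[OF g_subspace, of a c] by (metis imageI)
    qed
  qed
  then have "\<phi> ` g = {0} \<or> \<phi> ` g = M"
  proof (rule irreducible)
    show "\<phi> ` g \<subseteq> M" using closed by blast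
    show "act x v \<in> \<phi> ` g" if "x \<in> g" "v \<in> \<phi> ` g" for x v
    proof -
      obtain a where "a \<in> g" "v = \<phi> a" using \<open>v \<in> \<phi> ` g\<close> by blast
      then show ?thesis using hom[of x a] g_br[of x a] \<open>x \<in> g\<close> by (metis imageI)
    qed
  qed
  then have "\<phi> ` g = M" using nz assms(7) by blast
  then obtain y where y: "y \<in> g" "\<phi> y = w" using wM(1) by blast
  have "y \<noteq> 0" using y zero wM(3) by blast
  moreover have "br t y = scale (\<theta> t) y" if "t \<in> h" for t
  proof (rule inj)
    show "\<phi> (br t y) = \<phi> (scale (\<theta> t) y)"
      using hom[of t y] y that h_subset scl[OF y(1)] weight_vectors_D[OF wM(2) that] by auto
  qed (use that h_subset y g_br subspace_scale[OF g_subspace] in auto)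
  then have "y \<in> gspace \<theta>" using y(1) by (simp add: weight_space_def)
  moreover have "br z y = 0" if "\<alpha> \<in> rootset" "nonneg_comb r \<pi> \<alpha>" "z \<in> gspace \<alpha>" for \<alpha> z
  proof (rule inj)
    have "act z w = 0" using w that unfolding highest_vector_def by blast
    then show "\<phi> (br z y) = \<phi> 0" using hom[OF gspace_g[OF that(3)] y(1)] y(2) zero by simp
  qed (use that y g_br gspace_g subspace_0[OF g_subspace] in auto)
  ultimately show False using adjoint_highest_not_short[of y \<theta>] wM(4) short by blast
qed

end

section \<open>Homomorphisms into tensor products\<close>

text \<open>That endomorphisms of U are scalars is an assumption, because it is proved differently
  for the two instances: through an ideal for g, through the highest weight space for W.\<close>

locale tensor_module = irreducible_module scale br g h r \<pi> sU U act + V: vector_space sV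
  for scale :: "'f::field_char_0 \<Rightarrow> 'l::ab_group_add \<Rightarrow> 'l" and br g h r \<pi>
    and sU :: "'f \<Rightarrow> 'u::ab_group_add \<Rightarrow> 'u" and U act
    and sV :: "'f \<Rightarrow> 'v::ab_group_add \<Rightarrow> 'v" +
  fixes V :: "'v set" and tens :: "'u \<Rightarrow> 'v \<Rightarrow> 'l"
  assumes V_sub: "V.subspace V"
    and tensor: "tensor_map sU sV scale U V tens"
    and tens_act: "\<lbrakk>x \<in> g; u \<in> U; v \<in> V\<rbrakk> \<Longrightarrow> br x (tens u v) = tens (act x u) v"
    and endomorphism_scalar:
      "\<lbrakk>\<And>x. x \<in> U \<Longrightarrow> \<phi> x \<in> U;
        \<And>x y. \<lbrakk>x \<in> U; y \<in> U\<rbrakk> \<Longrightarrow> \<phi> (x + y) = \<phi> x + \<phi> y;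
        \<And>c x. x \<in> U \<Longrightarrow> \<phi> (sU c x) = sU c (\<phi> x);
        \<And>x y. \<lbrakk>x \<in> g; y \<in> U\<rbrakk> \<Longrightarrow> \<phi> (act x y) = act x (\<phi> y)\<rbrakk>
       \<Longrightarrow> \<exists>c. \<forall>x\<in>U. \<phi> x = sU c x"
begin

abbreviation tensors where "tensors \<equiv> span {tens u v |u v. u \<in> U \<and> v \<in> V}"

lemma tens_add_left: "\<lbrakk>u \<in> U; u' \<in> U; v \<in> V\<rbrakk> \<Longrightarrow> tens (u + u') v = tens u v + tens u' v"
  and tens_add_right: "\<lbrakk>u \<in> U; v \<in> V; v' \<in> V\<rbrakk> \<Longrightarrow> tens u (v + v') = tens u v + tens u v'"
  and tens_scale_left: "\<lbrakk>u \<in> U; v \<in> V\<rbrakk> \<Longrightarrow> tens (sU c u) v = scale c (tens u v)"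
  and tens_scale_right: "\<lbrakk>u \<in> U; v \<in> V\<rbrakk> \<Longrightarrow> tens u (sV c v) = scale c (tens u v)"
  using tensor unfolding tensor_map_def bilinear_on_def by blast+

lemma tens_zero_left: "v \<in> V \<Longrightarrow> tens 0 v = 0"
  using tens_scale_left[of 0 v 0] M.subspace_0[OF M_sub] by simp

lemma tens_zero_right: "u \<in> U \<Longrightarrow> tens u 0 = 0"
  using tens_scale_right[of u 0 0] V.subspace_0[OF V_sub] by simp

lemma tens_sum_right:
  "\<lbrakk>u \<in> U; \<And>i. i \<in> I \<Longrightarrow> f i \<in> V\<rbrakk> \<Longrightarrow> tens u (sum f I) = (\<Sum>i\<in>I. tens u (f i))"
proof (induction I rule: infinite_finite_induct)
  case (insert i I)
  then show ?case using V.subspace_sum[OF V_sub, of I f] by (simp add: tens_add_right)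
qed (simp_all add: tens_zero_right)

lemma tens_eq_0D:
  assumes "u \<in> U" "u \<noteq> 0" "v \<in> V" "tens u v = 0"
  shows "v = 0"
proof (rule ccontr)
  assume "v \<noteq> 0"
  obtain E where E: "{u} \<subseteq> E" "E \<subseteq> U" "M.independent E" "U \<subseteq> M.span E"
    by (rule M.maximal_independent_subset_extend[of "{u}" U]) (use assms in auto)
  obtain F where F: "{v} \<subseteq> F" "F \<subseteq> V" "V.independent F" "V \<subseteq> V.span F"
    by (rule V.maximal_independent_subset_extend[of "{v}" V]) (use assms \<open>v \<noteq> 0\<close> in auto)
  have "M.span E = U" "V.span F = V"
    using E F M.span_minimal[OF E(2) M_sub] V.span_minimal[OF F(2) V_sub] by blast+
  then have "independent ((\<lambda>(e, f). tens e f) ` (E \<times> F))"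
    using tensor E F unfolding tensor_map_def by blast
  moreover have "tens u v \<in> (\<lambda>(e, f). tens e f) ` (E \<times> F)" using E F by force
  ultimately show False using assms(4) dependent_zero by metis
qed

text \<open>\<open>s f\<close> is the coordinate map from U \<otimes> V to U along the basis vector
  f of V. \<open>tensor_map\<close> speaks about pairs of bases only, so a basis E of U is chosen as
  well and the value on \<open>tens u f'\<close> is extended linearly from E.\<close>

lemma slices:
  obtains F :: "'v set" and s :: "'v \<Rightarrow> 'l \<Rightarrow> 'u"
  where "F \<subseteq> V" and "\<And>f. Vector_Spaces.linear scale sU (s f)" and "\<And>f y. s f y \<in> U"
    and "\<And>f f' u. \<lbrakk>f \<in> F; f' \<in> F; u \<in> U\<rbrakk> \<Longrightarrow> s f (tens u f') = (if f = f' then u else 0)"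
    and "V \<subseteq> V.span F"
proof -
  obtain E where E: "E \<subseteq> U" "M.independent E" "U \<subseteq> M.span E"
    using M.maximal_independent_subset by blast
  obtain F where F: "F \<subseteq> V" "V.independent F" "V \<subseteq> V.span F"
    using V.maximal_independent_subset by blast
  have sp: "M.span E = U" "V.span F = V"
    using E F M.span_minimal[OF E(1) M_sub] V.span_minimal[OF F(1) V_sub] by blast+
  let ?t = "\<lambda>(e, f). tens e f"
  let ?X = "?t ` (E \<times> F)"
  have inj: "inj_on ?t (E \<times> F)" and ind: "independent ?X"
    using tensor E F sp unfolding tensor_map_def by blast+
  interpret vp: vector_space_pair scale sU ..
  \<comment> \<open>The products of basis vectors are pairwise distinct, so each determines its pair
    (e, f'); k returns e when the second entry is f.\<close>
  define k where "k f x = (let p = the_inv_into (E \<times> F) ?t x in if snd p = f then fst p else 0)" for f x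
  have k: "k f (tens e f') = (if f' = f then e else 0)" if "e \<in> E" "f' \<in> F" for e f f'
    using the_inv_into_f_f[OF inj, of "(e, f')"] that by (simp add: k_def)
  define s where "s f = vp.construct ?X (k f)" for f
  have lin: "Vector_Spaces.linear scale sU (s f)" for f
    unfolding s_def by (rule vp.linear_construct[OF ind])
  have sU: "s f y \<in> U" for f y
  proof -
    have "s f y \<in> M.span (k f ` ?X)" unfolding s_def by (rule vp.construct_in_span[OF ind])
    moreover have "k f ` ?X \<subseteq> U" using k E(1) M.subspace_0[OF M_sub] by auto
    ultimately show ?thesis using M.span_minimal M_sub by blast
  qed
  have val: "s f (tens u f') = (if f = f' then u else 0)" if "f \<in> F" "f' \<in> F" "u \<in> U" for f f' u
  proof -
    interpret l: Vector_Spaces.linear scale sU "s f" by (rule lin)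
    have f'V: "f' \<in> V" using F that by blast
    have "u \<in> M.span E" using that sp by simp
    then have "u \<in> U \<and> s f (tens u f') = (if f = f' then u else 0)"
    proof (induction rule: M.span_induct_alt)
      case base
      then show ?case using tens_zero_left[OF f'V] M.subspace_0[OF M_sub] by simp
    next
      case (step c e u)
      have eU: "e \<in> U" using step E by blast
      have "tens e f' \<in> ?X" using step(1) that(2) by force
      then have "s f (tens e f') = k f (tens e f')" unfolding s_def by (rule vp.construct_basis[OF ind])
      also have "\<dots> = (if f = f' then e else 0)" using k[OF step(1) that(2), of f] by simp
      finally have "s f (tens e f') = (if f = f' then e else 0)" .
      then show ?case
        using step eU f'V
        by (simp add: tens_add_left tens_scale_left M.subspace_scale[OF M_sub] M.subspace_add[OF M_sub]
            l.add l.scale)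
    qed
    then show ?thesis ..
  qed
  show ?thesis by (rule that[OF F(1) lin sU val F(3)])
qed

text \<open>Even for infinite F a tensor has finitely many nonzero slices, and it is recovered from
  them. The explicit finite set I allows the slices of two tensors to be added.\<close>

lemma slice_expansion:
  assumes F: "F \<subseteq> V" and lin: "\<And>f. Vector_Spaces.linear scale sU (s f)" and sU: "\<And>f y. s f y \<in> U"
    and val: "\<And>f f' u. \<lbrakk>f \<in> F; f' \<in> F; u \<in> U\<rbrakk> \<Longrightarrow> s f (tens u f') = (if f = f' then u else 0)"
    and sp: "V \<subseteq> V.span F" and y: "y \<in> tensors"
  shows "\<exists>I. finite I \<and> I \<subseteq> F \<and> (\<forall>f\<in>F - I. s f y = 0) \<and> y = (\<Sum>f\<in>I. tens (s f y) f)"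
proof -
  have s_add: "s f (x + y) = s f x + s f y" and s_scale: "s f (scale c x) = sU c (s f x)"
    and s_zero: "s f 0 = 0" and s_sum: "s f (sum k I) = (\<Sum>i\<in>I. s f (k i))" for f x y c k and I :: "'v set"
  proof -
    interpret l: Vector_Spaces.linear scale sU "s f" by (rule lin)
    show "s f (x + y) = s f x + s f y" "s f (scale c x) = sU c (s f x)" "s f 0 = 0"
      "s f (sum k I) = (\<Sum>i\<in>I. s f (k i))"
      by (simp_all add: l.add l.scale l.sum)
  qed
  \<comment> \<open>Zero slices are added to the index set, so that the expansions of x and y can
    both run over I \<union> J.\<close>
  have extend: "y = (\<Sum>f\<in>J. tens (s f y) f)"
    if "finite J" "I \<subseteq> J" "J \<subseteq> F" "\<forall>f\<in>F - I. s f y = 0" "y = (\<Sum>f\<in>I. tens (s f y) f)" for I J y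
  proof -
    have "(\<Sum>f\<in>I. tens (s f y) f) = (\<Sum>f\<in>J. tens (s f y) f)"
      by (rule sum.mono_neutral_left) (use that F tens_zero_left in \<open>auto simp: subset_iff\<close>)
    then show ?thesis using that(5) by simp
  qed
  from y show ?thesis
  proof (induction rule: span_induct_alt)
    case base
    show ?case by (rule exI[of _ "{}"]) (simp add: s_zero)
  next
    case (step c x y)
    then obtain u v where uv: "x = tens u v" "u \<in> U" "v \<in> V" by blast
    obtain I a where I: "finite I" "I \<subseteq> F" "v = (\<Sum>f\<in>I. sV (a f) f)"
      using sp uv(3) by (auto simp: V.span_explicit)
    have IV: "f \<in> V" if "f \<in> I" for f using that I F by blast
    have x: "x = (\<Sum>f\<in>I. tens (sU (a f) u) f)"
      unfolding uv(1) I(3) using uv(2) IV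
      by (subst tens_sum_right) (auto simp: tens_scale_left tens_scale_right V.subspace_scale[OF V_sub])
    have sx: "s f x = (if f \<in> I then sU (a f) u else 0)" if "f \<in> F" for f
    proof -
      have "s f x = (\<Sum>f'\<in>I. s f (tens (sU (a f') u) f'))" unfolding x by (rule s_sum)
      also have "\<dots> = (\<Sum>f'\<in>I. if f = f' then sU (a f') u else 0)"
        by (intro sum.cong val) (use that I uv(2) M.subspace_scale[OF M_sub] in auto)
      finally show ?thesis using I(1) by simp
    qed
    have x': "x = (\<Sum>f\<in>I. tens (s f x) f)"
    proof -
      have "(\<Sum>f\<in>I. tens (s f x) f) = (\<Sum>f\<in>I. tens (sU (a f) u) f)"
        by (intro sum.cong) (use sx I in auto)
      then show ?thesis using x by simp
    qed
    obtain J where J: "finite J" "J \<subseteq> F" "\<forall>f\<in>F - J. s f y = 0" "y = (\<Sum>f\<in>J. tens (s f y) f)"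
      using step by blast
    have 1: "x = (\<Sum>f\<in>I \<union> J. tens (s f x) f)" by (rule extend[OF _ _ _ _ x']) (use I J sx in auto)
    have 2: "y = (\<Sum>f\<in>I \<union> J. tens (s f y) f)" by (rule extend[OF _ _ _ J(3,4)]) (use I J in auto)
    have "(\<Sum>f\<in>I \<union> J. tens (s f (scale c x + y)) f) =
        (\<Sum>f\<in>I \<union> J. scale c (tens (s f x) f) + tens (s f y) f)"
      using I J F sU M.subspace_scale[OF M_sub]
      by (intro sum.cong) (auto simp: s_add s_scale tens_add_left tens_scale_left subset_iff)
    also have "\<dots> = scale c x + y"
      using arg_cong[OF 1, of "scale c"] 2 by (simp add: sum.distrib scale_sum_right)
    finally show ?case
      using I J sx by (intro exI[of _ "I \<union> J"]) (auto simp: s_add s_scale s_zero)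
  qed
qed

text \<open>On U \<otimes> V, g acts on the left factor alone, so taking the coordinate along f
  commutes with it.\<close>

lemma slice_equivariant:
  assumes F: "F \<subseteq> V" and lin: "\<And>f. Vector_Spaces.linear scale sU (s f)" and sU: "\<And>f y. s f y \<in> U"
    and val: "\<And>f f' u. \<lbrakk>f \<in> F; f' \<in> F; u \<in> U\<rbrakk> \<Longrightarrow> s f (tens u f') = (if f = f' then u else 0)"
    and sp: "V \<subseteq> V.span F" and y: "y \<in> tensors" and x: "x \<in> g" and f: "f \<in> F"
  shows "s f (br x y) = act x (s f y)"
proof -
  interpret l: Vector_Spaces.linear scale sU "s f" by (rule lin)
  obtain I where I: "finite I" "I \<subseteq> F" "\<forall>f\<in>F - I. s f y = 0" "y = (\<Sum>f\<in>I. tens (s f y) f)"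
    using slice_expansion[OF F lin sU val sp y] by blast
  have "br x y = (\<Sum>f\<in>I. br x (tens (s f y) f))"
    using br_sum_right[of x "\<lambda>f. tens (s f y) f" I] I(4) by simp
  also have "\<dots> = (\<Sum>f\<in>I. tens (act x (s f y)) f)"
    by (intro sum.cong refl tens_act x sU) (use I F in auto)
  finally have "s f (br x y) = (\<Sum>f'\<in>I. s f (tens (act x (s f' y)) f'))" by (simp add: l.sum)
  also have "\<dots> = (\<Sum>f'\<in>I. if f = f' then act x (s f' y) else 0)"
    by (intro sum.cong refl val f act_closed x sU) (use I in auto)
  also have "\<dots> = (if f \<in> I then act x (s f y) else 0)" using I(1) by simp
  also have "\<dots> = act x (s f y)" using I(3) f act_zero_right[OF x] by auto
  finally show ?thesis .
qed

text \<open>Each slice of \<phi> is an endomorphism of U, hence a scalar \<open>c f\<close>; the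
  vector v has the coordinates \<open>c f\<close> in the basis F.\<close>

lemma hom_to_tensors:
  assumes closed: "\<And>u. u \<in> U \<Longrightarrow> \<phi> u \<in> tensors"
    and add: "\<And>u v. \<lbrakk>u \<in> U; v \<in> U\<rbrakk> \<Longrightarrow> \<phi> (u + v) = \<phi> u + \<phi> v"
    and scl: "\<And>c u. u \<in> U \<Longrightarrow> \<phi> (sU c u) = scale c (\<phi> u)"
    and hom: "\<And>x u. \<lbrakk>x \<in> g; u \<in> U\<rbrakk> \<Longrightarrow> \<phi> (act x u) = br x (\<phi> u)"
  shows "\<exists>v\<in>V. \<forall>u\<in>U. \<phi> u = tens u v"
proof -
  obtain F :: "'v set" and s :: "'v \<Rightarrow> 'l \<Rightarrow> 'u"
    where F: "F \<subseteq> V" and lin: "\<And>f. Vector_Spaces.linear scale sU (s f)" and sU: "\<And>f y. s f y \<in> U"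
      and val: "\<And>f f' u. \<lbrakk>f \<in> F; f' \<in> F; u \<in> U\<rbrakk> \<Longrightarrow> s f (tens u f') = (if f = f' then u else 0)"
      and sp: "V \<subseteq> V.span F" by (rule slices) blast
  have "\<exists>c. \<forall>u\<in>U. s f (\<phi> u) = sU c u" if f: "f \<in> F" for f
  proof -
    interpret l: Vector_Spaces.linear scale sU "s f" by (rule lin)
    show ?thesis
      by (rule endomorphism_scalar)
        (use sU add scl hom closed slice_equivariant[OF F lin sU val sp] f in \<open>auto simp: l.add l.scale\<close>)
  qed
  then obtain c where c: "\<And>f u. \<lbrakk>f \<in> F; u \<in> U\<rbrakk> \<Longrightarrow> s f (\<phi> u) = sU (c f) u" by metis
  \<comment> \<open>A single nonzero vector bounds the support of c for all u at once, so v is a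
    finite sum although V may be infinite-dimensional.\<close>
  obtain u0 where u0: "u0 \<in> U" "u0 \<noteq> 0" using act_nontrivial act_closed by blast
  obtain I where I: "finite I" "I \<subseteq> F" "\<forall>f\<in>F - I. s f (\<phi> u0) = 0"
    using slice_expansion[OF F lin sU val sp closed[OF u0(1)]] by blast
  have c0: "c f = 0" if "f \<in> F - I" for f using c[of f u0] I(3) u0 that by auto
  let ?v = "\<Sum>f\<in>I. sV (c f) f"
  have IV: "f \<in> V" if "f \<in> I" for f using that I F by blast
  have "?v \<in> V" by (intro V.subspace_sum V_sub V.subspace_scale IV)
  moreover have "\<phi> u = tens u ?v" if u: "u \<in> U" for u
  proof -
    obtain J where J: "finite J" "J \<subseteq> F" "\<forall>f\<in>F - J. s f (\<phi> u) = 0" "\<phi> u = (\<Sum>f\<in>J. tens (s f (\<phi> u)) f)"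
      using slice_expansion[OF F lin sU val sp closed[OF u]] by blast
    have JV: "f \<in> V" if "f \<in> J" for f using that J F by blast
    have "\<phi> u = (\<Sum>f\<in>J. tens (s f (\<phi> u)) f)" by (rule J(4))
    also have "\<dots> = (\<Sum>f\<in>J. tens (sU (c f) u) f)" by (intro sum.cong) (use c u J in auto)
    also have "\<dots> = (\<Sum>f\<in>I \<union> J. tens (sU (c f) u) f)"
    proof (rule sum.mono_neutral_left)
      show "\<forall>f\<in>I \<union> J - J. tens (sU (c f) u) f = 0"
        using c[of _ u] u J I IV tens_zero_left by fastforce
    qed (use I J in auto)
    also have "\<dots> = (\<Sum>f\<in>I. tens (sU (c f) u) f)"
    proof (rule sum.mono_neutral_right)
      show "\<forall>f\<in>I \<union> J - I. tens (sU (c f) u) f = 0"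
        using c0 J JV tens_zero_left by fastforce
    qed (use I J in auto)
    also have "\<dots> = (\<Sum>f\<in>I. tens u (sV (c f) f))"
      by (intro sum.cong) (use u IV in \<open>auto simp: tens_scale_left tens_scale_right\<close>)
    also have "\<dots> = tens u ?v" by (intro tens_sum_right[symmetric] u V.subspace_scale V_sub IV)
    finally show ?thesis .
  qed
  ultimately show ?thesis by blast
qed

text \<open>Each slice is a homomorphism from N to U, so it is enough to exclude those; this reduces
  maps between g and W \<otimes> B, or W and g \<otimes> A, to maps between g and W.\<close>

lemma hom_to_tensors_zero:
  assumes no_hom: "\<And>\<psi>. \<lbrakk>\<And>u. u \<in> N \<Longrightarrow> \<psi> u \<in> U;
        \<And>u v. \<lbrakk>u \<in> N; v \<in> N\<rbrakk> \<Longrightarrow> \<psi> (u + v) = \<psi> u + \<psi> v;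
        \<And>c u. u \<in> N \<Longrightarrow> \<psi> (sN c u) = sU c (\<psi> u);
        \<And>x u. \<lbrakk>x \<in> g; u \<in> N\<rbrakk> \<Longrightarrow> \<psi> (actN x u) = act x (\<psi> u)\<rbrakk> \<Longrightarrow> \<forall>u\<in>N. \<psi> u = 0"
    and closed: "\<And>u. u \<in> N \<Longrightarrow> \<phi> u \<in> tensors"
    and add: "\<And>u v. \<lbrakk>u \<in> N; v \<in> N\<rbrakk> \<Longrightarrow> \<phi> (u + v) = \<phi> u + \<phi> v"
    and scl: "\<And>c u. u \<in> N \<Longrightarrow> \<phi> (sN c u) = scale c (\<phi> u)"
    and hom: "\<And>x u. \<lbrakk>x \<in> g; u \<in> N\<rbrakk> \<Longrightarrow> \<phi> (actN x u) = br x (\<phi> u)"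
    and u: "u \<in> N"
  shows "\<phi> u = 0"
proof -
  obtain F :: "'v set" and s :: "'v \<Rightarrow> 'l \<Rightarrow> 'u"
    where F: "F \<subseteq> V" and lin: "\<And>f. Vector_Spaces.linear scale sU (s f)" and sU: "\<And>f y. s f y \<in> U"
      and val: "\<And>f f' u. \<lbrakk>f \<in> F; f' \<in> F; u \<in> U\<rbrakk> \<Longrightarrow> s f (tens u f') = (if f = f' then u else 0)"
      and sp: "V \<subseteq> V.span F" by (rule slices) blast
  have zero: "s f (\<phi> u) = 0" if f: "f \<in> F" for f
  proof -
    interpret l: Vector_Spaces.linear scale sU "s f" by (rule lin)
    have "\<forall>u\<in>N. s f (\<phi> u) = 0"
      by (rule no_hom)
        (use sU add scl hom closed slice_equivariant[OF F lin sU val sp] f in \<open>auto simp: l.add l.scale\<close>)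
    then show ?thesis using u by blast
  qed
  obtain I where "I \<subseteq> F" "\<phi> u = (\<Sum>f\<in>I. tens (s f (\<phi> u)) f)"
    using slice_expansion[OF F lin sU val sp closed[OF u]] by blast
  moreover have "(\<Sum>f\<in>I. tens (s f (\<phi> u)) f) = 0"
    by (rule sum.neutral) (use \<open>I \<subseteq> F\<close> zero F tens_zero_left in \<open>auto simp: subset_iff\<close>)
  ultimately show ?thesis by simp
qed

end

section \<open>Homomorphisms from \<open>g\<close> and \<open>W\<close> into the root-graded algebra\<close>

context root_graded_lie_algebra
begin

sublocale based_simple sL br g h "type_rank T" \<pi>
proof unfold_locales
  show "\<exists>E. finite E \<and> span E = g" "simple_subalgebra g" "split_cartan_subalgebra g h"
    using graded by (auto simp: root_graded_def)
  show "root_base g h (type_rank T) \<pi>" using type_T by (simp add: root_system_of_type_def)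
qed

sublocale gT: tensor_module sL br g h "type_rank T" \<pi> sL g br sA A gA
proof -
  interpret ad: irreducible_module sL br g h "type_rank T" \<pi> sL g br by (rule adjoint_module)
  show "tensor_module sL br g h (type_rank T) \<pi> sL g br sA A gA"
    by unfold_locales
      (use \<aa>.subspace_A gA_tensor g_on_gA adjoint_endomorphism_scalar in auto)
qed

lemma W_highest:
  assumes "\<not> simply_laced T"
  obtains \<theta> w where "\<theta> \<in> short_roots g h" "\<theta> \<in> rootset" "w \<noteq> 0" "\<And>t. t \<in> h \<Longrightarrow> act t w = sW (\<theta> t) w"
    "\<And>\<alpha> x. \<lbrakk>\<alpha> \<in> rootset; nonneg_comb (type_rank T) \<pi> \<alpha>; x \<in> gspace \<alpha>\<rbrakk> \<Longrightarrow> act x w = 0"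
proof -
  obtain \<theta> where \<theta>: "highest_short_root g h (type_rank T) \<pi> \<theta>" "W_has_highest_weight \<theta>"
    using W_highest_weight assms by blast
  then have "\<theta> \<in> short_roots g h" "\<theta> \<in> rootset"
    by (auto simp: highest_short_root_def short_roots_def)
  then show ?thesis using that \<theta>(2) unfolding W_has_highest_weight_def by blast
qed

lemma W_irreducible_module:
  assumes "\<not> simply_laced T"
  shows "irreducible_module sL br g h (type_rank T) \<pi> sW UNIV act"
proof -
  obtain \<theta> w where \<theta>: "\<theta> \<in> rootset" and w: "w \<noteq> 0" "\<And>t. t \<in> h \<Longrightarrow> act t w = sW (\<theta> t) w"
    using W_highest[OF assms] by metis
  obtain t where t: "t \<in> h" "\<theta> t \<noteq> 0" using rootsD(2)[OF \<theta>] by blast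
  have nt: "\<exists>x\<in>g. \<exists>v\<in>UNIV. act x v \<noteq> 0"
    using t w h_subset by (intro bexI[of _ t] bexI[of _ w]) auto
  have bil: "bilinear_on sL sW sW g UNIV act"
    and br: "\<forall>x\<in>g. \<forall>y\<in>g. \<forall>w. act (br x y) w = act x (act y w) - act y (act x w)"
    using W_module by (auto simp: module_W_def)
  have irr: "N = {0} \<or> N = UNIV" if "W.subspace N" "\<And>x v. \<lbrakk>x \<in> g; v \<in> N\<rbrakk> \<Longrightarrow> act x v \<in> N" for N
    using W_irreducible[OF assms] that unfolding irreducible_W_def by blast
  show ?thesis
    by unfold_locales (use bil br nt irr in \<open>auto simp: bilinear_on_def\<close>)
qed

lemma W_tensor_module:
  assumes "\<not> simply_laced T"
  shows "tensor_module sL br g h (type_rank T) \<pi> sW UNIV act sA B WB"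
proof -
  interpret WM: irreducible_module sL br g h "type_rank T" \<pi> sW UNIV act
    by (rule W_irreducible_module[OF assms])
  obtain \<theta> w where "\<theta> \<in> rootset" "w \<noteq> 0" "\<And>t. t \<in> h \<Longrightarrow> act t w = sW (\<theta> t) w"
    "\<And>\<alpha> x. \<lbrakk>\<alpha> \<in> rootset; nonneg_comb (type_rank T) \<pi> \<alpha>; x \<in> gspace \<alpha>\<rbrakk> \<Longrightarrow> act x w = 0"
    using W_highest[OF assms] by metis
  then have hv: "WM.highest_vector \<theta> w"
    unfolding WM.highest_vector_def WM.wm.weight_vectors_def using rootsD(1) by blast
  show ?thesis
    by unfold_locales
      (use \<aa>.subspace_B WB_tensor g_on_WB WM.highest_weight_endomorphism_scalar[OF hv] in auto)
qed

section \<open>Projections onto the three summands\<close>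

abbreviation TA where "TA \<equiv> span {gA x a |x a. x \<in> g \<and> a \<in> A}"
abbreviation TB where "TB \<equiv> span {WB w b |w b. b \<in> B}"
abbreviation D where "D \<equiv> invariants g"

lemma WB_add_left: "b \<in> B \<Longrightarrow> WB (u + u') b = WB u b + WB u' b"
  and WB_add_right: "\<lbrakk>b \<in> B; b' \<in> B\<rbrakk> \<Longrightarrow> WB u (b + b') = WB u b + WB u b'"
  and WB_scale_left: "b \<in> B \<Longrightarrow> WB (sW c u) b = sL c (WB u b)"
  and WB_scale_right: "b \<in> B \<Longrightarrow> WB u (sA c b) = sL c (WB u b)"
  using WB_tensor unfolding tensor_map_def bilinear_on_def by blast+

lemma WB_zero_right: "WB u 0 = 0"
  using WB_scale_right[of 0 u 0] \<aa>.subspace_0[OF \<aa>.subspace_B] by simp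

lemma ang_add_left: "ang (\<alpha> + \<alpha>') \<beta> = ang \<alpha> \<beta> + ang \<alpha>' \<beta>"
  and ang_add_right: "ang \<alpha> (\<beta> + \<beta>') = ang \<alpha> \<beta> + ang \<alpha> \<beta>'"
  and ang_scale_left: "ang (sA c \<alpha>) \<beta> = sL c (ang \<alpha> \<beta>)"
  and ang_scale_right: "ang \<alpha> (sA c \<beta>) = sL c (ang \<alpha> \<beta>)"
  using ang_bilinear unfolding bilinear_on_def by blast+

lemma D_subspace: "subspace D"
  unfolding invariants_def by (rule subspaceI) (auto simp: br_add_right br_scale_right)

lemma br_g_D: "\<lbrakk>x \<in> g; d \<in> D\<rbrakk> \<Longrightarrow> br x d = 0"
  by (simp add: invariants_def)

lemma ang_D: "ang \<alpha> \<beta> \<in> D"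
proof -
  have "ang \<alpha> \<beta> \<in> span {ang \<alpha> \<beta> |\<alpha> \<beta>. True}" by (rule span_base) blast
  then show ?thesis by (simp only: ang_span)
qed

lemma gA_TA: "\<lbrakk>x \<in> g; a \<in> A\<rbrakk> \<Longrightarrow> gA x a \<in> TA"
  by (rule span_base) blast

lemma WB_TB: "b \<in> B \<Longrightarrow> WB w b \<in> TB"
  by (rule span_base) blast

definition prA where
  "prA v = fst (THE p. p \<in> TA \<times> TB \<times> D \<and> v = fst p + fst (snd p) + snd (snd p))"
definition prB where
  "prB v = fst (snd (THE p. p \<in> TA \<times> TB \<times> D \<and> v = fst p + fst (snd p) + snd (snd p)))"
definition prD where
  "prD v = snd (snd (THE p. p \<in> TA \<times> TB \<times> D \<and> v = fst p + fst (snd p) + snd (snd p)))"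

lemma pr_eq:
  assumes "a \<in> TA" "b \<in> TB" "d \<in> D" "v = a + b + d"
  shows "prA v = a" "prB v = b" "prD v = d"
proof -
  have "(THE p. p \<in> TA \<times> TB \<times> D \<and> v = fst p + fst (snd p) + snd (snd p)) = (a, b, d)"
    by (rule the1_equality[OF decomposition]) (use assms in auto)
  then show "prA v = a" "prB v = b" "prD v = d" by (simp_all add: prA_def prB_def prD_def)
qed

lemma pr_mem: "prA v \<in> TA" "prB v \<in> TB" "prD v \<in> D"
  and pr_sum: "v = prA v + prB v + prD v"
proof -
  obtain p where "p \<in> TA \<times> TB \<times> D \<and> v = fst p + fst (snd p) + snd (snd p)"
    using decomposition by blast
  then obtain a b d where *: "a \<in> TA" "b \<in> TB" "d \<in> D" "v = a + b + d" by auto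
  then show "prA v \<in> TA" "prB v \<in> TB" "prD v \<in> D" "v = prA v + prB v + prD v"
    unfolding pr_eq[OF *] using * by blast+
qed

lemma pr_add: "prA (u + v) = prA u + prA v" "prB (u + v) = prB u + prB v" "prD (u + v) = prD u + prD v"
proof -
  have "u + v = (prA u + prA v) + (prB u + prB v) + (prD u + prD v)"
    using arg_cong2[OF pr_sum[of u] pr_sum[of v], of "(+)"] by (simp only: ac_simps)
  note pr_eq[OF _ _ _ this]
  then show "prA (u + v) = prA u + prA v" "prB (u + v) = prB u + prB v" "prD (u + v) = prD u + prD v"
    by (simp_all add: pr_mem span_add subspace_add[OF D_subspace])
qed

lemma pr_scale: "prA (sL c v) = sL c (prA v)" "prB (sL c v) = sL c (prB v)" "prD (sL c v) = sL c (prD v)"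
proof -
  have "sL c v = sL c (prA v) + sL c (prB v) + sL c (prD v)"
    using arg_cong[OF pr_sum[of v], of "sL c"] by (simp add: scale_right_distrib)
  note pr_eq[OF _ _ _ this]
  then show "prA (sL c v) = sL c (prA v)" "prB (sL c v) = sL c (prB v)" "prD (sL c v) = sL c (prD v)"
    by (simp_all add: pr_mem span_scale subspace_scale[OF D_subspace])
qed

lemma pr_TA: "v \<in> TA \<Longrightarrow> prA v = v" "v \<in> TA \<Longrightarrow> prB v = 0" "v \<in> TA \<Longrightarrow> prD v = 0"
  by (intro pr_eq[of v 0 0]; simp add: span_zero subspace_0[OF D_subspace])+

lemma pr_TB: "v \<in> TB \<Longrightarrow> prA v = 0" "v \<in> TB \<Longrightarrow> prB v = v" "v \<in> TB \<Longrightarrow> prD v = 0"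
  by (intro pr_eq[of 0 v 0]; simp add: span_zero subspace_0[OF D_subspace])+

lemma pr_D: "v \<in> D \<Longrightarrow> prA v = 0" "v \<in> D \<Longrightarrow> prB v = 0" "v \<in> D \<Longrightarrow> prD v = v"
  by (intro pr_eq[of 0 0 v]; simp add: span_zero subspace_0[OF D_subspace])+

lemma br_TA: "\<lbrakk>x \<in> g; v \<in> TA\<rbrakk> \<Longrightarrow> br x v \<in> TA"
proof -
  assume x: "x \<in> g" and "v \<in> TA"
  from this(2) show ?thesis
  proof (induction rule: span_induct_alt)
    case (step c u v)
    then have "br x u \<in> TA" using x g_on_gA g_br gA_TA by auto
    then show ?case using step by (simp add: br_add_right br_scale_right span_add span_scale)
  qed (simp add: span_zero)
qed

lemma br_TB: "\<lbrakk>x \<in> g; v \<in> TB\<rbrakk> \<Longrightarrow> br x v \<in> TB"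
proof -
  assume x: "x \<in> g" and "v \<in> TB"
  from this(2) show ?thesis
  proof (induction rule: span_induct_alt)
    case (step c u v)
    then have "br x u \<in> TB" using x g_on_WB WB_TB by auto
    then show ?case using step by (simp add: br_add_right br_scale_right span_add span_scale)
  qed (simp add: span_zero)
qed

lemma pr_br:
  assumes "x \<in> g"
  shows "prA (br x v) = br x (prA v)" "prB (br x v) = br x (prB v)" "prD (br x v) = 0"
proof -
  have "br x v = br x (prA v) + br x (prB v) + 0"
    using arg_cong[OF pr_sum[of v], of "br x"] br_g_D[OF assms pr_mem(3)] by (simp add: br_add_right)
  note pr_eq[OF _ _ _ this]
  then show "prA (br x v) = br x (prA v)" "prB (br x v) = br x (prB v)" "prD (br x v) = 0"
    using br_TA[OF assms pr_mem(1)] br_TB[OF assms pr_mem(2)] subspace_0[OF D_subspace] by auto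
qed

lemma simply_laced_trivial:
  assumes "simply_laced T"
  shows "B = {0}" "TB = {0}" "sW 1 w = 0"
proof -
  show B: "B = {0}" using W_simply_laced assms by blast
  show "sW 1 w = 0" using W_simply_laced assms unfolding zero_W_def by blast
  have "{WB w b |w b. b \<in> B} \<subseteq> {0}" using B WB_zero_right by auto
  then have "TB \<subseteq> {0}" by (rule span_minimal) simp
  then show "TB = {0}" using span_zero by blast
qed

text \<open>The three components of \<phi> are treated separately. The first is a tensor with fixed
  right factor, the second vanishes because g does not map to W, and the third vanishes on brackets,
  hence on the perfect algebra g.\<close>

lemma hom_g_L:
  assumes add: "\<And>x y. \<lbrakk>x \<in> g; y \<in> g\<rbrakk> \<Longrightarrow> \<phi> (x + y) = \<phi> x + \<phi> y"
    and scl: "\<And>c x. x \<in> g \<Longrightarrow> \<phi> (sL c x) = sL c (\<phi> x)"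
    and hom: "\<And>x y. \<lbrakk>x \<in> g; y \<in> g\<rbrakk> \<Longrightarrow> \<phi> (br x y) = br x (\<phi> y)"
  shows "\<exists>a\<in>A. \<forall>x\<in>g. \<phi> x = gA x a"
proof -
  have "\<exists>a\<in>A. \<forall>x\<in>g. prA (\<phi> x) = gA x a"
    by (rule gT.hom_to_tensors) (use add scl hom in \<open>simp_all add: pr_mem pr_add pr_scale pr_br\<close>)
  then obtain a where a: "a \<in> A" "\<forall>x\<in>g. prA (\<phi> x) = gA x a" by blast
  have B: "prB (\<phi> x) = 0" if "x \<in> g" for x
  proof (cases "simply_laced T")
    case True
    then show ?thesis using pr_mem(2) simply_laced_trivial(2) by blast
  next
    case False
    interpret WT: tensor_module sL br g h "type_rank T" \<pi> sW UNIV act sA B WB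
      by (rule W_tensor_module[OF False])
    obtain \<theta> w where \<theta>: "\<theta> \<in> short_roots g h" "\<theta> \<in> rootset" "w \<noteq> 0" "\<And>t. t \<in> h \<Longrightarrow> act t w = sW (\<theta> t) w"
      "\<And>\<alpha> x. \<lbrakk>\<alpha> \<in> rootset; nonneg_comb (type_rank T) \<pi> \<alpha>; x \<in> gspace \<alpha>\<rbrakk> \<Longrightarrow> act x w = 0"
      using W_highest[OF False] by metis
    then have hv: "WT.highest_vector \<theta> w"
      unfolding WT.highest_vector_def WT.wm.weight_vectors_def using rootsD(1) by blast
    show ?thesis
    proof (rule WT.hom_to_tensors_zero[where N = g and \<phi> = "\<lambda>x. prB (\<phi> x)" and sN = sL and actN = br])
      fix \<psi> assume "\<And>u. u \<in> g \<Longrightarrow> \<psi> u \<in> UNIV"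
        "\<And>u v. \<lbrakk>u \<in> g; v \<in> g\<rbrakk> \<Longrightarrow> \<psi> (u + v) = \<psi> u + \<psi> v"
        "\<And>c u. u \<in> g \<Longrightarrow> \<psi> (sL c u) = sW c (\<psi> u)"
        "\<And>x u. \<lbrakk>x \<in> g; u \<in> g\<rbrakk> \<Longrightarrow> \<psi> (br x u) = act x (\<psi> u)"
      then show "\<forall>u\<in>g. \<psi> u = 0" using WT.no_hom_from_adjoint[OF hv \<theta>(1), of \<psi>] by blast
    qed (use add scl hom that pr_mem(2) in \<open>simp_all add: pr_add pr_scale pr_br\<close>)
  qed
  have D: "prD (\<phi> x) = 0" if "x \<in> g" for x
  proof -
    have "x \<in> span {br x y |x y. x \<in> g \<and> y \<in> g}" using that perfect by simp
    then have "x \<in> g \<and> prD (\<phi> x) = 0"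
    proof (induction rule: span_induct_alt)
      case base
      have "\<phi> 0 = 0" using scl[of 0 0] subspace_0[OF g_subspace] by simp
      then show ?case using pr_D(3)[OF subspace_0[OF D_subspace]] subspace_0[OF g_subspace] by simp
    next
      case (step c x y)
      then obtain p q where "x = br p q" "p \<in> g" "q \<in> g" by blast
      then show ?case
        using step g_br[of p q] hom[of p q] subspace_add[OF g_subspace] subspace_scale[OF g_subspace]
        by (simp add: add scl pr_add pr_scale pr_br)
    qed
    then show ?thesis ..
  qed
  have "\<phi> x = gA x a" if "x \<in> g" for x using pr_sum[of "\<phi> x"] a(2) B D that by simp
  then show ?thesis using a(1) by blast
qed

text \<open>As for g, with \<open>act_span\<close> in the place of perfectness for the component in
  D. In the simply laced case W = 0.\<close>

lemma hom_W_L: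
  assumes add: "\<And>x y. \<phi> (x + y) = \<phi> x + \<phi> y"
    and scl: "\<And>c x. \<phi> (sW c x) = sL c (\<phi> x)"
    and hom: "\<And>x y. x \<in> g \<Longrightarrow> \<phi> (act x y) = br x (\<phi> y)"
  shows "\<exists>b\<in>B. \<forall>w. \<phi> w = WB w b"
proof (cases "simply_laced T")
  case True
  have "\<phi> 0 = 0" using scl[of 0 0] by simp
  then have "\<phi> w = 0" for w using simply_laced_trivial(3)[OF True, of w] by (simp only: W.scale_one)
  then show ?thesis using simply_laced_trivial(1)[OF True] WB_zero_right by auto
next
  case False
  interpret WT: tensor_module sL br g h "type_rank T" \<pi> sW UNIV act sA B WB
    by (rule W_tensor_module[OF False])
  obtain \<theta> w where \<theta>: "\<theta> \<in> short_roots g h" "\<theta> \<in> rootset" "w \<noteq> 0" "\<And>t. t \<in> h \<Longrightarrow> act t w = sW (\<theta> t) w"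
    "\<And>\<alpha> x. \<lbrakk>\<alpha> \<in> rootset; nonneg_comb (type_rank T) \<pi> \<alpha>; x \<in> gspace \<alpha>\<rbrakk> \<Longrightarrow> act x w = 0"
    using W_highest[OF False] by metis
  then have hv: "WT.highest_vector \<theta> w"
    unfolding WT.highest_vector_def WT.wm.weight_vectors_def using rootsD(1) by blast
  have "\<exists>b\<in>B. \<forall>w\<in>UNIV. prB (\<phi> w) = WB w b"
    by (rule WT.hom_to_tensors) (use add scl hom pr_mem(2) in \<open>simp_all add: pr_add pr_scale pr_br\<close>)
  then obtain b where b: "b \<in> B" "\<forall>w. prB (\<phi> w) = WB w b" by blast
  have A: "prA (\<phi> w) = 0" for w
  proof (rule gT.hom_to_tensors_zero[where N = UNIV and \<phi> = "\<lambda>x. prA (\<phi> x)" and sN = sW and actN = act])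
    fix \<psi> assume "\<And>u. u \<in> UNIV \<Longrightarrow> \<psi> u \<in> g"
      "\<And>u v. \<lbrakk>u \<in> UNIV; v \<in> UNIV\<rbrakk> \<Longrightarrow> \<psi> (u + v) = \<psi> u + \<psi> v"
      "\<And>c u. u \<in> UNIV \<Longrightarrow> \<psi> (sW c u) = sL c (\<psi> u)"
      "\<And>x u. \<lbrakk>x \<in> g; u \<in> UNIV\<rbrakk> \<Longrightarrow> \<psi> (act x u) = br x (\<psi> u)"
    then show "\<forall>u\<in>UNIV. \<psi> u = 0" using WT.no_hom_to_adjoint[OF hv \<theta>(1), of \<psi>] by blast
  qed (use add scl hom pr_mem(1) in \<open>simp_all add: pr_add pr_scale pr_br\<close>)
  have D: "prD (\<phi> w) = 0" for w
  proof -
    have "w \<in> W.span {act x v |x v. x \<in> g \<and> v \<in> UNIV}" using WT.act_span by blast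
    then show ?thesis
    proof (induction rule: W.span_induct_alt)
      case base
      have "\<phi> 0 = 0" using scl[of 0 0] by simp
      then show ?case using pr_D(3)[OF subspace_0[OF D_subspace]] by simp
    next
      case (step c x y)
      then obtain p q where "x = act p q" "p \<in> g" by blast
      then show ?case using step hom[of p q] by (simp add: add scl pr_add pr_scale pr_br)
    qed
  qed
  have "\<phi> w = WB w b" for w using pr_sum[of "\<phi> w"] b(2) A D by simp
  then show ?thesis using b(1) by blast
qed

text \<open>For fixed a the map sending x to \<open>\<chi> (gA x a)\<close> is a g-homomorphism, so
  it is again a tensor with fixed right factor; similarly for W. D is preserved because it consists
  of the vectors killed by g.\<close>

lemma centroid_forms:
  assumes \<chi>: "\<chi> \<in> centroid sL br"
  obtains \<phi> \<psi> where "\<And>a. a \<in> A \<Longrightarrow> \<phi> a \<in> A" "\<And>x a. \<lbrakk>x \<in> g; a \<in> A\<rbrakk> \<Longrightarrow> \<chi> (gA x a) = gA x (\<phi> a)"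
    and "\<And>b. b \<in> B \<Longrightarrow> \<psi> b \<in> B" "\<And>w b. b \<in> B \<Longrightarrow> \<chi> (WB w b) = WB w (\<psi> b)"
    and "\<And>d. d \<in> D \<Longrightarrow> \<chi> d \<in> D"
proof -
  interpret l: Vector_Spaces.linear sL sL \<chi> using \<chi> by (simp add: centroid_def)
  have hom: "\<chi> (br x y) = br x (\<chi> y)" for x y using \<chi> by (simp add: centroid_def)
  have 1: "\<exists>a'\<in>A. \<forall>x\<in>g. \<chi> (gA x a) = gA x a'" if a: "a \<in> A" for a
    by (rule hom_g_L)
      (use a in \<open>simp_all add: gT.tens_add_left gT.tens_scale_left l.add l.scale hom[symmetric] g_on_gA\<close>)
  have 2: "\<exists>b'\<in>B. \<forall>w. \<chi> (WB w b) = WB w b'" if b: "b \<in> B" for b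
    by (rule hom_W_L)
      (use b in \<open>simp_all add: WB_add_left WB_scale_left l.add l.scale hom[symmetric] g_on_WB\<close>)
  obtain \<phi> where "\<forall>a\<in>A. \<phi> a \<in> A \<and> (\<forall>x\<in>g. \<chi> (gA x a) = gA x (\<phi> a))" using 1 by metis
  moreover obtain \<psi> where "\<forall>b\<in>B. \<psi> b \<in> B \<and> (\<forall>w. \<chi> (WB w b) = WB w (\<psi> b))" using 2 by metis
  moreover have "\<chi> d \<in> D" if "d \<in> D" for d
    using that hom[of _ d, symmetric] by (simp add: invariants_def l.zero)
  ultimately show ?thesis using that[of \<phi> \<psi>] by blast
qed

end

section \<open>Matrix realisations of types A and C\<close>

lemma mat_trace_mult:
  assumes "X \<in> carrier_mat n n" "Y \<in> carrier_mat n n"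
  shows "mat_trace (X * Y) = (\<Sum>i<n. \<Sum>k<n. X $$ (i, k) * Y $$ (k, i))"
  using assms unfolding mat_trace_def
  by (intro sum.cong) (auto simp: scalar_prod_def lessThan_atLeast0)

lemma mat_trace_mult_comm:
  assumes "X \<in> carrier_mat n n" "(Y :: 'f::comm_ring_1 mat) \<in> carrier_mat n n"
  shows "mat_trace (X * Y) = mat_trace (Y * X)"
  using assms by (simp add: mat_trace_mult[of _ n]) (subst sum.swap, simp add: mult.commute)

lemma mat_trace_smult: "X \<in> carrier_mat n n \<Longrightarrow> mat_trace (c \<cdot>\<^sub>m X) = c * mat_trace X"
  by (simp add: mat_trace_def sum_distrib_left)

lemma mat_trace_transpose: "X \<in> carrier_mat n n \<Longrightarrow> mat_trace (transpose_mat X) = mat_trace X"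
  by (simp add: mat_trace_def)

lemma smult_smult_mat: "a \<cdot>\<^sub>m (b \<cdot>\<^sub>m M) = (a * b) \<cdot>\<^sub>m (M :: 'f::comm_ring_1 mat)"
  by (intro eq_matI) (auto simp: mult.assoc)

definition unit_mat :: "nat \<Rightarrow> nat \<Rightarrow> nat \<Rightarrow> 'f::comm_ring_1 mat" where
  "unit_mat n i j = mat n n (\<lambda>(k, l). if k = i \<and> l = j then 1 else 0)"

lemma unit_mat_carrier [simp]: "unit_mat n i j \<in> carrier_mat n n"
  "dim_row (unit_mat n i j) = n" "dim_col (unit_mat n i j) = n"
  by (simp_all add: unit_mat_def)

lemma unit_mat_index [simp]:
  "\<lbrakk>k < n; l < n\<rbrakk> \<Longrightarrow> unit_mat n i j $$ (k, l) = (if k = i \<and> l = j then 1 else 0)"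
  by (simp add: unit_mat_def)

lemma unit_mat_mult:
  assumes "j < n"
  shows "unit_mat n i j * unit_mat n k l = (if j = k then unit_mat n i l else 0\<^sub>m n n)"
proof (rule eq_matI)
  fix p q assume pq: "p < dim_row (if j = k then unit_mat n i l else 0\<^sub>m n n)"
    "q < dim_col (if j = k then unit_mat n i l else 0\<^sub>m n n)"
  then have "(unit_mat n i j * unit_mat n k l) $$ (p, q) =
      (\<Sum>s\<in>{0..<n}. (if p = i \<and> s = j then 1 else 0) * (if s = k \<and> q = l then 1 else 0))"
    by (auto simp: scalar_prod_def split: if_splits)
  also have "\<dots> = (\<Sum>s\<in>{0..<n}. if s = j then (if p = i \<and> j = k \<and> q = l then 1 else 0) else 0)"
    by (intro sum.cong) auto
  also have "\<dots> = (if p = i \<and> j = k \<and> q = l then 1 else 0)" using assms by simp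
  finally show "(unit_mat n i j * unit_mat n k l) $$ (p, q) =
      (if j = k then unit_mat n i l else 0\<^sub>m n n) $$ (p, q)"
    using pq by (auto split: if_splits)
qed auto

lemma mat_trace_unit_mat: "i < n \<Longrightarrow> mat_trace (unit_mat n i j) = (if i = j then 1 else 0)"
proof -
  assume i: "i < n"
  have "mat_trace (unit_mat n i j :: 'a mat) = (\<Sum>k<n. if k = i then (if i = j then 1 else 0) else 0)"
    unfolding mat_trace_def by (intro sum.cong) auto
  then show ?thesis using i by simp
qed

text \<open>The matrix units at (0,1) and (1,2) multiply to the one at (0,2), of trace 0, while the
  reverse product vanishes. So bracket and circle product coincide, and in the bracket of the graded
  algebra the two halves of a a' add up again.\<close>

lemma sl_mat_products:
  assumes n: "3 \<le> n"
  shows "\<exists>X\<in>sl_mat n. \<exists>Y\<in>sl_mat n. \<exists>Z\<in>sl_mat n. (Z :: 'f::field mat) \<noteq> 0\<^sub>m n n \<and>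
    mat_bracket X Y = Z \<and> mat_circ n X Y = Z"
proof -
  let ?X = "unit_mat n 0 1 :: 'f mat" and ?Y = "unit_mat n 1 2 :: 'f mat" and ?Z = "unit_mat n 0 2 :: 'f mat"
  have mem: "?X \<in> sl_mat n" "?Y \<in> sl_mat n" "?Z \<in> sl_mat n"
    using n by (simp_all add: sl_mat_def mat_trace_unit_mat)
  have XY: "?X * ?Y = ?Z" "?Y * ?X = 0\<^sub>m n n" using n by (simp_all add: unit_mat_mult)
  have "mat_bracket ?X ?Y = ?Z" unfolding mat_bracket_def XY by (intro eq_matI) auto
  moreover have "mat_circ n ?X ?Y = ?Z"
    unfolding mat_circ_def XY using n by (intro eq_matI) (auto simp: mat_trace_unit_mat)
  moreover have "?Z $$ (0, 2) \<noteq> (0\<^sub>m n n :: 'f mat) $$ (0, 2)" using n by simp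
  then have "?Z \<noteq> 0\<^sub>m n n" by metis
  ultimately show ?thesis using mem by blast
qed

text \<open>The sign \<open>s\<close> is \<open>-1\<close> for \<open>sp\<^sub>2\<^sub>r\<close> and \<open>1\<close> for the module of self-adjoint matrices.\<close>

definition form_adjoint :: "nat \<Rightarrow> 'f::field \<Rightarrow> 'f mat \<Rightarrow> bool" where
  "form_adjoint r s X \<longleftrightarrow> X \<in> carrier_mat (2 * r) (2 * r) \<and>
     transpose_mat X * symplectic_mat r = s \<cdot>\<^sub>m (symplectic_mat r * X)"

lemma symplectic_mat_carrier: "symplectic_mat r \<in> carrier_mat (2 * r) (2 * r)"
  unfolding symplectic_mat_def by (auto intro!: carrier_matI)

lemma symplectic_mat_square: "symplectic_mat r * symplectic_mat r = (- 1) \<cdot>\<^sub>m (1\<^sub>m (2 * r) :: 'f::field mat)"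
proof -
  have "symplectic_mat r * symplectic_mat r =
      four_block_mat (- (1\<^sub>m r)) (0\<^sub>m r r) (0\<^sub>m r r) (- (1\<^sub>m r) :: 'f mat)"
    unfolding symplectic_mat_def
    by (subst mult_four_block_mat[of _ r r _ r _ r _ _ r _ r]) auto
  also have "\<dots> = (- 1) \<cdot>\<^sub>m (1\<^sub>m (2 * r))"
    by (rule eq_matI) (auto simp: four_block_mat_def)
  finally show ?thesis .
qed

lemma sp_mat_iff: "X \<in> sp_mat r \<longleftrightarrow> form_adjoint r (- 1) X"
proof -
  have "- M = (- 1) \<cdot>\<^sub>m M" for M :: "'a mat" by (intro eq_matI) auto
  then show ?thesis by (simp add: sp_mat_def form_adjoint_def)
qed

lemma sp_module_mat_iff: "X \<in> sp_module_mat r \<longleftrightarrow> form_adjoint r 1 X \<and> mat_trace X = 0"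
proof -
  have "1 \<cdot>\<^sub>m M = M" for M :: "'a mat" by (intro eq_matI) auto
  then show ?thesis by (auto simp: sp_module_mat_def form_adjoint_def)
qed

text \<open>For the adjoint with respect to the form this is the rule that the adjoint of X Y is the
  product of the adjoints in reverse order.\<close>

lemma form_adjoint_mult:
  assumes "form_adjoint r s X" "form_adjoint r t Y"
  shows "transpose_mat (X * Y) * symplectic_mat r = (s * t) \<cdot>\<^sub>m (symplectic_mat r * (Y * X))"
proof -
  let ?J = "symplectic_mat r :: 'a mat" and ?n = "2 * r"
  have X: "X \<in> carrier_mat ?n ?n" "transpose_mat X * ?J = s \<cdot>\<^sub>m (?J * X)"
    and Y: "Y \<in> carrier_mat ?n ?n" "transpose_mat Y * ?J = t \<cdot>\<^sub>m (?J * Y)"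
    using assms by (auto simp: form_adjoint_def)
  note J = symplectic_mat_carrier[of r, where 'a = 'a]
  have c: "?J * X \<in> carrier_mat ?n ?n" "?J * Y \<in> carrier_mat ?n ?n"
    using mult_carrier_mat[of _ ?n ?n _ ?n] J X(1) Y(1) by blast+
  have "transpose_mat (X * Y) * ?J = transpose_mat Y * (transpose_mat X * ?J)"
    by (subst transpose_mult[OF X(1) Y(1)], rule assoc_mult_mat[of _ ?n ?n _ ?n _ ?n])
      (use X(1) Y(1) J in auto)
  also have "\<dots> = s \<cdot>\<^sub>m (transpose_mat Y * (?J * X))"
    unfolding X(2) using X(1) Y(1) J c by (simp add: mult_smult_distrib[of _ ?n ?n _ ?n])
  also have "transpose_mat Y * (?J * X) = transpose_mat Y * ?J * X"
    using X(1) Y(1) J by (simp add: assoc_mult_mat[of _ ?n ?n _ ?n _ ?n])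
  also have "\<dots> = t \<cdot>\<^sub>m (?J * (Y * X))"
    unfolding Y(2) using X(1) Y(1) J c
    by (simp add: mult_smult_assoc_mat[of _ ?n ?n _ ?n] assoc_mult_mat[of _ ?n ?n _ ?n _ ?n])
  finally show ?thesis by (simp add: smult_smult_mat)
qed

text \<open>A matrix and its adjoint have equal traces, and here the adjoint of X Y is -Y X; so the
  trace equals its own negative.\<close>

lemma form_adjoint_trace_zero:
  assumes "form_adjoint r (- 1) X" "form_adjoint r 1 (Y :: 'f::field_char_0 mat)"
  shows "mat_trace (X * Y) = 0"
proof -
  let ?J = "symplectic_mat r :: 'f mat" and ?n = "2 * r"
  have X: "X \<in> carrier_mat ?n ?n" and Y: "Y \<in> carrier_mat ?n ?n"
    using assms by (auto simp: form_adjoint_def)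
  note J = symplectic_mat_carrier[of r, where 'a = 'f]
  have JJ: "?J * (Y * X) * ?J \<in> carrier_mat ?n ?n" by (intro mult_carrier_mat[of _ ?n ?n _ ?n] J X Y)
  have "(- 1) \<cdot>\<^sub>m transpose_mat (X * Y) = transpose_mat (X * Y) * (?J * ?J)"
    unfolding symplectic_mat_square using X Y by (simp add: mult_smult_distrib[of _ ?n ?n _ ?n])
  also have "\<dots> = transpose_mat (X * Y) * ?J * ?J"
    using X Y J by (simp add: assoc_mult_mat[of _ ?n ?n _ ?n _ ?n])
  also have "\<dots> = (- 1) \<cdot>\<^sub>m (?J * (Y * X) * ?J)"
    unfolding form_adjoint_mult[OF assms] using X Y J
    by (simp add: mult_smult_assoc_mat[of _ ?n ?n _ ?n])
  finally have "mat_trace ((- 1) \<cdot>\<^sub>m transpose_mat (X * Y)) = mat_trace ((- 1) \<cdot>\<^sub>m (?J * (Y * X) * ?J))"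
    by simp
  then have "mat_trace (X * Y) = mat_trace (?J * (Y * X) * ?J)"
    using X Y JJ by (simp add: mat_trace_smult[of _ ?n] mat_trace_transpose[of _ ?n])
  also have "\<dots> = mat_trace (?J * (?J * (Y * X)))"
    using X Y J by (intro mat_trace_mult_comm[of _ ?n]) auto
  also have "?J * (?J * (Y * X)) = ?J * ?J * (Y * X)"
    using X Y J by (simp add: assoc_mult_mat[of _ ?n ?n _ ?n _ ?n])
  also have "\<dots> = (- 1) \<cdot>\<^sub>m (Y * X)"
    unfolding symplectic_mat_square using X Y by (simp add: mult_smult_assoc_mat[of _ ?n ?n _ ?n])
  also have "mat_trace \<dots> = - mat_trace (X * Y)"
    using mat_trace_mult_comm[OF X Y] X Y by (simp add: mat_trace_smult[of _ ?n])
  finally show ?thesis by simp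
qed

text \<open>The term \<open>X * Y + Y * X\<close> has the sign s t by itself. The trace term is a
  multiple of the identity, which is self-adjoint; it fits when s t = 1 and is absent when the trace
  is 0.\<close>

lemma mat_circ_form_adjoint:
  assumes "form_adjoint r s X" "form_adjoint r t Y" "s * t = 1 \<or> mat_trace (X * Y) = 0"
  shows "form_adjoint r (s * t) (mat_circ (2 * r) X (Y :: 'f::field mat))"
proof -
  let ?J = "symplectic_mat r :: 'f mat" and ?n = "2 * r"
  let ?c = "2 / of_nat ?n * mat_trace (X * Y)"
  have X: "X \<in> carrier_mat ?n ?n" and Y: "Y \<in> carrier_mat ?n ?n"
    using assms by (auto simp: form_adjoint_def)
  note J = symplectic_mat_carrier[of r, where 'a = 'f]
  have cc: "?c = (s * t) * ?c" using assms(3) by auto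
  have "transpose_mat (mat_circ ?n X Y) * ?J =
      (transpose_mat (X * Y) + transpose_mat (Y * X) - ?c \<cdot>\<^sub>m 1\<^sub>m ?n) * ?J"
    using X Y by (intro arg_cong[of _ _ "\<lambda>M. M * ?J"] eq_matI) (auto simp: mat_circ_def)
  also have "\<dots> = transpose_mat (X * Y) * ?J + transpose_mat (Y * X) * ?J - ?c \<cdot>\<^sub>m ?J"
    using X Y J
    by (simp add: minus_mult_distrib_mat[of _ ?n ?n _ _ ?n] add_mult_distrib_mat[of _ ?n ?n _ _ ?n]
        mult_smult_assoc_mat[of _ ?n ?n _ ?n])
  also have "\<dots> = (s * t) \<cdot>\<^sub>m (?J * (Y * X)) + (s * t) \<cdot>\<^sub>m (?J * (X * Y)) - ((s * t) * ?c) \<cdot>\<^sub>m ?J"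
    unfolding form_adjoint_mult[OF assms(1,2)] form_adjoint_mult[OF assms(2,1)]
    by (simp only: mult.commute[of t s] cc[symmetric])
  also have "\<dots> = (s * t) \<cdot>\<^sub>m (?J * (Y * X) + ?J * (X * Y) - ?c \<cdot>\<^sub>m ?J)"
    using X Y J by (intro eq_matI) (auto simp: algebra_simps)
  also have "?J * (Y * X) + ?J * (X * Y) - ?c \<cdot>\<^sub>m ?J = ?J * (X * Y + Y * X - ?c \<cdot>\<^sub>m 1\<^sub>m ?n)"
    using X Y J
    by (simp add: mult_minus_distrib_mat[of _ ?n ?n _ ?n] mult_add_distrib_mat[of _ ?n ?n _ ?n]
        mult_smult_distrib[of _ ?n ?n _ ?n] comm_add_mat[of _ ?n ?n])
  finally have "transpose_mat (mat_circ ?n X Y) * ?J = (s * t) \<cdot>\<^sub>m (?J * mat_circ ?n X Y)"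
    unfolding mat_circ_def .
  moreover have "mat_circ ?n X Y \<in> carrier_mat ?n ?n"
    using X Y by (auto simp: mat_circ_def intro!: carrier_matI)
  ultimately show ?thesis by (simp only: form_adjoint_def)
qed

text \<open>The constant \<open>2 / n\<close> in \<open>mat_circ\<close> is chosen for this: the
  identity matrix has trace n.\<close>

lemma mat_trace_circ:
  assumes "X \<in> carrier_mat n n" "(Y :: 'f::field_char_0 mat) \<in> carrier_mat n n" "0 < n"
  shows "mat_trace (mat_circ n X Y) = 0"
proof -
  have "mat_trace (mat_circ n X Y) = mat_trace (X * Y) + mat_trace (Y * X)
      - 2 / of_nat n * mat_trace (X * Y) * of_nat n"
    using assms unfolding mat_circ_def mat_trace_def by (simp add: sum.distrib sum_subtractf)
  also have "\<dots> = 0" using mat_trace_mult_comm[OF assms(1,2)] assms(3) by simp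
  finally show ?thesis .
qed

lemma mat_circ_sl:
  assumes "X \<in> sl_mat n" "(Y :: 'f::field_char_0 mat) \<in> sl_mat n" "0 < n"
  shows "mat_circ n X Y \<in> sl_mat n"
  using mat_trace_circ[of X n Y] assms by (auto simp: sl_mat_def mat_circ_def)

lemma mat_circ_sp_sp:
  assumes "X \<in> sp_mat r" "(Y :: 'f::field_char_0 mat) \<in> sp_mat r" "0 < r"
  shows "mat_circ (2 * r) X Y \<in> sp_module_mat r"
  using mat_circ_form_adjoint[of r "- 1" X "- 1" Y] mat_trace_circ[of X "2 * r" Y] assms
  by (simp add: sp_mat_iff sp_module_mat_iff form_adjoint_def)

lemma mat_circ_module_module:
  assumes "X \<in> sp_module_mat r" "(Y :: 'f::field_char_0 mat) \<in> sp_module_mat r" "0 < r"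
  shows "mat_circ (2 * r) X Y \<in> sp_module_mat r"
  using mat_circ_form_adjoint[of r 1 X 1 Y] mat_trace_circ[of X "2 * r" Y] assms
  by (simp add: sp_module_mat_iff form_adjoint_def)

lemma mat_circ_sp_module:
  assumes "X \<in> sp_mat r" "(Y :: 'f::field_char_0 mat) \<in> sp_module_mat r"
  shows "mat_circ (2 * r) X Y \<in> sp_mat r"
  using mat_circ_form_adjoint[of r "- 1" X 1 Y] form_adjoint_trace_zero[of r X Y] assms
  by (simp add: sp_mat_iff sp_module_mat_iff)

lemma mat_bracket_module_module:
  assumes "X \<in> sp_module_mat r" "(Y :: 'f::field_char_0 mat) \<in> sp_module_mat r"
  shows "mat_bracket X Y \<in> sp_mat r"
proof -
  let ?J = "symplectic_mat r :: 'f mat" and ?n = "2 * r"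
  have fa: "form_adjoint r 1 X" "form_adjoint r 1 Y" using assms by (auto simp: sp_module_mat_iff)
  then have X: "X \<in> carrier_mat ?n ?n" and Y: "Y \<in> carrier_mat ?n ?n" by (auto simp: form_adjoint_def)
  note J = symplectic_mat_carrier[of r, where 'a = 'f]
  have "transpose_mat (mat_bracket X Y) * ?J = (transpose_mat (X * Y) - transpose_mat (Y * X)) * ?J"
    using X Y by (intro arg_cong[of _ _ "\<lambda>M. M * ?J"] eq_matI) (auto simp: mat_bracket_def)
  also have "\<dots> = transpose_mat (X * Y) * ?J - transpose_mat (Y * X) * ?J"
    by (rule minus_mult_distrib_mat[of _ ?n ?n _ _ ?n]) (use X Y J in auto)
  also have "\<dots> = 1 \<cdot>\<^sub>m (?J * (Y * X)) - 1 \<cdot>\<^sub>m (?J * (X * Y))"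
    unfolding form_adjoint_mult[OF fa(1,2)] form_adjoint_mult[OF fa(2,1)] by simp
  also have "\<dots> = (- 1) \<cdot>\<^sub>m (?J * (X * Y) - ?J * (Y * X))"
    using X Y J by (intro eq_matI) auto
  also have "?J * (X * Y) - ?J * (Y * X) = ?J * mat_bracket X Y"
    unfolding mat_bracket_def
    by (rule mult_minus_distrib_mat[of _ ?n ?n _ ?n, symmetric]) (use X Y J in auto)
  finally have "transpose_mat (mat_bracket X Y) * ?J = (- 1) \<cdot>\<^sub>m (?J * mat_bracket X Y)" .
  moreover have "mat_bracket X Y \<in> carrier_mat ?n ?n"
    using X Y by (auto simp: mat_bracket_def intro!: carrier_matI)
  ultimately show ?thesis by (simp add: sp_mat_iff form_adjoint_def)
qed

section \<open>Block-diagonal test matrices\<close>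

definition diag_block :: "nat \<Rightarrow> 'f::field mat \<Rightarrow> 'f mat \<Rightarrow> 'f mat" where
  "diag_block r P Q = four_block_mat P (0\<^sub>m r r) (0\<^sub>m r r) Q"

lemma diag_block_mult:
  assumes "P \<in> carrier_mat r r" "Q \<in> carrier_mat r r" "P' \<in> carrier_mat r r" "Q' \<in> carrier_mat r r"
  shows "diag_block r P Q * diag_block r P' Q' = diag_block r (P * P') (Q * Q')"
  unfolding diag_block_def using assms by (subst mult_four_block_mat[of _ r r _ r _ r _ _ r _ r]) auto

text \<open>A supply of explicit elements: blocks P and -P^T give members of \<open>sp_mat\<close>,
  and P and P^T, with trace 0, members of \<open>sp_module_mat\<close>.\<close>

lemma form_adjoint_diag_block:
  assumes "P \<in> carrier_mat r r" "Q = s \<cdot>\<^sub>m transpose_mat P" "s * s = 1"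
  shows "form_adjoint r s (diag_block r P Q)"
proof -
  have PT: "transpose_mat P \<in> carrier_mat r r" using assms by simp
  have s: "s * s * x = x" "s * (s * x) = x" for x :: 'a
    using assms(3) by (simp_all add: mult.assoc[symmetric])
  have "transpose_mat (diag_block r P Q) * symplectic_mat r =
      four_block_mat (0\<^sub>m r r) (transpose_mat P) (- (transpose_mat Q)) (0\<^sub>m r r)"
    unfolding diag_block_def symplectic_mat_def assms(2) using assms PT
    by (subst transpose_four_block_mat[of _ r r _ r _ r], auto,
        subst mult_four_block_mat[of _ r r _ r _ r _ _ r _ r]) auto
  moreover have "symplectic_mat r * diag_block r P Q =
      four_block_mat (0\<^sub>m r r) Q (- P) (0\<^sub>m r r)"
    unfolding diag_block_def symplectic_mat_def assms(2) using assms PT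
    by (subst mult_four_block_mat[of _ r r _ r _ r _ _ r _ r]) auto
  moreover have "four_block_mat (0\<^sub>m r r) (transpose_mat P) (- (transpose_mat Q)) (0\<^sub>m r r) =
      s \<cdot>\<^sub>m four_block_mat (0\<^sub>m r r) Q (- P) (0\<^sub>m r r)"
    using assms(1,3) unfolding assms(2) by (intro eq_matI) (auto simp: s)
  ultimately show ?thesis
    using assms by (auto simp: form_adjoint_def diag_block_def intro!: carrier_matI)
qed

lemma diag_block_index:
  assumes "P \<in> carrier_mat r r" "Q \<in> carrier_mat r r" "i < r" "j < r"
  shows "diag_block r P Q $$ (i, j) = P $$ (i, j)"
  using assms by (simp add: diag_block_def)

lemma mat_trace_diag_block:
  assumes "P \<in> carrier_mat r r" "Q \<in> carrier_mat r r"
  shows "mat_trace (diag_block r P Q) = mat_trace P + mat_trace Q"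
proof -
  let ?M = "four_block_mat P (0\<^sub>m r r) (0\<^sub>m r r) Q"
  have "mat_trace ?M = (\<Sum>i<r + r. ?M $$ (i, i))" using assms by (simp add: mat_trace_def)
  also have "\<dots> = (\<Sum>i<r. ?M $$ (i, i)) + (\<Sum>i\<in>{r..<r + r}. ?M $$ (i, i))"
    using sum.atLeastLessThan_concat[of 0 r "r + r" "\<lambda>i. ?M $$ (i, i)"]
    by (simp add: lessThan_atLeast0)
  also have "(\<Sum>i\<in>{r..<r + r}. ?M $$ (i, i)) = (\<Sum>i<r. ?M $$ (i + r, i + r))"
    using sum.shift_bounds_nat_ivl[of "\<lambda>i. ?M $$ (i, i)" 0 r r] by (simp add: lessThan_atLeast0)
  also have "(\<Sum>i<r. ?M $$ (i, i)) = mat_trace P" using assms by (simp add: mat_trace_def)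
  also have "(\<Sum>i<r. ?M $$ (i + r, i + r)) = mat_trace Q"
    using assms by (simp add: mat_trace_def)
  finally show ?thesis by (simp add: diag_block_def)
qed

lemma unit_mat_transpose: "transpose_mat (unit_mat n i j) = unit_mat n j i"
  by (intro eq_matI) auto

text \<open>For X = diag(E, -E) with E the matrix unit at (0,0), the square has trace 2 and vanishes
  at (1,1), where only the trace correction \<open>- 2 / r\<close> remains.\<close>

lemma sp_sp_product_nonzero:
  assumes r: "2 \<le> r"
  shows "\<exists>X\<in>sp_mat r. \<exists>Y\<in>sp_mat r. mat_circ (2 * r) X (Y :: 'f::field_char_0 mat) \<noteq> 0\<^sub>m (2 * r) (2 * r)"
proof -
  let ?E = "unit_mat r 0 0 :: 'f mat"
  let ?X = "diag_block r ?E ((- 1) \<cdot>\<^sub>m ?E)"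
  have X: "?X \<in> sp_mat r"
    unfolding sp_mat_iff by (rule form_adjoint_diag_block) (simp_all add: unit_mat_transpose)
  have EE: "?E * ?E = ?E" using r by (simp add: unit_mat_mult)
  have XX: "?X * ?X = diag_block r ?E ?E"
    by (subst diag_block_mult[of _ r])
      (simp_all add: EE mult_smult_distrib[of _ r r _ r] mult_smult_assoc_mat[of _ r r _ r] smult_smult_mat,
       intro arg_cong2[where f = "diag_block r"] eq_matI, auto)
  have carr: "diag_block r ?E ?E \<in> carrier_mat (2 * r) (2 * r)"
    unfolding diag_block_def by (auto intro!: carrier_matI)
  have tr: "mat_trace (?X * ?X) = 2"
    unfolding XX using r by (simp add: mat_trace_diag_block mat_trace_unit_mat)
  have "mat_circ (2 * r) ?X ?X $$ (1, 1) = - (2 / of_nat r)"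
    unfolding mat_circ_def tr unfolding XX using r carr
    by (simp add: diag_block_index)
  moreover have "(0\<^sub>m (2 * r) (2 * r) :: 'f mat) $$ (1, 1) = 0" using r by simp
  ultimately have "mat_circ (2 * r) ?X ?X \<noteq> 0\<^sub>m (2 * r) (2 * r)" using r by auto
  then show ?thesis using X by blast
qed

text \<open>U has to be traceless, so a second diagonal unit F is subtracted; since E F = F E = 0
  the entry at (0,0) of both products is 1.\<close>

lemma sp_module_product_nonzero:
  assumes r: "2 \<le> r"
  shows "\<exists>X\<in>sp_mat r. \<exists>U\<in>sp_module_mat r. mat_circ (2 * r) X (U :: 'f::field_char_0 mat) \<noteq> 0\<^sub>m (2 * r) (2 * r)"
proof -
  let ?E = "unit_mat r 0 0 :: 'f mat" and ?F = "unit_mat r (Suc 0) (Suc 0) :: 'f mat"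
  let ?X = "diag_block r ?E ((- 1) \<cdot>\<^sub>m ?E)" and ?U = "diag_block r (?E - ?F) (1 \<cdot>\<^sub>m transpose_mat (?E - ?F))"
  have X: "?X \<in> sp_mat r"
    unfolding sp_mat_iff by (rule form_adjoint_diag_block) (simp_all add: unit_mat_transpose)
  have tEF: "mat_trace (?E - ?F) = 0" "mat_trace (1 \<cdot>\<^sub>m transpose_mat (?E - ?F)) = 0"
    using r mat_trace_unit_mat[of 0 r 0] mat_trace_unit_mat[of "Suc 0" r "Suc 0"]
    by (simp_all add: mat_trace_def sum_subtractf)
  have U: "?U \<in> sp_module_mat r"
    unfolding sp_module_mat_iff
  proof
    show "form_adjoint r 1 ?U" by (rule form_adjoint_diag_block) auto
    show "mat_trace ?U = 0" by (subst mat_trace_diag_block) (use tEF in auto)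
  qed
  have tr: "mat_trace (?X * ?U) = 0"
    using form_adjoint_trace_zero[of r ?X ?U] X U by (simp only: sp_mat_iff sp_module_mat_iff)
  have EF: "?E * (?E - ?F) = ?E" "(?E - ?F) * ?E = ?E"
    using r by (simp_all add: mult_minus_distrib_mat[of _ r r _ r] minus_mult_distrib_mat[of _ r r _ _ r]
        unit_mat_mult) (intro eq_matI, auto)+
  have c: "?X \<in> carrier_mat (2 * r) (2 * r)" "?U \<in> carrier_mat (2 * r) (2 * r)"
    using X U by (auto simp: sp_mat_def sp_module_mat_def)
  have carr: "?E - ?F \<in> carrier_mat r r" "1 \<cdot>\<^sub>m transpose_mat (?E - ?F) \<in> carrier_mat r r"
    by (auto intro!: carrier_matI)
  have "(?X * ?U) $$ (0, 0) = 1" "(?U * ?X) $$ (0, 0) = 1"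
    using r carr
    by (subst diag_block_mult[of _ r], simp_all add: EF,
        subst diag_block_index[of _ r], auto intro!: carrier_matI)+
  then have "mat_circ (2 * r) ?X ?U $$ (0, 0) = 2"
    unfolding mat_circ_def tr using r c by simp
  moreover have "(0\<^sub>m (2 * r) (2 * r) :: 'f mat) $$ (0, 0) = 0" using r by simp
  ultimately have "mat_circ (2 * r) ?X ?U \<noteq> 0\<^sub>m (2 * r) (2 * r)" by auto
  then show ?thesis using X U by blast
qed

text \<open>The upper left blocks are the matrix units at (0,1) and (1,0); their two products are
  different diagonal units.\<close>

lemma module_bracket_nonzero:
  assumes r: "2 \<le> r"
  shows "\<exists>U\<in>sp_module_mat r. \<exists>V\<in>sp_module_mat r. mat_bracket U (V :: 'f::field_char_0 mat) \<noteq> 0\<^sub>m (2 * r) (2 * r)"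
proof -
  have mem: "diag_block r (unit_mat r i j) (unit_mat r j i :: 'f mat) \<in> sp_module_mat r"
    if "i < r" "j < r" "i \<noteq> j" for i j
    unfolding sp_module_mat_iff
  proof
    show "form_adjoint r 1 (diag_block r (unit_mat r i j) (unit_mat r j i :: 'f mat))"
      by (rule form_adjoint_diag_block) (simp_all add: unit_mat_transpose, intro eq_matI, auto)
    show "mat_trace (diag_block r (unit_mat r i j) (unit_mat r j i :: 'f mat)) = 0"
      using that by (simp add: mat_trace_diag_block mat_trace_unit_mat)
  qed
  let ?U = "diag_block r (unit_mat r 0 1) (unit_mat r 1 0 :: 'f mat)"
    and ?V = "diag_block r (unit_mat r 1 0) (unit_mat r 0 1 :: 'f mat)"
  have U: "?U \<in> sp_module_mat r" and V: "?V \<in> sp_module_mat r" using mem r by auto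
  then have c: "?U \<in> carrier_mat (2 * r) (2 * r)" "?V \<in> carrier_mat (2 * r) (2 * r)"
    by (auto simp: sp_module_mat_def)
  have "(?U * ?V) $$ (0, 0) = 1" "(?V * ?U) $$ (0, 0) = 0"
    using r by (simp_all add: diag_block_mult diag_block_index[of _ r] unit_mat_mult)
  then have "mat_bracket ?U ?V $$ (0, 0) = 1"
    unfolding mat_bracket_def using r c by simp
  moreover have "(0\<^sub>m (2 * r) (2 * r) :: 'f mat) $$ (0, 0) = 0" using r by simp
  ultimately have "mat_bracket ?U ?V \<noteq> 0\<^sub>m (2 * r) (2 * r)" by auto
  then show ?thesis using U V by blast
qed

text \<open>Three distinct indices give a product of trace 0 that does not cancel. For r = 2 the
  circle product on the module is zero, hence the stronger bound.\<close>

lemma module_product_nonzero: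
  assumes r: "3 \<le> r"
  shows "\<exists>U\<in>sp_module_mat r. \<exists>V\<in>sp_module_mat r. mat_circ (2 * r) U (V :: 'f::field_char_0 mat) \<noteq> 0\<^sub>m (2 * r) (2 * r)"
proof -
  let ?U = "\<lambda>i j. diag_block r (unit_mat r i j) (unit_mat r j i :: 'f mat)"
  have mem: "?U i j \<in> sp_module_mat r" if "i < r" "j < r" "i \<noteq> j" for i j
    unfolding sp_module_mat_iff
  proof
    show "form_adjoint r 1 (?U i j)"
      by (rule form_adjoint_diag_block) (simp_all add: unit_mat_transpose, intro eq_matI, auto)
    show "mat_trace (?U i j) = 0"
      using that by (simp add: mat_trace_diag_block mat_trace_unit_mat)
  qed
  have U: "?U 0 1 \<in> sp_module_mat r" and V: "?U 1 2 \<in> sp_module_mat r" using mem r by auto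
  then have c: "?U 0 1 \<in> carrier_mat (2 * r) (2 * r)" "?U 1 2 \<in> carrier_mat (2 * r) (2 * r)"
    by (auto simp: sp_module_mat_def)
  have UV: "?U 0 1 * ?U 1 2 = diag_block r (unit_mat r 0 2) (0\<^sub>m r r)"
    "?U 1 2 * ?U 0 1 = diag_block r (0\<^sub>m r r) (unit_mat r 2 0)"
    using r by (simp_all add: diag_block_mult unit_mat_mult)
  have "(?U 0 1 * ?U 1 2) $$ (0, 2) = 1" "(?U 1 2 * ?U 0 1) $$ (0, 2) = 0"
    unfolding UV using r by (simp_all add: diag_block_index[of _ r])
  then have "mat_circ (2 * r) (?U 0 1) (?U 1 2) $$ (0, 2) = 1"
    unfolding mat_circ_def using r c by simp
  moreover have "(0\<^sub>m (2 * r) (2 * r) :: 'f mat) $$ (0, 2) = 0" using r by simp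
  ultimately have "mat_circ (2 * r) (?U 0 1) (?U 1 2) \<noteq> 0\<^sub>m (2 * r) (2 * r)" by auto
  then show ?thesis using U V by blast
qed

section \<open>The coordinate algebra and the brackets\<close>

context coordinate_algebra
begin

lemma parts_eq:
  assumes "a \<in> A" "b \<in> B"
  shows "A_part (a + b) = a" "B_part (a + b) = b"
proof -
  have "(THE p. p \<in> A \<times> B \<and> a + b = fst p + snd p) = (a, b)"
    by (rule the1_equality[OF A_plus_B]) (use assms in auto)
  then show "A_part (a + b) = a" "B_part (a + b) = b" by (simp_all add: A_part_def B_part_def)
qed

lemma parts_mem: "A_part c \<in> A" "B_part c \<in> B"
  and parts_sum: "c = A_part c + B_part c"
proof -
  obtain p where "p \<in> A \<times> B \<and> c = fst p + snd p" using A_plus_B by blast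
  then obtain a b where ab: "a \<in> A" "b \<in> B" "c = a + b" by auto
  show "A_part c \<in> A" "B_part c \<in> B" "c = A_part c + B_part c"
    unfolding ab(3) parts_eq[OF ab(1,2)] using ab by auto
qed

lemma decompose: obtains a b where "a \<in> A" "b \<in> B" "c = a + b"
  using parts_mem parts_sum that by blast

lemma mu_plus_left: "mu (\<alpha> + \<alpha>') \<beta> = mu \<alpha> \<beta> + mu \<alpha>' \<beta>"
  and mu_plus_right: "mu \<alpha> (\<beta> + \<beta>') = mu \<alpha> \<beta> + mu \<alpha> \<beta>'"
  and mu_sc_left: "mu (scale c \<alpha>) \<beta> = scale c (mu \<alpha> \<beta>)"
  and mu_sc_right: "mu \<alpha> (scale c \<beta>) = scale c (mu \<alpha> \<beta>)"
  using mu_bilinear unfolding bilinear_on_def by blast+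

lemma mu_minus_left: "mu (- \<alpha>) \<beta> = - mu \<alpha> \<beta>" and mu_minus_right: "mu \<alpha> (- \<beta>) = - mu \<alpha> \<beta>"
  using mu_sc_left[of "-1" \<alpha> \<beta>] mu_sc_right[of \<alpha> "-1" \<beta>] by simp_all

lemma mu_diff_right: "mu \<alpha> (\<beta> - \<beta>') = mu \<alpha> \<beta> - mu \<alpha> \<beta>'"
  using mu_plus_right[of \<alpha> \<beta> "- \<beta>'"] by (simp add: mu_minus_right)

lemma mu_zero_left: "mu 0 \<beta> = 0" and mu_zero_right: "mu \<alpha> 0 = 0"
  using mu_sc_left[of 0 0 \<beta>] mu_sc_right[of \<alpha> 0 0] by simp_all

text \<open>Centrality as the brackets deliver it: on elements of A and of B separately, and
  together with stability of A and B. Commutation and two ways of sliding z out of a product give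
  the three associator conditions.\<close>

definition multiplier where
  "multiplier z \<longleftrightarrow> z \<in> A \<and> (\<forall>a\<in>A. mu z a \<in> A) \<and> (\<forall>b\<in>B. mu z b \<in> B) \<and>
     (\<forall>\<alpha>\<in>A \<union> B. mu \<alpha> z = mu z \<alpha>) \<and>
     (\<forall>\<alpha>\<in>A \<union> B. \<forall>\<beta>\<in>A \<union> B. mu (mu z \<alpha>) \<beta> = mu z (mu \<alpha> \<beta>) \<and> mu \<alpha> (mu z \<beta>) = mu z (mu \<alpha> \<beta>))"

lemma algebra_centreD:
  assumes "z \<in> algebra_centre mu"
  shows "mu \<alpha> z = mu z \<alpha>" "mu (mu z \<alpha>) \<beta> = mu z (mu \<alpha> \<beta>)" "mu \<alpha> (mu z \<beta>) = mu z (mu \<alpha> \<beta>)"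
proof -
  show c: "mu \<alpha> z = mu z \<alpha>" for \<alpha> using assms by (simp add: algebra_centre_def)
  have a: "mu (mu z \<alpha>) \<beta> = mu z (mu \<alpha> \<beta>)" "mu (mu \<alpha> z) \<beta> = mu \<alpha> (mu z \<beta>)" for \<alpha> \<beta>
    using assms unfolding algebra_centre_def associator_def by simp_all
  show "mu (mu z \<alpha>) \<beta> = mu z (mu \<alpha> \<beta>)" by (rule a)
  show "mu \<alpha> (mu z \<beta>) = mu z (mu \<alpha> \<beta>)" using a[of \<alpha> \<beta>] c by metis
qed

lemma multiplier_centre:
  assumes "multiplier z"
  shows "z \<in> algebra_centre mu"
proof -
  have c: "mu \<alpha> z = mu z \<alpha>" for \<alpha>
  proof -
    obtain a b where "a \<in> A" "b \<in> B" "\<alpha> = a + b" by (rule decompose)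
    then show ?thesis using assms by (simp add: multiplier_def mu_plus_left mu_plus_right)
  qed
  have m: "mu (mu z \<alpha>) \<beta> = mu z (mu \<alpha> \<beta>)" "mu \<alpha> (mu z \<beta>) = mu z (mu \<alpha> \<beta>)" for \<alpha> \<beta>
  proof -
    obtain a b where ab: "a \<in> A" "b \<in> B" "\<alpha> = a + b" by (rule decompose)
    obtain a' b' where ab': "a' \<in> A" "b' \<in> B" "\<beta> = a' + b'" by (rule decompose)
    have *: "mu (mu z \<alpha>) \<beta> = mu z (mu \<alpha> \<beta>) \<and> mu \<alpha> (mu z \<beta>) = mu z (mu \<alpha> \<beta>)"
      if "\<alpha> \<in> A \<union> B" "\<beta> \<in> A \<union> B" for \<alpha> \<beta>
      using assms that unfolding multiplier_def by blast
    show "mu (mu z \<alpha>) \<beta> = mu z (mu \<alpha> \<beta>)" "mu \<alpha> (mu z \<beta>) = mu z (mu \<alpha> \<beta>)"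
      unfolding ab(3) ab'(3) using * ab ab' by (simp_all add: mu_plus_left mu_plus_right)
  qed
  show ?thesis
    unfolding algebra_centre_def associator_def by (simp add: c m)
qed

lemma sym_centre:
  assumes "z \<in> algebra_centre mu"
  shows "sym (mu z \<alpha>) \<beta> = mu z (sym \<alpha> \<beta>)" "sym \<alpha> (mu z \<beta>) = mu z (sym \<alpha> \<beta>)"
    "skew (mu z \<alpha>) \<beta> = mu z (skew \<alpha> \<beta>)" "skew \<alpha> (mu z \<beta>) = mu z (skew \<alpha> \<beta>)"
  using algebra_centreD[OF assms]
  by (simp_all add: sym_def skew_def mu_sc_right mu_plus_right mu_diff_right)

text \<open>Every operator in the list is linear in a and z slides out of each product; the
  coefficients k are irrelevant. So inner derivations are linear over the centre in their first
  argument.\<close>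

lemma mult_expression_centre:
  assumes z: "z \<in> algebra_centre mu"
  shows "mult_expression k (mu z a) b c = mu z (mult_expression k a b c)"
proof -
  have ops: "mult_operators (mu z a) b c = map (mu z) (mult_operators a b c)"
    using algebra_centreD[OF z] by (simp add: mult_operators_def)
  have len: "length (mult_operators a b c) = 12" by (simp add: mult_operators_def)
  have "mu z (sum f I) = (\<Sum>i\<in>I. mu z (f i))" for f and I :: "nat set"
    by (induction I rule: infinite_finite_induct) (auto simp: mu_zero_right mu_plus_right)
  then show ?thesis
    unfolding mult_expression_def ops
    by (simp add: len mu_sc_right del: sum.lessThan_Suc)
qed

lemma skew_one: "skew one \<alpha> = 0"
  by (simp add: skew_def unit)

end

text \<open>With \<open>p = (z, b, c)\<close>, alternativity and commutation with \<open>z\<close> give \<open>(b, z, c) = - p\<close> and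
  \<open>p = - 2 p\<close>, so \<open>p = 0\<close> outside characteristic 3.\<close>

lemma (in coordinate_algebra) alternative_commuting_central:
  assumes alt: "alternative_alg mu" and comm: "\<And>\<alpha>. mu \<alpha> z = mu z \<alpha>" and char: "(3 :: 'f) \<noteq> 0"
  shows "mu (mu z b) c = mu z (mu b c)" "mu b (mu z c) = mu z (mu b c)"
proof -
  have left: "mu (mu x y) w - mu x (mu y w) = - (mu (mu y x) w - mu y (mu x w))" for x y w
  proof -
    have "mu (mu (x + y) (x + y)) w = mu (x + y) (mu (x + y) w)"
      and "mu (mu x x) w = mu x (mu x w)" "mu (mu y y) w = mu y (mu y w)"
      using alt by (auto simp: alternative_alg_def)
    then show ?thesis by (simp add: mu_plus_left mu_plus_right algebra_simps)
  qed
  have right: "mu (mu w x) y - mu w (mu x y) = - (mu (mu w y) x - mu w (mu y x))" for x y w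
  proof -
    have "mu (mu w (x + y)) (x + y) = mu w (mu (x + y) (x + y))"
      and "mu (mu w x) x = mu w (mu x x)" "mu (mu w y) y = mu w (mu y y)"
      using alt by (auto simp: alternative_alg_def)
    then show ?thesis by (simp add: mu_plus_left mu_plus_right algebra_simps)
  qed
  let ?X = "mu (mu z b) c" and ?Y = "mu z (mu b c)" and ?Q = "mu b (mu z c)"
  have 1: "?X - ?Y = - (?X - ?Q)" using left[of z b c] comm by simp
  have 2: "?X - ?Q = - (?Y - ?Q)" using right[of b z c] comm by simp
  have "?X - ?Q = ?Q - ?Y" using 2 by simp
  moreover have "?X - ?Y = (?X - ?Q) + (?Q - ?Y)" by simp
  ultimately have "- (?Q - ?Y) = (?Q - ?Y) + (?Q - ?Y)" using 1 by (simp only:)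
  then have "(?Q - ?Y) + (?Q - ?Y) + (?Q - ?Y) = 0" by (metis add.left_inverse)
  then have "scale 3 (?Q - ?Y) = 0"
    using scale_left_distrib[of 1 2 "?Q - ?Y"] scale_left_distrib[of 1 1 "?Q - ?Y"] by (simp add: add.assoc)
  then have "?Q = ?Y" using char by simp
  then show "?Q = ?Y" "?X = ?Y" using 2 by simp_all
qed

lemma linear_bij_mat_inv:
  assumes "linear_bij_mat sc V S \<rho>" "X \<in> S"
  shows "inv_into V \<rho> X \<in> V" "\<rho> (inv_into V \<rho> X) = X"
  using assms by (auto simp: linear_bij_mat_def bij_betw_def intro: inv_into_into f_inv_into_f)

lemma linear_bij_mat_inv_nonzero:
  assumes \<rho>: "linear_bij_mat sc V S \<rho>" and "vector_space sc" "S \<subseteq> carrier_mat n n" "X \<in> S" "X \<noteq> 0\<^sub>m n n"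
  shows "inv_into V \<rho> X \<noteq> 0"
proof
  interpret vector_space sc by fact
  assume 0: "inv_into V \<rho> X = 0"
  have V: "0 \<in> V" and X: "\<rho> 0 = X" using linear_bij_mat_inv[OF \<rho> assms(4)] 0 by auto
  have "\<rho> (sc 0 0) = 0 \<cdot>\<^sub>m \<rho> 0" using \<rho> V by (simp only: linear_bij_mat_def)
  then have "X = 0 \<cdot>\<^sub>m X" using X by simp
  moreover have "0 \<cdot>\<^sub>m X = 0\<^sub>m n n" using assms(3,4) by (intro eq_matI) auto
  ultimately show False using assms(5) by simp
qed

text \<open>Counting signs: the involution is 1 on A and -1 on B and reverses products, so
  \<open>sym\<close> multiplies the signs of its arguments while \<open>skew\<close> contributes one
  more -1. A product with a commuting z is its own symmetrisation.\<close>

lemma (in coordinate_algebra) involution_parts: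
  assumes has_involution
  shows "\<lbrakk>a \<in> A; a' \<in> A\<rbrakk> \<Longrightarrow> sym a a' \<in> A" "\<lbrakk>a \<in> A; a' \<in> A\<rbrakk> \<Longrightarrow> skew a a' \<in> B"
    "\<lbrakk>a \<in> A; b \<in> B\<rbrakk> \<Longrightarrow> sym a b \<in> B" "\<lbrakk>a \<in> A; b \<in> B\<rbrakk> \<Longrightarrow> skew a b \<in> A"
    "\<lbrakk>b \<in> B; b' \<in> B\<rbrakk> \<Longrightarrow> sym b b' \<in> A" "\<lbrakk>b \<in> B; b' \<in> B\<rbrakk> \<Longrightarrow> skew b b' \<in> B"
    "\<lbrakk>z \<in> A; a \<in> A; mu a z = mu z a\<rbrakk> \<Longrightarrow> mu z a \<in> A" "\<lbrakk>z \<in> A; b \<in> B; mu b z = mu z b\<rbrakk> \<Longrightarrow> mu z b \<in> B"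
proof -
  obtain \<eta> where lin: "Vector_Spaces.linear scale scale \<eta>"
    and anti: "\<And>a b. \<eta> (mu a b) = mu (\<eta> b) (\<eta> a)" and AB: "A = {a. \<eta> a = a}" "B = {b. \<eta> b = - b}"
    using assms unfolding has_involution_def by blast
  interpret l: Vector_Spaces.linear scale scale \<eta> by (rule lin)
  note s = AB sym_def skew_def l.scale l.add l.diff anti mu_minus_left mu_minus_right
  show "\<lbrakk>a \<in> A; a' \<in> A\<rbrakk> \<Longrightarrow> sym a a' \<in> A" "\<lbrakk>a \<in> A; a' \<in> A\<rbrakk> \<Longrightarrow> skew a a' \<in> B"
    "\<lbrakk>a \<in> A; b \<in> B\<rbrakk> \<Longrightarrow> sym a b \<in> B" "\<lbrakk>a \<in> A; b \<in> B\<rbrakk> \<Longrightarrow> skew a b \<in> A"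
    "\<lbrakk>b \<in> B; b' \<in> B\<rbrakk> \<Longrightarrow> sym b b' \<in> A" "\<lbrakk>b \<in> B; b' \<in> B\<rbrakk> \<Longrightarrow> skew b b' \<in> B"
    "\<lbrakk>z \<in> A; a \<in> A; mu a z = mu z a\<rbrakk> \<Longrightarrow> mu z a \<in> A" "\<lbrakk>z \<in> A; b \<in> B; mu b z = mu z b\<rbrakk> \<Longrightarrow> mu z b \<in> B"
    by (simp_all add: s add.commute scale_minus_right[symmetric] del: scale_minus_right)
qed

section \<open>Bracket formulas with the matrix realisations removed\<close>

context root_graded_lie_algebra
begin

lemma type_cases:
  obtains (general) brackets_general "simply_laced T \<or> T = TypeF4 \<or> T = TypeG2 \<or> (\<exists>r. T = TypeB r)"
  | (A) r where "2 \<le> r" "T = TypeA r" "brackets_A r"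
  | (C) r where "2 \<le> r" "T = TypeC r" "brackets_C r"
  using brackets[unfolded brackets_of_type_def] valid by (cases T) (auto split: if_splits)

lemma sym_plus_skew: "\<aa>.sym a b + \<aa>.skew a b = mu a b"
  and sym_minus_skew: "\<aa>.sym a b - \<aa>.skew a b = mu b a"
proof -
  have half: "sA (1 / 2) x + sA (1 / 2) x = x" for x
    by (simp add: \<aa>.scale_left_distrib[symmetric])
  show "\<aa>.sym a b + \<aa>.skew a b = mu a b" "\<aa>.sym a b - \<aa>.skew a b = mu b a"
    using half[of "mu a b"] half[of "mu b a"]
    by (simp_all add: \<aa>.sym_def \<aa>.skew_def \<aa>.scale_right_distrib \<aa>.scale_right_diff_distrib algebra_simps)
qed

lemma gA_cancel:
  assumes "x \<in> g" "x \<noteq> 0" "a \<in> A" "a' \<in> A" "gA x a = gA x a'"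
  shows "a = a'"
proof -
  have s: "sA (- 1) a' \<in> A" using assms(4) \<aa>.subspace_scale[OF \<aa>.subspace_A] by blast
  have "gA x (a + sA (- 1) a') = 0"
    using assms s gT.tens_add_right[OF assms(1,3) s] gT.tens_scale_right[OF assms(1,4), of "- 1"] by simp
  then have "a + sA (- 1) a' = 0"
    using gT.tens_eq_0D[OF assms(1,2)] \<aa>.subspace_add[OF \<aa>.subspace_A assms(3) s] by blast
  then show ?thesis by simp
qed

lemma WB_cancel:
  assumes "w \<noteq> 0" "b \<in> B" "b' \<in> B" "WB w b = WB w b'"
  shows "b = b'"
proof (cases "simply_laced T")
  case True
  then show ?thesis using simply_laced_trivial(1) assms by auto
next
  case False
  interpret WT: tensor_module sL br g h "type_rank T" \<pi> sW UNIV act sA B WB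
    by (rule W_tensor_module[OF False])
  have s: "sA (- 1) b' \<in> B" using assms(3) \<aa>.subspace_scale[OF \<aa>.subspace_B] by blast
  have "WB w (b + sA (- 1) b') = 0"
    using assms s WB_add_right[OF assms(2) s] WB_scale_right[OF assms(3), of w "- 1"] by simp
  then have "b + sA (- 1) b' = 0"
    using WT.tens_eq_0D[of w "b + sA (- 1) b'"] assms(1) \<aa>.subspace_add[OF \<aa>.subspace_B assms(2) s] by blast
  then show ?thesis by simp
qed

lemma pr_gA: "\<lbrakk>x \<in> g; a \<in> A\<rbrakk> \<Longrightarrow> prA (gA x a) = gA x a" "\<lbrakk>x \<in> g; a \<in> A\<rbrakk> \<Longrightarrow> prB (gA x a) = 0"
  "\<lbrakk>x \<in> g; a \<in> A\<rbrakk> \<Longrightarrow> prD (gA x a) = 0"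
  using pr_TA gA_TA by blast+

lemma pr_WB: "b \<in> B \<Longrightarrow> prA (WB w b) = 0" "b \<in> B \<Longrightarrow> prB (WB w b) = WB w b" "b \<in> B \<Longrightarrow> prD (WB w b) = 0"
  using pr_TB WB_TB by blast+

lemma pr_ang: "prA (ang \<alpha> \<beta>) = 0" "prB (ang \<alpha> \<beta>) = 0" "prD (ang \<alpha> \<beta>) = ang \<alpha> \<beta>"
  using pr_D ang_D by blast+

lemmas pr_simps = pr_add pr_scale pr_gA pr_WB pr_ang

text \<open>The matrices are hidden in a function c. One pair with
  \<open>c x y = br x y \<noteq> 0\<close> is kept, at which the component in g \<otimes> A sees the
  full product a a'.\<close>

lemma brackets_A_form:
  assumes "brackets_A r" "2 \<le> r"
  obtains c where "\<And>x y. \<lbrakk>x \<in> g; y \<in> g\<rbrakk> \<Longrightarrow> c x y \<in> g"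
    and "\<And>x y a a'. \<lbrakk>x \<in> g; y \<in> g; a \<in> A; a' \<in> A\<rbrakk> \<Longrightarrow> br (gA x a) (gA y a') =
      gA (br x y) (\<aa>.sym a a') + gA (c x y) (\<aa>.skew a a') + sL (killing x y) (ang a a')"
    and "\<exists>x\<in>g. \<exists>y\<in>g. c x y = br x y \<and> br x y \<noteq> 0"
proof -
  obtain \<rho> where \<rho>: "linear_bij_mat sL g (sl_mat (r + 1)) \<rho>"
    and hom: "\<And>x y. \<lbrakk>x \<in> g; y \<in> g\<rbrakk> \<Longrightarrow> \<rho> (br x y) = mat_bracket (\<rho> x) (\<rho> y)"
    and eq: "\<And>x y a a'. \<lbrakk>x \<in> g; y \<in> g; a \<in> A; a' \<in> A\<rbrakk> \<Longrightarrow> br (gA x a) (gA y a') =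
      gA (br x y) (\<aa>.sym a a') + gA (inv_into g \<rho> (mat_circ (r + 1) (\<rho> x) (\<rho> y))) (\<aa>.skew a a')
        + sL (killing x y) (ang a a')"
    using assms(1) unfolding brackets_A_def by blast
  have \<rho>g: "\<rho> x \<in> sl_mat (r + 1)" if "x \<in> g" for x
    using \<rho> that by (auto simp: linear_bij_mat_def bij_betw_def)
  let ?c = "\<lambda>x y. inv_into g \<rho> (mat_circ (r + 1) (\<rho> x) (\<rho> y))"
  have c: "?c x y \<in> g" if "x \<in> g" "y \<in> g" for x y
    by (rule linear_bij_mat_inv(1)[OF \<rho> mat_circ_sl]) (use \<rho>g that in auto)
  obtain X Y Z :: "'a mat" where XYZ: "X \<in> sl_mat (r + 1)" "Y \<in> sl_mat (r + 1)" "Z \<in> sl_mat (r + 1)"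
    "Z \<noteq> 0\<^sub>m (r + 1) (r + 1)" "mat_bracket X Y = Z" "mat_circ (r + 1) X Y = Z"
    using sl_mat_products[of "r + 1"] assms(2) by auto
  let ?x = "inv_into g \<rho> X" and ?y = "inv_into g \<rho> Y"
  have xy: "?x \<in> g" "?y \<in> g" "\<rho> ?x = X" "\<rho> ?y = Y" using linear_bij_mat_inv[OF \<rho>] XYZ by auto
  have "inv_into g \<rho> Z = br ?x ?y"
  proof -
    have "inj_on \<rho> g" using \<rho> by (simp add: linear_bij_mat_def bij_betw_def)
    moreover have "\<rho> (br ?x ?y) = Z" using hom[OF xy(1,2)] xy XYZ by simp
    ultimately show ?thesis using g_br[OF xy(1,2)] by (metis inv_into_f_f)
  qed
  moreover have "inv_into g \<rho> Z \<noteq> 0"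
    by (rule linear_bij_mat_inv_nonzero[OF \<rho> vector_space_axioms _ XYZ(3,4)]) (auto simp: sl_mat_def)
  ultimately have "?c ?x ?y = br ?x ?y \<and> br ?x ?y \<noteq> 0" using xy XYZ by simp
  then show ?thesis using that[of ?c] c eq xy by blast
qed

text \<open>What survives of the matrices is that each coefficient map takes a nonzero value, so
  that coefficients can be cancelled. For s this holds from r = 3 on.\<close>

lemma brackets_C_form:
  assumes "brackets_C r" "2 \<le> r"
  obtains c e d s where "\<And>x u. x \<in> g \<Longrightarrow> e x u \<in> g" "\<And>u v. d u v \<in> g"
    and "\<And>x y a a'. \<lbrakk>x \<in> g; y \<in> g; a \<in> A; a' \<in> A\<rbrakk> \<Longrightarrow> br (gA x a) (gA y a') =
      gA (br x y) (\<aa>.sym a a') + WB (c x y) (\<aa>.skew a a') + sL (killing x y) (ang a a')"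
    and "\<And>x u a b. \<lbrakk>x \<in> g; a \<in> A; b \<in> B\<rbrakk> \<Longrightarrow> br (gA x a) (WB u b) =
      gA (e x u) (\<aa>.skew a b) + WB (act x u) (\<aa>.sym a b)"
    and "\<And>u v b b'. \<lbrakk>b \<in> B; b' \<in> B\<rbrakk> \<Longrightarrow> br (WB u b) (WB v b') =
      gA (d u v) (\<aa>.sym b b') + WB (s u v) (\<aa>.skew b b') + sL (wf u v) (ang b b')"
    and "\<exists>x\<in>g. \<exists>y\<in>g. c x y \<noteq> 0" "\<exists>x\<in>g. \<exists>u. e x u \<noteq> 0" "\<exists>u v. d u v \<noteq> 0"
    and "3 \<le> r \<Longrightarrow> \<exists>u v. s u v \<noteq> 0"
proof -
  obtain \<rho> \<sigma> where \<rho>: "linear_bij_mat sL g (sp_mat r) \<rho>" and \<sigma>: "linear_bij_mat sW UNIV (sp_module_mat r) \<sigma>"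
    and "\<forall>x\<in>g. \<forall>y\<in>g. \<rho> (br x y) = mat_bracket (\<rho> x) (\<rho> y)"
    and "\<forall>x\<in>g. \<forall>u. \<sigma> (act x u) = mat_bracket (\<rho> x) (\<sigma> u)"
    and eqs: "\<forall>x\<in>g. \<forall>y\<in>g. \<forall>a\<in>A. \<forall>a'\<in>A. br (gA x a) (gA y a') =
      gA (br x y) (\<aa>.sym a a') + WB (inv_into UNIV \<sigma> (mat_circ (2 * r) (\<rho> x) (\<rho> y))) (\<aa>.skew a a')
        + sL (killing x y) (ang a a')"
      "\<forall>x\<in>g. \<forall>u. \<forall>a\<in>A. \<forall>b\<in>B. br (gA x a) (WB u b) =
      gA (inv_into g \<rho> (mat_circ (2 * r) (\<rho> x) (\<sigma> u))) (\<aa>.skew a b) + WB (act x u) (\<aa>.sym a b)"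
      "\<forall>u v. \<forall>b\<in>B. \<forall>b'\<in>B. br (WB u b) (WB v b') =
      gA (inv_into g \<rho> (mat_bracket (\<sigma> u) (\<sigma> v))) (\<aa>.sym b b')
        + WB (inv_into UNIV \<sigma> (mat_circ (2 * r) (\<sigma> u) (\<sigma> v))) (\<aa>.skew b b') + sL (wf u v) (ang b b')"
    using assms(1) unfolding brackets_C_def by (elim exE conjE) (rule that)
  have \<rho>g: "\<rho> x \<in> sp_mat r" if "x \<in> g" for x
    using \<rho> that by (auto simp: linear_bij_mat_def bij_betw_def)
  have \<sigma>W: "\<sigma> u \<in> sp_module_mat r" for u
    using \<sigma> by (auto simp: linear_bij_mat_def bij_betw_def)
  have car: "sp_mat r \<subseteq> carrier_mat (2 * r) (2 * r)" "sp_module_mat r \<subseteq> carrier_mat (2 * r) (2 * r)"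
    by (auto simp: sp_mat_def sp_module_mat_def)
  note inv\<rho> = linear_bij_mat_inv[OF \<rho>] and inv\<sigma> = linear_bij_mat_inv[OF \<sigma>]
  note nz\<rho> = linear_bij_mat_inv_nonzero[OF \<rho> vector_space_axioms car(1)]
  note nz\<sigma> = linear_bij_mat_inv_nonzero[OF \<sigma> W.vector_space_axioms car(2)]
  have r: "0 < r" using assms(2) by simp
  let ?c = "\<lambda>x y. inv_into UNIV \<sigma> (mat_circ (2 * r) (\<rho> x) (\<rho> y))"
    and ?e = "\<lambda>x u. inv_into g \<rho> (mat_circ (2 * r) (\<rho> x) (\<sigma> u))"
    and ?d = "\<lambda>u v. inv_into g \<rho> (mat_bracket (\<sigma> u) (\<sigma> v))"
    and ?s = "\<lambda>u v. inv_into UNIV \<sigma> (mat_circ (2 * r) (\<sigma> u) (\<sigma> v))"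
  have e: "?e x u \<in> g" if "x \<in> g" for x u
    by (rule inv\<rho>(1)[OF mat_circ_sp_module[OF \<rho>g[OF that] \<sigma>W]])
  have d: "?d u v \<in> g" for u v by (rule inv\<rho>(1)[OF mat_bracket_module_module[OF \<sigma>W \<sigma>W]])
  have "\<exists>x\<in>g. \<exists>y\<in>g. ?c x y \<noteq> 0"
  proof -
    obtain X Y :: "'a mat" where XY: "X \<in> sp_mat r" "Y \<in> sp_mat r" "mat_circ (2 * r) X Y \<noteq> 0\<^sub>m (2 * r) (2 * r)"
      using sp_sp_product_nonzero[OF assms(2)] by blast
    have "?c (inv_into g \<rho> X) (inv_into g \<rho> Y) \<noteq> 0"
      unfolding inv\<rho>(2)[OF XY(1)] inv\<rho>(2)[OF XY(2)] by (rule nz\<sigma>[OF mat_circ_sp_sp[OF XY(1,2) r] XY(3)])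
    then show ?thesis using inv\<rho>(1)[OF XY(1)] inv\<rho>(1)[OF XY(2)] by blast
  qed
  moreover have "\<exists>x\<in>g. \<exists>u. ?e x u \<noteq> 0"
  proof -
    obtain X U :: "'a mat" where XU: "X \<in> sp_mat r" "U \<in> sp_module_mat r" "mat_circ (2 * r) X U \<noteq> 0\<^sub>m (2 * r) (2 * r)"
      using sp_module_product_nonzero[OF assms(2)] by blast
    have "?e (inv_into g \<rho> X) (inv_into UNIV \<sigma> U) \<noteq> 0"
      unfolding inv\<rho>(2)[OF XU(1)] inv\<sigma>(2)[OF XU(2)] by (rule nz\<rho>[OF mat_circ_sp_module[OF XU(1,2)] XU(3)])
    then show ?thesis using inv\<rho>(1)[OF XU(1)] by blast
  qed
  moreover have "\<exists>u v. ?d u v \<noteq> 0"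
  proof -
    obtain U V :: "'a mat" where UV: "U \<in> sp_module_mat r" "V \<in> sp_module_mat r" "mat_bracket U V \<noteq> 0\<^sub>m (2 * r) (2 * r)"
      using module_bracket_nonzero[OF assms(2)] by blast
    have "?d (inv_into UNIV \<sigma> U) (inv_into UNIV \<sigma> V) \<noteq> 0"
      unfolding inv\<sigma>(2)[OF UV(1)] inv\<sigma>(2)[OF UV(2)] by (rule nz\<rho>[OF mat_bracket_module_module[OF UV(1,2)] UV(3)])
    then show ?thesis by blast
  qed
  moreover have "\<exists>u v. ?s u v \<noteq> 0" if "3 \<le> r"
  proof -
    obtain U V :: "'a mat" where UV: "U \<in> sp_module_mat r" "V \<in> sp_module_mat r" "mat_circ (2 * r) U V \<noteq> 0\<^sub>m (2 * r) (2 * r)"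
      using module_product_nonzero[OF \<open>3 \<le> r\<close>] by blast
    have "?s (inv_into UNIV \<sigma> U) (inv_into UNIV \<sigma> V) \<noteq> 0"
      unfolding inv\<sigma>(2)[OF UV(1)] inv\<sigma>(2)[OF UV(2)] by (rule nz\<sigma>[OF mat_circ_module_module[OF UV(1,2) r] UV(3)])
    then show ?thesis by blast
  qed
  ultimately show ?thesis using eqs by (intro that[of ?e ?d ?c ?s, OF e d]) blast+
qed

lemma A_UNIV: "simply_laced T \<Longrightarrow> \<alpha> \<in> A"
  using \<aa>.decompose[of \<alpha>] simply_laced_trivial(1) by (metis add.right_neutral singletonD)

lemma C_involution: "T = TypeC r \<Longrightarrow> \<aa>.has_involution"
  using coordinates by (simp add: \<aa>.coordinate_algebra_of_type_def)

lemma brackets_generalD: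
  assumes brackets_general
  shows "\<aa>.product_respects_parts"
    and "\<forall>x\<in>g. \<forall>y\<in>g. \<forall>a\<in>A. \<forall>a'\<in>A.
        br (gA x a) (gA y a') = gA (br x y) (mu a a') + sL (killing x y) (ang a a')"
    and "\<forall>x\<in>g. \<forall>u. \<forall>a\<in>A. \<forall>b\<in>B. br (gA x a) (WB u b) = WB (act x u) (mu a b)"
proof -
  note * = assms[unfolded brackets_general_def]
  note * [THEN conjunct1] * [THEN conjunct2, THEN conjunct1] * [THEN conjunct2, THEN conjunct2, THEN conjunct1]
  then show "\<aa>.product_respects_parts"
    and "\<forall>x\<in>g. \<forall>y\<in>g. \<forall>a\<in>A. \<forall>a'\<in>A.
        br (gA x a) (gA y a') = gA (br x y) (mu a a') + sL (killing x y) (ang a a')"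
    and "\<forall>x\<in>g. \<forall>u. \<forall>a\<in>A. \<forall>b\<in>B. br (gA x a) (WB u b) = WB (act x u) (mu a b)"
    by this+
qed

lemma brackets_general_W:
  assumes brackets_general
  obtains der star where "\<And>u v. der u v \<in> g" "\<not> simply_laced T \<Longrightarrow> \<exists>u v. der u v \<noteq> 0"
    "T = TypeF4 \<or> T = TypeG2 \<Longrightarrow> \<exists>u v. star u v \<noteq> 0"
    "\<And>u v b b'. \<lbrakk>b \<in> B; b' \<in> B\<rbrakk> \<Longrightarrow> br (WB u b) (WB v b') =
      gA (der u v) (\<aa>.A_part (mu b b')) + WB (star u v) (\<aa>.B_part (mu b b')) + sL (wf u v) (ang b b')"
proof -
  obtain der star where "\<forall>u v. der u v \<in> g"
    "bilinear_on sW sW sL UNIV UNIV der" "bilinear_on sW sW sW UNIV UNIV star"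
    "\<forall>x\<in>g. \<forall>u v. br x (der u v) = der (act x u) v + der u (act x v)"
    "\<forall>x\<in>g. \<forall>u v. act x (star u v) = star (act x u) v + star u (act x v)"
    "\<not> simply_laced T \<longrightarrow> (\<exists>u v. der u v \<noteq> 0)" "T = TypeF4 \<or> T = TypeG2 \<longrightarrow> (\<exists>u v. star u v \<noteq> 0)"
    "\<forall>u v. \<forall>b\<in>B. \<forall>b'\<in>B. br (WB u b) (WB v b') =
      gA (der u v) (\<aa>.A_part (mu b b')) + WB (star u v) (\<aa>.B_part (mu b b')) + sL (wf u v) (ang b b')"
    using assms unfolding brackets_general_def by (elim exE conjE) (rule that)
  then show ?thesis by (intro that[of der star]) blast+
qed

text \<open>The component in D has the same shape for all types; with \<open>prD_WB_WB\<close> it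
  allows \<open>ang\<close> to be treated without further distinction of bracket formulas.\<close>

lemma prD_gA_gA:
  assumes x: "x \<in> g" "y \<in> g" "a \<in> A" "a' \<in> A"
  shows "prD (br (gA x a) (gA y a')) = sL (killing x y) (ang a a')"
proof (cases rule: type_cases)
  case general
  then have "mu a a' \<in> A"
    "br (gA x a) (gA y a') = gA (br x y) (mu a a') + sL (killing x y) (ang a a')"
    using x brackets_generalD[OF general(1)] unfolding \<aa>.product_respects_parts_def by blast+
  then show ?thesis using x g_br by (simp add: pr_simps)
next
  case (A r)
  obtain c where "c x y \<in> g" "br (gA x a) (gA y a') =
      gA (br x y) (\<aa>.sym a a') + gA (c x y) (\<aa>.skew a a') + sL (killing x y) (ang a a')"
    using brackets_A_form[OF A(3,1)] x by metis
  then show ?thesis using x g_br A_UNIV A by (simp add: pr_simps)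
next
  case (C r)
  obtain c where "br (gA x a) (gA y a') =
      gA (br x y) (\<aa>.sym a a') + WB (c x y) (\<aa>.skew a a') + sL (killing x y) (ang a a')"
    using brackets_C_form[OF C(3,1)] x by metis
  then show ?thesis using x g_br \<aa>.involution_parts(1,2)[OF C_involution[OF C(2)] x(3,4)] by (simp add: pr_simps)
qed

lemma prD_WB_WB:
  assumes "\<not> simply_laced T" and b: "b \<in> B" "b' \<in> B"
  shows "prD (br (WB u b) (WB v b')) = sL (wf u v) (ang b b')"
proof (cases rule: type_cases)
  case general
  obtain der star where "der u v \<in> g" "br (WB u b) (WB v b') =
      gA (der u v) (\<aa>.A_part (mu b b')) + WB (star u v) (\<aa>.B_part (mu b b')) + sL (wf u v) (ang b b')"
    using b by (rule_tac brackets_general_W[OF general(1)]) blast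
  then show ?thesis using \<aa>.parts_mem by (simp add: pr_simps)
next
  case (A r)
  then show ?thesis using assms by simp
next
  case (C r)
  obtain d s where "d u v \<in> g" "br (WB u b) (WB v b') =
      gA (d u v) (\<aa>.sym b b') + WB (s u v) (\<aa>.skew b b') + sL (wf u v) (ang b b')"
    using brackets_C_form[OF C(3,1)] b by metis
  then show ?thesis using b \<aa>.involution_parts(5,6)[OF C_involution[OF C(2)] b] by (simp add: pr_simps)
qed

end

section \<open>Centroid elements act by multiplication\<close>

text \<open>The map is the identity tensored with f, prescribed on products of basis vectors and
  then verified first in the right and then in the left factor. Being free of any module structure,
  it also covers W = 0.\<close>

lemma tensor_map_extend:
  assumes "vector_space sU" "vector_space sV" "vector_space sT"
    and subU: "module.subspace sU U" and subV: "module.subspace sV V"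
    and t: "tensor_map sU sV sT U V t"
    and f: "\<And>v. v \<in> V \<Longrightarrow> f v \<in> V" "\<And>v v'. \<lbrakk>v \<in> V; v' \<in> V\<rbrakk> \<Longrightarrow> f (v + v') = f v + f v'"
      "\<And>c v. v \<in> V \<Longrightarrow> f (sV c v) = sV c (f v)"
  shows "\<exists>\<Psi>. Vector_Spaces.linear sT sT \<Psi> \<and> (\<forall>u\<in>U. \<forall>v\<in>V. \<Psi> (t u v) = t u (f v))"
proof -
  interpret U: vector_space sU by fact
  interpret V: vector_space sV by fact
  interpret T: vector_space sT by fact
  have bil: "bilinear_on sU sV sT U V t" using t by (simp add: tensor_map_def)
  have add_left: "t (u + u') v = t u v + t u' v" and scale_left: "t (sU c u) v = sT c (t u v)"
    if "u \<in> U" "u' \<in> U" "v \<in> V" for u u' v c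
    using bil that unfolding bilinear_on_def by blast+
  have add_right: "t u (v + v') = t u v + t u v'" and scale_right: "t u (sV c v) = sT c (t u v)"
    if "u \<in> U" "v \<in> V" "v' \<in> V" for u v v' c
    using bil that unfolding bilinear_on_def by blast+
  have zero_left: "t 0 v = 0" if "v \<in> V" for v
    using scale_left[of 0 0 v 0] U.subspace_0[OF subU] that by simp
  have zero_right: "t u 0 = 0" if "u \<in> U" for u
    using scale_right[of u 0 0 0] V.subspace_0[OF subV] that by simp
  have f0: "f 0 = 0" using f(3)[of 0 0] V.subspace_0[OF subV] by simp
  obtain E where E: "E \<subseteq> U" "U.independent E" "U \<subseteq> U.span E"
    using U.maximal_independent_subset by blast
  obtain F where F: "F \<subseteq> V" "V.independent F" "V \<subseteq> V.span F"
    using V.maximal_independent_subset by blast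
  have sp: "U.span E = U" "V.span F = V"
    using E F U.span_minimal[OF E(1) subU] V.span_minimal[OF F(1) subV] by blast+
  let ?t = "\<lambda>(e, f). t e f"
  let ?X = "?t ` (E \<times> F)"
  have inj: "inj_on ?t (E \<times> F)" and ind: "T.independent ?X"
    using t E F sp unfolding tensor_map_def by blast+
  interpret vp: vector_space_pair sT sT ..
  define k where "k x = (let p = the_inv_into (E \<times> F) ?t x in t (fst p) (f (snd p)))" for x
  have k: "k (t e v) = t e (f v)" if "e \<in> E" "v \<in> F" for e v
    using the_inv_into_f_f[OF inj, of "(e, v)"] that by (simp add: k_def)
  define \<Psi> where "\<Psi> = vp.construct ?X k"
  have lin: "Vector_Spaces.linear sT sT \<Psi>" unfolding \<Psi>_def by (rule vp.linear_construct[OF ind])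
  interpret l: Vector_Spaces.linear sT sT \<Psi> by (rule lin)
  have base: "\<Psi> (t e v) = t e (f v)" if ev: "e \<in> E" "v \<in> F" for e v
  proof -
    have "t e v \<in> ?X" using ev by force
    then have "\<Psi> (t e v) = k (t e v)" unfolding \<Psi>_def by (rule vp.construct_basis[OF ind])
    then show ?thesis using k ev by simp
  qed
  have right: "v \<in> V \<and> \<Psi> (t e v) = t e (f v)" if e: "e \<in> E" and v: "v \<in> V" for e v
  proof -
    have "v \<in> V.span F" using v sp by simp
    then show ?thesis
    proof (induction rule: V.span_induct_alt)
      case base
      then show ?case using V.subspace_0[OF subV] zero_right f0 e E l.zero by auto
    next
      case (step c w v)
      have "w \<in> V" "e \<in> U" using step F e E by auto
      then show ?case
        using step base[OF e step(1)] V.subspace_scale[OF subV] V.subspace_add[OF subV] f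
        by (simp add: add_right[of e "sV c w" v] scale_right[of e w w] l.add l.scale
            add_right[of e "sV c (f w)" "f v"] scale_right[of e "f w" "f w"])
    qed
  qed
  have "u \<in> U \<and> \<Psi> (t u v) = t u (f v)" if u: "u \<in> U" and v: "v \<in> V" for u v
  proof -
    have "u \<in> U.span E" using u sp by simp
    then show ?thesis
    proof (induction rule: U.span_induct_alt)
      case base
      then show ?case using U.subspace_0[OF subU] zero_left f v l.zero by auto
    next
      case (step c w u)
      have "w \<in> U" using step E by auto
      then show ?case
        using step right[OF step(1) v] U.subspace_scale[OF subU] U.subspace_add[OF subU] f v
        by (simp add: add_left[of "sU c w" u] scale_left[of w w] l.add l.scale)
    qed
  qed
  then show ?thesis using lin by blast
qed

context root_graded_lie_algebra
begin

text \<open>A centroid element preserves each of the three summands; hence an equation between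
  brackets can be read in each summand separately.\<close>

lemma centroid_pr:
  assumes \<chi>: "\<chi> \<in> centroid sL br"
  shows "prA (\<chi> v) = \<chi> (prA v)" "prB (\<chi> v) = \<chi> (prB v)" "prD (\<chi> v) = \<chi> (prD v)"
proof -
  obtain \<phi> \<psi> where f: "\<And>a. a \<in> A \<Longrightarrow> \<phi> a \<in> A" "\<And>x a. \<lbrakk>x \<in> g; a \<in> A\<rbrakk> \<Longrightarrow> \<chi> (gA x a) = gA x (\<phi> a)"
    "\<And>b. b \<in> B \<Longrightarrow> \<psi> b \<in> B" "\<And>w b. b \<in> B \<Longrightarrow> \<chi> (WB w b) = WB w (\<psi> b)"
    and D: "\<And>d. d \<in> D \<Longrightarrow> \<chi> d \<in> D"
    by (rule centroid_forms[OF \<chi>]) (rule that)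
  interpret l: Vector_Spaces.linear sL sL \<chi> using \<chi> by (simp add: centroid_def)
  have TA: "\<chi> u \<in> TA" if "u \<in> TA" for u
    using that
  proof (induction rule: span_induct_alt)
    case (step c x y)
    then have "\<chi> x \<in> TA" using f gA_TA by auto
    then show ?case using step by (simp add: l.add l.scale span_add span_scale)
  qed (simp add: span_zero l.zero)
  have TB: "\<chi> u \<in> TB" if "u \<in> TB" for u
    using that
  proof (induction rule: span_induct_alt)
    case (step c x y)
    then have "\<chi> x \<in> TB" using f WB_TB by auto
    then show ?case using step by (simp add: l.add l.scale span_add span_scale)
  qed (simp add: span_zero l.zero)
  have "\<chi> v = \<chi> (prA v) + \<chi> (prB v) + \<chi> (prD v)"
    using arg_cong[OF pr_sum[of v], of \<chi>] by (simp add: l.add)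
  note pr_eq[OF _ _ _ this]
  then show "prA (\<chi> v) = \<chi> (prA v)" "prB (\<chi> v) = \<chi> (prB v)" "prD (\<chi> v) = \<chi> (prD v)"
    using TA[OF pr_mem(1)] TB[OF pr_mem(2)] D[OF pr_mem(3)] by auto
qed

lemma centroid_br:
  assumes "\<chi> \<in> centroid sL br"
  shows "\<chi> (br u v) = br (\<chi> u) v" "\<chi> (br u v) = br u (\<chi> v)"
  using assms unfolding centroid_def by blast+

section \<open>Comparison of coefficients\<close>

definition acts_by where
  "acts_by \<chi> \<phi> \<psi> \<longleftrightarrow> \<chi> \<in> centroid sL br \<and>
     (\<forall>a\<in>A. \<phi> a \<in> A) \<and> (\<forall>x\<in>g. \<forall>a\<in>A. \<chi> (gA x a) = gA x (\<phi> a)) \<and>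
     (\<forall>b\<in>B. \<psi> b \<in> B) \<and> (\<forall>w. \<forall>b\<in>B. \<chi> (WB w b) = WB w (\<psi> b))"

lemma acts_byD:
  assumes "acts_by \<chi> \<phi> \<psi>"
  shows "\<chi> \<in> centroid sL br" "a \<in> A \<Longrightarrow> \<phi> a \<in> A" "\<lbrakk>x \<in> g; a \<in> A\<rbrakk> \<Longrightarrow> \<chi> (gA x a) = gA x (\<phi> a)"
    "b \<in> B \<Longrightarrow> \<psi> b \<in> B" "b \<in> B \<Longrightarrow> \<chi> (WB w b) = WB w (\<psi> b)"
  using assms unfolding acts_by_def by blast+

text \<open>\<chi> may be moved out of \<open>br p q\<close> onto p or onto q. If the component in g
  \<otimes> A has the same left factor e both times, the nonzero e can be cancelled.\<close>

lemma compare_A: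
  assumes \<chi>: "acts_by \<chi> \<phi> \<psi>" and "e \<in> g" "e \<noteq> 0" "c \<in> A" "c' \<in> A" and pr: "prA (br p q) = gA e c"
  shows "prA (br (\<chi> p) q) = gA e c' \<Longrightarrow> \<phi> c = c'" "prA (br p (\<chi> q)) = gA e c' \<Longrightarrow> \<phi> c = c'"
proof -
  note d = acts_byD[OF \<chi>]
  have *: "prA (\<chi> (br p q)) = gA e (\<phi> c)" using centroid_pr(1)[OF d(1), of "br p q"] pr d(3)[OF assms(2,4)] by simp
  show "\<phi> c = c'" if "prA (br (\<chi> p) q) = gA e c'"
    using * that centroid_br(1)[OF d(1), of p q] by (intro gA_cancel[OF assms(2,3) d(2)[OF assms(4)] assms(5)]) simp
  show "\<phi> c = c'" if "prA (br p (\<chi> q)) = gA e c'"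
    using * that centroid_br(2)[OF d(1), of p q] by (intro gA_cancel[OF assms(2,3) d(2)[OF assms(4)] assms(5)]) simp
qed

lemma compare_B:
  assumes \<chi>: "acts_by \<chi> \<phi> \<psi>" and "e \<noteq> 0" "c \<in> B" "c' \<in> B" and pr: "prB (br p q) = WB e c"
  shows "prB (br (\<chi> p) q) = WB e c' \<Longrightarrow> \<psi> c = c'" "prB (br p (\<chi> q)) = WB e c' \<Longrightarrow> \<psi> c = c'"
proof -
  note d = acts_byD[OF \<chi>]
  have *: "prB (\<chi> (br p q)) = WB e (\<psi> c)" using centroid_pr(2)[OF d(1), of "br p q"] pr d(5)[OF assms(3)] by simp
  show "\<psi> c = c'" if "prB (br (\<chi> p) q) = WB e c'"
    using * that centroid_br(1)[OF d(1), of p q] by (intro WB_cancel[OF assms(2) d(4)[OF assms(3)] assms(4)]) simp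
  show "\<psi> c = c'" if "prB (br p (\<chi> q)) = WB e c'"
    using * that centroid_br(2)[OF d(1), of p q] by (intro WB_cancel[OF assms(2) d(4)[OF assms(3)] assms(4)]) simp
qed

lemma act_nonzero:
  assumes "\<not> simply_laced T"
  shows "\<exists>x\<in>g. \<exists>u. act x u \<noteq> 0"
  using irreducible_module.act_nontrivial[OF W_irreducible_module[OF assms]] by blast

lemma multiplierI:
  assumes "z \<in> A" "\<And>a. a \<in> A \<Longrightarrow> mu z a \<in> A" "\<And>b. b \<in> B \<Longrightarrow> mu z b \<in> B"
    and "\<And>a. a \<in> A \<Longrightarrow> mu a z = mu z a" "\<And>b. b \<in> B \<Longrightarrow> mu b z = mu z b"
    and "\<And>a a'. \<lbrakk>a \<in> A; a' \<in> A\<rbrakk> \<Longrightarrow> mu (mu z a) a' = mu z (mu a a') \<and> mu a (mu z a') = mu z (mu a a')"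
    and "\<And>a b. \<lbrakk>a \<in> A; b \<in> B\<rbrakk> \<Longrightarrow> mu (mu z a) b = mu z (mu a b) \<and> mu a (mu z b) = mu z (mu a b)"
    and "\<And>a b. \<lbrakk>a \<in> A; b \<in> B\<rbrakk> \<Longrightarrow> mu (mu z b) a = mu z (mu b a) \<and> mu b (mu z a) = mu z (mu b a)"
    and "\<And>b b'. \<lbrakk>b \<in> B; b' \<in> B\<rbrakk> \<Longrightarrow> mu (mu z b) b' = mu z (mu b b') \<and> mu b (mu z b') = mu z (mu b b')"
  shows "\<aa>.multiplier z"
  unfolding \<aa>.multiplier_def Un_iff using assms by blast

text \<open>Moving \<chi> onto either factor gives
  \<open>\<phi> (a a') = \<phi> a a' = a \<phi> a'\<close>; setting one argument to
  \<open>one\<close> turns \<phi> into multiplication by \<open>\<phi> one\<close> from either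
  side.\<close>

lemma products_A:
  assumes \<chi>: "acts_by \<chi> \<phi> \<psi>" and cl: "\<forall>a\<in>A. \<forall>a'\<in>A. mu a a' \<in> A"
    and xy: "x \<in> g" "y \<in> g" "br x y \<noteq> 0"
    and prs: "\<forall>a\<in>A. \<forall>a'\<in>A. prA (br (gA x a) (gA y a')) = gA (br x y) (mu a a')"
    and a: "a \<in> A" "a' \<in> A"
  shows "\<phi> a = mu (\<phi> one) a" "mu a (\<phi> one) = mu (\<phi> one) a"
    "mu (\<phi> a) a' = \<phi> (mu a a')" "mu a (\<phi> a') = \<phi> (mu a a')"
proof -
  note d = acts_byD[OF \<chi>]
  have closed: "mu a a' \<in> A" and pr: "prA (br (gA x a) (gA y a')) = gA (br x y) (mu a a')"
    if "a \<in> A" "a' \<in> A" for a a'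
    using cl prs that by blast+
  have l: "\<phi> (mu a a') = mu (\<phi> a) a'" and r: "\<phi> (mu a a') = mu a (\<phi> a')" if "a \<in> A" "a' \<in> A" for a a'
  proof -
    note cmp = compare_A[OF \<chi> g_br[OF xy(1,2)] xy(3) closed[OF that] _ pr[OF that]]
    show "\<phi> (mu a a') = mu (\<phi> a) a'" by (rule cmp(1)) (use that xy d pr closed in simp_all)
    show "\<phi> (mu a a') = mu a (\<phi> a')" by (rule cmp(2)) (use that xy d pr closed in simp_all)
  qed
  show "\<phi> a = mu (\<phi> one) a" using l[OF \<aa>.one_in_A a(1)] by (simp add: \<aa>.unit)
  moreover have "\<phi> a = mu a (\<phi> one)" using r[OF a(1) \<aa>.one_in_A] by (simp add: \<aa>.unit)
  ultimately show "mu a (\<phi> one) = mu (\<phi> one) a" by simp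
  show "mu (\<phi> a) a' = \<phi> (mu a a')" "mu a (\<phi> a') = \<phi> (mu a a')" using l r a by simp_all
qed

text \<open>Products A A are seen through the bracket of g, products A B through the action on W.
  The product b b' is seen in two pieces: its A-part through \<open>der\<close>, its B-part through
  \<open>star\<close>.\<close>

lemma multiplier_general:
  assumes \<chi>: "acts_by \<chi> \<phi> \<psi>" and bg: brackets_general
    and T: "simply_laced T \<or> T = TypeF4 \<or> T = TypeG2 \<or> (\<exists>r. T = TypeB r)"
  shows "\<aa>.multiplier (\<phi> one) \<and> (\<forall>a\<in>A. \<phi> a = mu (\<phi> one) a) \<and> (\<forall>b\<in>B. \<psi> b = mu (\<phi> one) b)"
proof -
  note d = acts_byD[OF \<chi>]
  have AA: "\<And>a a'. \<lbrakk>a \<in> A; a' \<in> A\<rbrakk> \<Longrightarrow> mu a a' \<in> A" and AB: "\<And>a b. \<lbrakk>a \<in> A; b \<in> B\<rbrakk> \<Longrightarrow> mu a b \<in> B"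
    and BA: "\<And>a b. \<lbrakk>a \<in> A; b \<in> B\<rbrakk> \<Longrightarrow> mu b a = mu a b"
    using brackets_generalD(1)[OF bg] unfolding \<aa>.product_respects_parts_def by blast+
  let ?z = "\<phi> one"
  have z: "?z \<in> A" using d(2) \<aa>.one_in_A .
  obtain x y where xy: "x \<in> g" "y \<in> g" "br x y \<noteq> 0" using not_abelian by blast
  have "\<forall>a\<in>A. \<forall>a'\<in>A. prA (br (gA x a) (gA y a')) = gA (br x y) (mu a a')"
    using xy brackets_generalD(2)[OF bg] AA g_br by (simp add: pr_simps)
  then have A: "\<phi> a = mu ?z a" "mu a ?z = mu ?z a" "mu (\<phi> a) a' = \<phi> (mu a a')" "mu a (\<phi> a') = \<phi> (mu a a')"
    if "a \<in> A" "a' \<in> A" for a a'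
    using products_A[OF \<chi> _ xy _ that] AA by blast+
  have B: "mu (\<phi> a) b = \<psi> (mu a b) \<and> mu a (\<psi> b) = \<psi> (mu a b)" if ab: "a \<in> A" "b \<in> B" for a b
  proof (cases "simply_laced T")
    case True
    then have B0: "B = {0}" by (rule simply_laced_trivial(1))
    then show ?thesis using d(4)[of 0] that by (simp add: \<aa>.mu_zero_right)
  next
    case False
    then obtain x u where xu: "x \<in> g" "act x u \<noteq> 0" using act_nonzero by blast
    have pr: "prB (br (gA x a) (WB u b)) = WB (act x u) (mu a b)" if "a \<in> A" "b \<in> B" for a b
      using that xu brackets_generalD(3)[OF bg] AB by (simp add: pr_simps)
    note cmp = compare_B[OF \<chi> xu(2) AB[OF ab] _ pr[OF ab]]
    have "\<psi> (mu a b) = mu (\<phi> a) b" by (rule cmp(1)) (use ab xu d pr AB in simp_all)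
    moreover have "\<psi> (mu a b) = mu a (\<psi> b)" by (rule cmp(2)) (use ab xu d pr AB in simp_all)
    ultimately show ?thesis by simp
  qed
  have \<psi>: "\<psi> b = mu ?z b" if "b \<in> B" for b using B[OF \<aa>.one_in_A that] by (simp add: \<aa>.unit)
  have BB: "mu (\<psi> b) b' = mu ?z (mu b b') \<and> mu b (\<psi> b') = mu ?z (mu b b')" if b: "b \<in> B" "b' \<in> B" for b b'
  proof (cases "simply_laced T")
    case True
    then have B0: "B = {0}" by (rule simply_laced_trivial(1))
    then show ?thesis using d(4)[of 0] b by (simp add: \<aa>.mu_zero_right \<aa>.mu_zero_left)
  next
    case False
    obtain der star where W: "\<And>u v. der u v \<in> g" "\<exists>u v. der u v \<noteq> 0"
      "T = TypeF4 \<or> T = TypeG2 \<Longrightarrow> \<exists>u v. star u v \<noteq> 0"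
      "\<And>u v b b'. \<lbrakk>b \<in> B; b' \<in> B\<rbrakk> \<Longrightarrow> br (WB u b) (WB v b') =
        gA (der u v) (\<aa>.A_part (mu b b')) + WB (star u v) (\<aa>.B_part (mu b b')) + sL (wf u v) (ang b b')"
      by (rule brackets_general_W[OF bg]) (use False in blast)
    have prA': "prA (br (WB u b) (WB v b')) = gA (der u v) (\<aa>.A_part (mu b b'))"
      and prB': "prB (br (WB u b) (WB v b')) = WB (star u v) (\<aa>.B_part (mu b b'))" if "b \<in> B" "b' \<in> B" for u v b b'
      using that W(1,4) \<aa>.parts_mem by (simp_all add: pr_simps)
    obtain u v where uv: "der u v \<noteq> 0" using W(2) by blast
    note cmp = compare_A[OF \<chi> W(1) uv \<aa>.parts_mem(1) \<aa>.parts_mem(1) prA'[OF b]]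
    have "\<phi> (\<aa>.A_part (mu b b')) = \<aa>.A_part (mu (\<psi> b) b')"
      by (rule cmp(1)) (use b d prA' in simp)
    moreover have "\<phi> (\<aa>.A_part (mu b b')) = \<aa>.A_part (mu b (\<psi> b'))"
      by (rule cmp(2)) (use b d prA' in simp)
    \<comment> \<open>The B-part is visible only where \<open>star\<close> is nonzero, which is
      known for F4 and G2. In type B it is zero, for the shifted products as well.\<close>
    moreover have "mu ?z (\<aa>.B_part (mu b b')) = \<aa>.B_part (mu (\<psi> b) b') \<and>
      mu ?z (\<aa>.B_part (mu b b')) = \<aa>.B_part (mu b (\<psi> b'))"
    proof (cases "T = TypeF4 \<or> T = TypeG2")
      case True
      then obtain u v where uv: "star u v \<noteq> 0" using W(3) by blast
      note cmp = compare_B[OF \<chi> uv \<aa>.parts_mem(2) \<aa>.parts_mem(2) prB'[OF b]]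
      have "\<psi> (\<aa>.B_part (mu b b')) = \<aa>.B_part (mu (\<psi> b) b')"
        by (rule cmp(1)) (use b d prB' in simp)
      moreover have "\<psi> (\<aa>.B_part (mu b b')) = \<aa>.B_part (mu b (\<psi> b'))"
        by (rule cmp(2)) (use b d prB' in simp)
      ultimately show ?thesis using \<psi> \<aa>.parts_mem by simp
    next
      case False
      then obtain r where "T = TypeB r" using T \<open>\<not> simply_laced T\<close> by blast
      then have "\<forall>b\<in>B. \<forall>b'\<in>B. mu b b' \<in> A"
        using coordinates by (simp add: \<aa>.coordinate_algebra_of_type_def)
      then have "\<aa>.B_part (mu b b') = 0" if "b \<in> B" "b' \<in> B" for b b'
        using \<aa>.parts_eq(2)[of "mu b b'" 0] \<aa>.subspace_0[OF \<aa>.subspace_B] that by simp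
      then show ?thesis using b d(4) by (simp add: \<aa>.mu_zero_right)
    qed
    moreover have "\<phi> (\<aa>.A_part (mu b b')) = mu ?z (\<aa>.A_part (mu b b'))"
      using A(1)[OF \<aa>.parts_mem(1) \<aa>.one_in_A] .
    moreover have "mu ?z (mu b b') = mu ?z (\<aa>.A_part (mu b b')) + mu ?z (\<aa>.B_part (mu b b'))"
      using \<aa>.parts_sum[of "mu b b'"] \<aa>.mu_plus_right by metis
    ultimately show ?thesis using \<aa>.parts_sum by metis
  qed
  have \<phi>: "\<phi> a = mu ?z a" if "a \<in> A" for a using A(1)[OF that \<aa>.one_in_A] .
  have "\<aa>.multiplier ?z"
  proof (rule multiplierI[OF z])
    fix a assume a: "a \<in> A"
    show "mu ?z a \<in> A" using AA z a .
    show "mu a ?z = mu ?z a" using A(2)[OF a \<aa>.one_in_A] .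
    fix a' assume a': "a' \<in> A"
    show "mu (mu ?z a) a' = mu ?z (mu a a') \<and> mu a (mu ?z a') = mu ?z (mu a a')"
      using A(3,4)[OF a a'] \<phi> a a' AA by simp
  next
    fix b assume b: "b \<in> B"
    show "mu ?z b \<in> B" using AB z b .
    show "mu b ?z = mu ?z b" using BA z b .
    fix b' assume "b' \<in> B"
    then show "mu (mu ?z b) b' = mu ?z (mu b b') \<and> mu b (mu ?z b') = mu ?z (mu b b')"
      using BB[OF b] \<psi> b by simp
  next
    fix a b assume ab: "a \<in> A" "b \<in> B"
    show 1: "mu (mu ?z a) b = mu ?z (mu a b) \<and> mu a (mu ?z b) = mu ?z (mu a b)"
      using B[OF ab] \<phi> \<psi> ab AB by simp
    show "mu (mu ?z b) a = mu ?z (mu b a) \<and> mu b (mu ?z a) = mu ?z (mu b a)"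
      using 1 BA[OF ab] BA[OF ab(1) AB[OF z ab(2)]] BA[OF AA[OF z ab(1)] ab(2)] by simp
  qed
  then show ?thesis using \<phi> \<psi> by blast
qed

text \<open>At the special pair x, y the symmetric and the skew term have the same left factor
  \<open>br x y\<close> and merge into the product a a', so \<open>products_A\<close>
  applies.\<close>

lemma multiplier_A:
  assumes \<chi>: "acts_by \<chi> \<phi> \<psi>" and A: "2 \<le> r" "T = TypeA r" "brackets_A r"
  shows "\<aa>.multiplier (\<phi> one) \<and> (\<forall>a\<in>A. \<phi> a = mu (\<phi> one) a) \<and> (\<forall>b\<in>B. \<psi> b = mu (\<phi> one) b)"
proof -
  have sl: "simply_laced T" using A by simp
  note AU = A_UNIV[OF sl]
  have B0: "B = {0}" by (rule simply_laced_trivial(1)[OF sl])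
  note d = acts_byD[OF \<chi>]
  obtain c where c: "\<And>x y. \<lbrakk>x \<in> g; y \<in> g\<rbrakk> \<Longrightarrow> c x y \<in> g"
    "\<And>x y a a'. \<lbrakk>x \<in> g; y \<in> g; a \<in> A; a' \<in> A\<rbrakk> \<Longrightarrow> br (gA x a) (gA y a') =
      gA (br x y) (\<aa>.sym a a') + gA (c x y) (\<aa>.skew a a') + sL (killing x y) (ang a a')"
    "\<exists>x\<in>g. \<exists>y\<in>g. c x y = br x y \<and> br x y \<noteq> 0"
    by (rule brackets_A_form[OF A(3,1)]) blast
  obtain x y where xy: "x \<in> g" "y \<in> g" "br x y \<noteq> 0" "c x y = br x y" using c(3) by blast
  have "prA (br (gA x a) (gA y a')) = gA (br x y) (mu a a')" for a a'
  proof -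
    have "prA (br (gA x a) (gA y a')) = gA (br x y) (\<aa>.sym a a') + gA (br x y) (\<aa>.skew a a')"
      using c(2)[OF xy(1,2) AU AU] xy g_br AU by (simp add: pr_simps)
    also have "\<dots> = gA (br x y) (\<aa>.sym a a' + \<aa>.skew a a')"
      using gT.tens_add_right[OF g_br[OF xy(1,2)] AU AU] by simp
    also have "\<aa>.sym a a' + \<aa>.skew a a' = mu a a'" by (rule sym_plus_skew)
    finally show ?thesis .
  qed
  then have P: "\<phi> a = mu (\<phi> one) a" "mu a (\<phi> one) = mu (\<phi> one) a" "mu (\<phi> a) a' = \<phi> (mu a a')"
    "mu a (\<phi> a') = \<phi> (mu a a')" for a a'
    using products_A[OF \<chi> _ xy(1-3) _ AU AU] AU by blast+
  have "mu (mu (\<phi> one) \<alpha>) \<beta> = mu (\<phi> one) (mu \<alpha> \<beta>)" "mu \<alpha> (mu (\<phi> one) \<beta>) = mu (\<phi> one) (mu \<alpha> \<beta>)" for \<alpha> \<beta>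
    using P(1,3,4) by metis+
  then have "\<aa>.multiplier (\<phi> one)"
    using P(2) AU B0 by (intro multiplierI) (auto simp: \<aa>.mu_zero_right \<aa>.mu_zero_left)
  moreover have "\<psi> b = mu (\<phi> one) b" if "b \<in> B" for b
    using d(4)[of 0] B0 that by (simp add: \<aa>.mu_zero_right)
  moreover note P(1)
  ultimately show ?thesis by blast
qed

text \<open>Symmetric and skew halves of a product lie in different summands, and \<phi> acts on one
  and \<psi> on the other. They are compared separately, one nonzero coefficient map for each, and
  put together at the end by \<open>sym_plus_skew\<close>.\<close>

lemma multiplier_C:
  assumes \<chi>: "acts_by \<chi> \<phi> \<psi>" and C: "2 \<le> r" "T = TypeC r" "brackets_C r"
  shows "\<aa>.multiplier (\<phi> one) \<and> (\<forall>a\<in>A. \<phi> a = mu (\<phi> one) a) \<and> (\<forall>b\<in>B. \<psi> b = mu (\<phi> one) b)"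
proof -
  have sl: "\<not> simply_laced T" using C by simp
  note d = acts_byD[OF \<chi>] and inv = \<aa>.involution_parts[OF C_involution[OF C(2)]]
  let ?z = "\<phi> one"
  have z: "?z \<in> A" using d(2) \<aa>.one_in_A .
  obtain c e dd s where f: "\<And>x u. x \<in> g \<Longrightarrow> e x u \<in> g" "\<And>u v. dd u v \<in> g"
    "\<And>x y a a'. \<lbrakk>x \<in> g; y \<in> g; a \<in> A; a' \<in> A\<rbrakk> \<Longrightarrow> br (gA x a) (gA y a') =
      gA (br x y) (\<aa>.sym a a') + WB (c x y) (\<aa>.skew a a') + sL (killing x y) (ang a a')"
    "\<And>x u a b. \<lbrakk>x \<in> g; a \<in> A; b \<in> B\<rbrakk> \<Longrightarrow> br (gA x a) (WB u b) =
      gA (e x u) (\<aa>.skew a b) + WB (act x u) (\<aa>.sym a b)"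
    "\<And>u v b b'. \<lbrakk>b \<in> B; b' \<in> B\<rbrakk> \<Longrightarrow> br (WB u b) (WB v b') =
      gA (dd u v) (\<aa>.sym b b') + WB (s u v) (\<aa>.skew b b') + sL (wf u v) (ang b b')"
    and nz: "\<exists>x\<in>g. \<exists>y\<in>g. c x y \<noteq> 0" "\<exists>x\<in>g. \<exists>u. e x u \<noteq> 0" "\<exists>u v. dd u v \<noteq> 0"
      "3 \<le> r \<Longrightarrow> \<exists>u v. s u v \<noteq> 0"
    by (rule brackets_C_form[OF C(3,1)]) blast
  have prAA: "prA (br (gA x a) (gA y a')) = gA (br x y) (\<aa>.sym a a')"
    "prB (br (gA x a) (gA y a')) = WB (c x y) (\<aa>.skew a a')" if "x \<in> g" "y \<in> g" "a \<in> A" "a' \<in> A" for x y a a'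
    using that f(3) inv(1,2) g_br by (simp_all add: pr_simps)
  have prAB: "prA (br (gA x a) (WB u b)) = gA (e x u) (\<aa>.skew a b)"
    "prB (br (gA x a) (WB u b)) = WB (act x u) (\<aa>.sym a b)" if "x \<in> g" "a \<in> A" "b \<in> B" for x u a b
    using that f(1,4) inv(3,4) by (simp_all add: pr_simps)
  have prBB: "prA (br (WB u b) (WB v b')) = gA (dd u v) (\<aa>.sym b b')"
    "prB (br (WB u b) (WB v b')) = WB (s u v) (\<aa>.skew b b')" if "b \<in> B" "b' \<in> B" for u v b b'
    using that f(2,5) inv(5,6) by (simp_all add: pr_simps)
  have symAA: "\<aa>.sym (\<phi> a) a' = \<phi> (\<aa>.sym a a')" "\<aa>.sym a (\<phi> a') = \<phi> (\<aa>.sym a a')" if a: "a \<in> A" "a' \<in> A" for a a'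
  proof -
    obtain x y where xy: "x \<in> g" "y \<in> g" "br x y \<noteq> 0" using not_abelian by blast
    note cmp = compare_A[OF \<chi> g_br[OF xy(1,2)] xy(3) inv(1)[OF a] _ prAA(1)[OF xy(1,2) a]]
    show "\<aa>.sym (\<phi> a) a' = \<phi> (\<aa>.sym a a')" by (rule cmp(1)[symmetric]) (use a xy d prAA(1) inv(1) in simp_all)
    show "\<aa>.sym a (\<phi> a') = \<phi> (\<aa>.sym a a')" by (rule cmp(2)[symmetric]) (use a xy d prAA(1) inv(1) in simp_all)
  qed
  have skewAA: "\<aa>.skew (\<phi> a) a' = \<psi> (\<aa>.skew a a')" "\<aa>.skew a (\<phi> a') = \<psi> (\<aa>.skew a a')" if a: "a \<in> A" "a' \<in> A" for a a'
  proof -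
    obtain x y where xy: "x \<in> g" "y \<in> g" "c x y \<noteq> 0" using nz(1) by blast
    note cmp = compare_B[OF \<chi> xy(3) inv(2)[OF a] _ prAA(2)[OF xy(1,2) a]]
    show "\<aa>.skew (\<phi> a) a' = \<psi> (\<aa>.skew a a')" by (rule cmp(1)[symmetric]) (use a xy d prAA(2) inv(2) in simp_all)
    show "\<aa>.skew a (\<phi> a') = \<psi> (\<aa>.skew a a')" by (rule cmp(2)[symmetric]) (use a xy d prAA(2) inv(2) in simp_all)
  qed
  have symAB: "\<aa>.sym (\<phi> a) b = \<psi> (\<aa>.sym a b)" "\<aa>.sym a (\<psi> b) = \<psi> (\<aa>.sym a b)" if a: "a \<in> A" "b \<in> B" for a b
  proof -
    obtain x u where xu: "x \<in> g" "act x u \<noteq> 0" using act_nonzero[OF sl] by blast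
    note cmp = compare_B[OF \<chi> xu(2) inv(3)[OF a] _ prAB(2)[OF xu(1) a]]
    show "\<aa>.sym (\<phi> a) b = \<psi> (\<aa>.sym a b)" by (rule cmp(1)[symmetric]) (use a xu d prAB(2) inv(3) in simp_all)
    show "\<aa>.sym a (\<psi> b) = \<psi> (\<aa>.sym a b)" by (rule cmp(2)[symmetric]) (use a xu d prAB(2) inv(3) in simp_all)
  qed
  have skewAB: "\<aa>.skew (\<phi> a) b = \<phi> (\<aa>.skew a b)" "\<aa>.skew a (\<psi> b) = \<phi> (\<aa>.skew a b)" if a: "a \<in> A" "b \<in> B" for a b
  proof -
    obtain x u where xu: "x \<in> g" "e x u \<noteq> 0" using nz(2) by blast
    note cmp = compare_A[OF \<chi> f(1)[OF xu(1)] xu(2) inv(4)[OF a] _ prAB(1)[OF xu(1) a]]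
    show "\<aa>.skew (\<phi> a) b = \<phi> (\<aa>.skew a b)" by (rule cmp(1)[symmetric]) (use a xu d prAB(1) inv(4) in simp_all)
    show "\<aa>.skew a (\<psi> b) = \<phi> (\<aa>.skew a b)" by (rule cmp(2)[symmetric]) (use a xu d prAB(1) inv(4) in simp_all)
  qed
  have symBB: "\<aa>.sym (\<psi> b) b' = \<phi> (\<aa>.sym b b')" "\<aa>.sym b (\<psi> b') = \<phi> (\<aa>.sym b b')" if a: "b \<in> B" "b' \<in> B" for b b'
  proof -
    obtain u v where uv: "dd u v \<noteq> 0" using nz(3) by blast
    note cmp = compare_A[OF \<chi> f(2) uv inv(5)[OF a] _ prBB(1)[OF a]]
    show "\<aa>.sym (\<psi> b) b' = \<phi> (\<aa>.sym b b')" by (rule cmp(1)[symmetric]) (use a d prBB(1) inv(5) in simp_all)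
    show "\<aa>.sym b (\<psi> b') = \<phi> (\<aa>.sym b b')" by (rule cmp(2)[symmetric]) (use a d prBB(1) inv(5) in simp_all)
  qed
  have skewBB: "\<aa>.skew (\<psi> b) b' = \<psi> (\<aa>.skew b b')" "\<aa>.skew b (\<psi> b') = \<psi> (\<aa>.skew b b')" if r: "3 \<le> r" and a: "b \<in> B" "b' \<in> B" for b b'
  proof -
    obtain u v where uv: "s u v \<noteq> 0" using nz(4)[OF r] by blast
    note cmp = compare_B[OF \<chi> uv inv(6)[OF a] _ prBB(2)[OF a]]
    show "\<aa>.skew (\<psi> b) b' = \<psi> (\<aa>.skew b b')" by (rule cmp(1)[symmetric]) (use a d prBB(2) inv(6) in simp_all)
    show "\<aa>.skew b (\<psi> b') = \<psi> (\<aa>.skew b b')" by (rule cmp(2)[symmetric]) (use a d prBB(2) inv(6) in simp_all)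
  qed
  have sym_one: "\<aa>.sym one \<alpha> = \<alpha>" for \<alpha>
    using sym_plus_skew[of one \<alpha>] \<aa>.skew_one[of \<alpha>] by (simp add: \<aa>.unit)
  have comm: "mu \<alpha> \<beta> = \<aa>.sym \<alpha> \<beta> \<and> mu \<beta> \<alpha> = \<aa>.sym \<alpha> \<beta>" if "\<aa>.skew \<alpha> \<beta> = 0" for \<alpha> \<beta>
    using sym_plus_skew[of \<alpha> \<beta>] sym_minus_skew[of \<alpha> \<beta>] that by simp
  have \<phi>: "\<phi> a = mu ?z a" "mu a ?z = mu ?z a" if a: "a \<in> A" for a
  proof -
    \<comment> \<open>\<open>skew ?z a\<close> and \<open>skew one (\<phi> a)\<close> are both equal
      to \<open>\<psi> (skew one a)\<close>, and a commutator with the unit vanishes; so z commutes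
      with a.\<close>
    have "\<aa>.skew ?z a = 0" using skewAA[OF \<aa>.one_in_A a] by (metis \<aa>.skew_one)
    then show "\<phi> a = mu ?z a" "mu a ?z = mu ?z a"
      using symAA(1)[OF \<aa>.one_in_A a] comm[of ?z a] by (simp_all add: sym_one)
  qed
  have \<psi>: "\<psi> b = mu ?z b" "mu b ?z = mu ?z b" if b: "b \<in> B" for b
  proof -
    have "\<aa>.skew ?z b = 0" using skewAB[OF \<aa>.one_in_A b] by (metis \<aa>.skew_one)
    then show "\<psi> b = mu ?z b" "mu b ?z = mu ?z b"
      using symAB(1)[OF \<aa>.one_in_A b] comm[of ?z b] by (simp_all add: sym_one)
  qed
  have comm_all: "mu \<alpha> ?z = mu ?z \<alpha>" for \<alpha>
  proof -
    obtain a b where "a \<in> A" "b \<in> B" "\<alpha> = a + b" by (rule \<aa>.decompose)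
    then show ?thesis using \<phi> \<psi> by (simp add: \<aa>.mu_plus_left \<aa>.mu_plus_right)
  qed
  have zmu: "mu ?z (mu \<alpha> \<beta>) = mu ?z (\<aa>.sym \<alpha> \<beta>) + mu ?z (\<aa>.skew \<alpha> \<beta>)"
    "mu ?z (mu \<beta> \<alpha>) = mu ?z (\<aa>.sym \<alpha> \<beta>) - mu ?z (\<aa>.skew \<alpha> \<beta>)" for \<alpha> \<beta>
    using arg_cong[OF sym_plus_skew[of \<alpha> \<beta>], of "mu ?z"] arg_cong[OF sym_minus_skew[of \<alpha> \<beta>], of "mu ?z"]
    by (simp_all add: \<aa>.mu_plus_right \<aa>.mu_diff_right)
  have "\<aa>.multiplier ?z"
  proof (rule multiplierI[OF z])
    fix a assume a: "a \<in> A"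
    show "mu ?z a \<in> A" using \<phi>[OF a] d(2)[OF a] by simp
    show "mu a ?z = mu ?z a" by (rule comm_all)
    fix a' assume a': "a' \<in> A"
    have "mu ?z (\<aa>.sym a a') = \<aa>.sym (mu ?z a) a'" "mu ?z (\<aa>.sym a a') = \<aa>.sym a (mu ?z a')"
      "mu ?z (\<aa>.skew a a') = \<aa>.skew (mu ?z a) a'" "mu ?z (\<aa>.skew a a') = \<aa>.skew a (mu ?z a')"
      using symAA[OF a a'] skewAA[OF a a'] \<phi>[OF a] \<phi>[OF a'] \<phi>[OF inv(1)[OF a a']] \<psi>[OF inv(2)[OF a a']] by simp_all
    then show "mu (mu ?z a) a' = mu ?z (mu a a') \<and> mu a (mu ?z a') = mu ?z (mu a a')"
      using zmu(1)[of a a'] sym_plus_skew by metis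
  next
    fix b assume b: "b \<in> B"
    show "mu ?z b \<in> B" using \<psi>[OF b] d(4)[OF b] by simp
    show "mu b ?z = mu ?z b" by (rule comm_all)
    fix b' assume b': "b' \<in> B"
    have S: "mu ?z (\<aa>.sym b b') = \<aa>.sym (mu ?z b) b'" "mu ?z (\<aa>.sym b b') = \<aa>.sym b (mu ?z b')"
      using symBB[OF b b'] \<psi>[OF b] \<psi>[OF b'] \<phi>[OF inv(5)[OF b b']] by simp_all
    \<comment> \<open>The skew half of b b' is visible in the bracket only from r = 3 on. For r = 2
      either commuting with everything already makes z central, by alternativity, or the skew half
      is zero on B.\<close>
    consider "alternative_alg mu" | "3 \<le> r" | "\<forall>b\<in>B. \<forall>b'\<in>B. mu b b' = mu b' b"
      using coordinates C(1,2) by (auto simp: \<aa>.coordinate_algebra_of_type_def split: if_splits)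
    then show "mu (mu ?z b) b' = mu ?z (mu b b') \<and> mu b (mu ?z b') = mu ?z (mu b b')"
    proof cases
      case 1
      then show ?thesis using \<aa>.alternative_commuting_central[OF 1 comm_all] by simp
    next
      case 2
      have "mu ?z (\<aa>.skew b b') = \<aa>.skew (mu ?z b) b'" "mu ?z (\<aa>.skew b b') = \<aa>.skew b (mu ?z b')"
        using skewBB[OF 2 b b'] \<psi>[OF b] \<psi>[OF b'] \<psi>[OF inv(6)[OF b b']] by simp_all
      then show ?thesis using S zmu(1)[of b b'] sym_plus_skew by metis
    next
      case 3
      then have "\<aa>.skew b b' = 0" if "b \<in> B" "b' \<in> B" for b b' using that by (simp add: \<aa>.skew_def)
      moreover have "mu ?z b \<in> B" "mu ?z b' \<in> B" using \<psi> d(4) b b' by metis+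
      ultimately have "\<aa>.skew b b' = 0" "\<aa>.skew (mu ?z b) b' = 0" "\<aa>.skew b (mu ?z b') = 0" using b b' by auto
      then show ?thesis using S comm by metis
    qed
  next
    fix a b assume ab: "a \<in> A" "b \<in> B"
    have e: "mu ?z (\<aa>.sym a b) = \<aa>.sym (mu ?z a) b" "mu ?z (\<aa>.sym a b) = \<aa>.sym a (mu ?z b)"
      "mu ?z (\<aa>.skew a b) = \<aa>.skew (mu ?z a) b" "mu ?z (\<aa>.skew a b) = \<aa>.skew a (mu ?z b)"
      using symAB[OF ab] skewAB[OF ab] \<phi>[OF ab(1)] \<psi>[OF ab(2)] \<psi>[OF inv(3)[OF ab]] \<phi>[OF inv(4)[OF ab]] by simp_all
    then show "mu (mu ?z a) b = mu ?z (mu a b) \<and> mu a (mu ?z b) = mu ?z (mu a b)"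
      using zmu(1)[of a b] sym_plus_skew by metis
    show "mu (mu ?z b) a = mu ?z (mu b a) \<and> mu b (mu ?z a) = mu ?z (mu b a)"
      using e zmu(2)[of b a] sym_minus_skew by metis
  qed
  then show ?thesis using \<phi> \<psi> by blast
qed

end

section \<open>The isomorphism\<close>

context root_graded_lie_algebra
begin

abbreviation scalars where "scalars \<equiv> centroid_scalars mu A ang"
abbreviation multiplies where "multiplies \<equiv> multiplies_by g A B mu gA WB ang"

lemma ang_split:
  assumes "a \<in> A" "b \<in> B" "a' \<in> A" "b' \<in> B"
  shows "ang (a + b) (a' + b') = ang a a' + ang b b'"
  using assms ang_mixed by (simp add: ang_add_left ang_add_right)

lemma ang_zero_left: "ang 0 \<beta> = 0" and ang_zero_right: "ang \<alpha> 0 = 0"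
  using ang_scale_left[of 0 0 \<beta>] ang_scale_right[of \<alpha> 0 0] by simp_all

text \<open>The value on D comes from D-components: \<chi> moved onto either factor of a bracket
  with \<open>killing x y \<noteq> 0\<close>, or \<open>wf u v \<noteq> 0\<close>, gives both
  formulas for \<open>\<chi> (ang \<alpha> \<beta>)\<close>. Their agreement is condition (a);
  condition (b) is linearity of \<chi> applied to a vanishing sum.\<close>

lemma centroid_is_multiplication:
  assumes \<chi>: "\<chi> \<in> centroid sL br"
  shows "\<exists>z\<in>scalars. multiplies z \<chi>"
proof -
  obtain \<phi> \<psi> where "\<And>a. a \<in> A \<Longrightarrow> \<phi> a \<in> A" "\<And>x a. \<lbrakk>x \<in> g; a \<in> A\<rbrakk> \<Longrightarrow> \<chi> (gA x a) = gA x (\<phi> a)"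
    "\<And>b. b \<in> B \<Longrightarrow> \<psi> b \<in> B" "\<And>w b. b \<in> B \<Longrightarrow> \<chi> (WB w b) = WB w (\<psi> b)"
    "\<And>d. d \<in> D \<Longrightarrow> \<chi> d \<in> D"
    by (rule centroid_forms[OF \<chi>]) (rule that)
  then have ab: "acts_by \<chi> \<phi> \<psi>" unfolding acts_by_def using \<chi> by blast
  define z where "z = \<phi> one"
  have "\<aa>.multiplier z \<and> (\<forall>a\<in>A. \<phi> a = mu z a) \<and> (\<forall>b\<in>B. \<psi> b = mu z b)"
    unfolding z_def
    by (cases rule: type_cases)
      (use multiplier_general[OF ab] multiplier_A[OF ab] multiplier_C[OF ab] in blast)+
  then have mult: "\<aa>.multiplier z" and \<phi>: "\<And>a. a \<in> A \<Longrightarrow> \<phi> a = mu z a" and \<psi>: "\<And>b. b \<in> B \<Longrightarrow> \<psi> b = mu z b"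
    by blast+
  have zA: "mu z a \<in> A" if "a \<in> A" for a using mult that unfolding \<aa>.multiplier_def by blast
  have zB: "mu z b \<in> B" if "b \<in> B" for b using mult that unfolding \<aa>.multiplier_def by blast
  have gA: "\<chi> (gA x a) = gA x (mu z a)" if "x \<in> g" "a \<in> A" for x a
    using acts_byD(3)[OF ab that] \<phi> that by simp
  have WB: "\<chi> (WB w b) = WB w (mu z b)" if "b \<in> B" for w b
    using acts_byD(5)[OF ab that] \<psi> that by simp
  interpret l: Vector_Spaces.linear sL sL \<chi> using \<chi> by (simp add: centroid_def)
  have AA: "\<chi> (ang a a') = ang (mu z a) a'" "\<chi> (ang a a') = ang a (mu z a')" if a: "a \<in> A" "a' \<in> A" for a a'
  proof -
    obtain x y where xy: "x \<in> g" "y \<in> g" "killing x y \<noteq> 0" using killing_nonzero by blast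
    have "sL (killing x y) (\<chi> (ang a a')) = prD (\<chi> (br (gA x a) (gA y a')))"
      unfolding centroid_pr(3)[OF \<chi>] prD_gA_gA[OF xy(1,2) a] by (simp add: l.scale)
    moreover have "prD (\<chi> (br (gA x a) (gA y a'))) = sL (killing x y) (ang (mu z a) a')"
      unfolding centroid_br(1)[OF \<chi>] gA[OF xy(1) a(1)] by (rule prD_gA_gA[OF xy(1,2) zA[OF a(1)] a(2)])
    moreover have "prD (\<chi> (br (gA x a) (gA y a'))) = sL (killing x y) (ang a (mu z a'))"
      unfolding centroid_br(2)[OF \<chi>] gA[OF xy(2) a(2)] by (rule prD_gA_gA[OF xy(1,2) a(1) zA[OF a(2)]])
    ultimately show "\<chi> (ang a a') = ang (mu z a) a'" "\<chi> (ang a a') = ang a (mu z a')"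
      using xy(3) scale_cancel_left by metis+
  qed
  have BB: "\<chi> (ang b b') = ang (mu z b) b' \<and> \<chi> (ang b b') = ang b (mu z b')" if b: "b \<in> B" "b' \<in> B" for b b'
  proof (cases "simply_laced T")
    case True
    then have "b = 0" "b' = 0" using simply_laced_trivial(1) b by auto
    then show ?thesis by (simp add: ang_zero_left ang_zero_right l.zero)
  next
    case False
    obtain u v where uv: "wf u v \<noteq> 0" using W_form_nonzero[OF False] by blast
    have "sL (wf u v) (\<chi> (ang b b')) = prD (\<chi> (br (WB u b) (WB v b')))"
      unfolding centroid_pr(3)[OF \<chi>] prD_WB_WB[OF False b] by (simp add: l.scale)
    moreover have "prD (\<chi> (br (WB u b) (WB v b'))) = sL (wf u v) (ang (mu z b) b')"
      unfolding centroid_br(1)[OF \<chi>] WB[OF b(1)] by (rule prD_WB_WB[OF False zB[OF b(1)] b(2)])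
    moreover have "prD (\<chi> (br (WB u b) (WB v b'))) = sL (wf u v) (ang b (mu z b'))"
      unfolding centroid_br(2)[OF \<chi>] WB[OF b(2)] by (rule prD_WB_WB[OF False b(1) zB[OF b(2)]])
    ultimately show ?thesis using uv scale_cancel_left by metis
  qed
  have ang: "\<chi> (ang \<alpha> \<beta>) = ang (mu z \<alpha>) \<beta>" "\<chi> (ang \<alpha> \<beta>) = ang \<alpha> (mu z \<beta>)" for \<alpha> \<beta>
  proof -
    obtain a b where ab: "a \<in> A" "b \<in> B" "\<alpha> = a + b" by (rule \<aa>.decompose)
    obtain a' b' where ab': "a' \<in> A" "b' \<in> B" "\<beta> = a' + b'" by (rule \<aa>.decompose)
    have "\<chi> (ang \<alpha> \<beta>) = \<chi> (ang a a') + \<chi> (ang b b')"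
      unfolding ab(3) ab'(3) ang_split[OF ab(1,2) ab'(1,2)] by (rule l.add)
    moreover have "ang (mu z \<alpha>) \<beta> = ang (mu z a) a' + ang (mu z b) b'"
      "ang \<alpha> (mu z \<beta>) = ang a (mu z a') + ang b (mu z b')"
      unfolding ab(3) ab'(3) \<aa>.mu_plus_right using ang_split ab(1,2) ab'(1,2) zA zB by simp_all
    ultimately show "\<chi> (ang \<alpha> \<beta>) = ang (mu z \<alpha>) \<beta>" "\<chi> (ang \<alpha> \<beta>) = ang \<alpha> (mu z \<beta>)"
      using AA[OF ab(1) ab'(1)] BB[OF ab(2) ab'(2)] by metis+
  qed
  have "z \<in> scalars"
    unfolding centroid_scalars_def
  proof (intro CollectI IntI conjI allI impI)
    show "z \<in> algebra_centre mu" using \<aa>.multiplier_centre[OF mult] .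
    show "z \<in> A" using mult by (simp add: \<aa>.multiplier_def)
    show "ang (mu z \<alpha>) \<beta> = ang \<alpha> (mu z \<beta>)" for \<alpha> \<beta> using ang[of \<alpha> \<beta>] by simp
    fix n :: nat and \<alpha> \<beta> assume "(\<Sum>t<n. ang (\<alpha> t) (\<beta> t)) = 0"
    then have "\<chi> (\<Sum>t<n. ang (\<alpha> t) (\<beta> t)) = 0" by (simp add: l.zero)
    then show "(\<Sum>t<n. ang (mu z (\<alpha> t)) (\<beta> t)) = 0" by (simp add: l.sum ang(1))
  qed
  moreover have "multiplies z \<chi>"
    unfolding multiplies_by_def using gA WB ang by metis
  ultimately show ?thesis by blast
qed

section \<open>From scalars to centroid elements\<close>

lemma scalarsD:
  assumes "z \<in> scalars"
  shows "z \<in> algebra_centre mu" "z \<in> A" "ang (mu z \<alpha>) \<beta> = ang \<alpha> (mu z \<beta>)"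
    "(\<Sum>t<(n::nat). ang (\<alpha>s t) (\<beta>s t)) = 0 \<Longrightarrow> (\<Sum>t<n. ang (mu z (\<alpha>s t)) (\<beta>s t)) = 0"
  using assms unfolding centroid_scalars_def by blast+

text \<open>Stability of A and B is a consequence of the type: the product respects the parts, or B
  = 0, or z is a symmetric element that commutes with everything.\<close>

lemma scalars_preserve:
  assumes z: "z \<in> scalars"
  shows "a \<in> A \<Longrightarrow> mu z a \<in> A" "b \<in> B \<Longrightarrow> mu z b \<in> B"
proof -
  have zA: "z \<in> A" and c: "\<And>\<alpha>. mu \<alpha> z = mu z \<alpha>"
    using scalarsD(1,2)[OF z] \<aa>.algebra_centreD(1) by blast+
  have "(a \<in> A \<longrightarrow> mu z a \<in> A) \<and> (b \<in> B \<longrightarrow> mu z b \<in> B)"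
  proof (cases rule: type_cases)
    case general
    then show ?thesis
      using brackets_generalD(1)[OF general(1)] zA unfolding \<aa>.product_respects_parts_def by blast
  next
    case (A r)
    then show ?thesis using A_UNIV simply_laced_trivial(1) by (auto simp: \<aa>.mu_zero_right)
  next
    case (C r)
    show ?thesis using \<aa>.involution_parts(7,8)[OF C_involution[OF C(2)] zA _ c] by blast
  qed
  then show "a \<in> A \<Longrightarrow> mu z a \<in> A" "b \<in> B \<Longrightarrow> mu z b \<in> B" by blast+
qed

text \<open>\<open>ang\<close> splits into its values on A and on B, which act by multiplication
  expressions with possibly different coefficients; z slides out of either.\<close>

lemma dact_scalar:
  assumes z: "z \<in> scalars"
  shows "dact (ang (mu z \<alpha>) \<beta>) \<gamma> = mu z (dact (ang \<alpha> \<beta>) \<gamma>)"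
proof -
  note zc = scalarsD(1)[OF z]
  obtain a b where ab: "a \<in> A" "b \<in> B" "\<alpha> = a + b" by (rule \<aa>.decompose)
  obtain a' b' where ab': "a' \<in> A" "b' \<in> B" "\<beta> = a' + b'" by (rule \<aa>.decompose)
  obtain k where k: "\<And>\<alpha> \<beta> \<gamma>. \<lbrakk>\<alpha> \<in> A; \<beta> \<in> A\<rbrakk> \<Longrightarrow> dact (ang \<alpha> \<beta>) \<gamma> = \<aa>.mult_expression k \<alpha> \<beta> \<gamma>"
    using D_inner_A by blast
  obtain k' where k': "\<And>\<alpha> \<beta> \<gamma>. \<lbrakk>\<alpha> \<in> B; \<beta> \<in> B\<rbrakk> \<Longrightarrow> dact (ang \<alpha> \<beta>) \<gamma> = \<aa>.mult_expression k' \<alpha> \<beta> \<gamma>"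
    using D_inner_B by blast
  have add: "dact (d + d') \<gamma> = dact d \<gamma> + dact d' \<gamma>" if "d \<in> D" "d' \<in> D" for d d'
    using D_action that unfolding bilinear_on_def by blast
  have "dact (ang \<alpha> \<beta>) \<gamma> = \<aa>.mult_expression k a a' \<gamma> + \<aa>.mult_expression k' b b' \<gamma>"
    unfolding ab(3) ab'(3) ang_split[OF ab(1,2) ab'(1,2)] using add ang_D k k' ab ab' by simp
  moreover have "dact (ang (mu z \<alpha>) \<beta>) \<gamma> =
      \<aa>.mult_expression k (mu z a) a' \<gamma> + \<aa>.mult_expression k' (mu z b) b' \<gamma>"
    unfolding ab(3) ab'(3) \<aa>.mu_plus_right
      ang_split[OF scalars_preserve(1)[OF z ab(1)] scalars_preserve(2)[OF z ab(2)] ab'(1,2)]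
    using add ang_D k k' ab ab' scalars_preserve[OF z] by simp
  ultimately show ?thesis by (simp add: \<aa>.mult_expression_centre[OF zc] \<aa>.mu_plus_right)
qed

lemma commute_if_on_generators:
  assumes lin: "Vector_Spaces.linear sL sL \<Psi>"
    and "\<And>y a. \<lbrakk>y \<in> g; a \<in> A\<rbrakk> \<Longrightarrow> \<Psi> (br u (gA y a)) = br u (\<Psi> (gA y a))"
    and "\<And>w b. b \<in> B \<Longrightarrow> \<Psi> (br u (WB w b)) = br u (\<Psi> (WB w b))"
    and "\<And>\<alpha> \<beta>. \<Psi> (br u (ang \<alpha> \<beta>)) = br u (\<Psi> (ang \<alpha> \<beta>))"
  shows "\<Psi> (br u v) = br u (\<Psi> v)"
proof -
  interpret l: Vector_Spaces.linear sL sL \<Psi> by (rule lin)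
  have A: "\<Psi> (br u v) = br u (\<Psi> v)" if "v \<in> TA" for v
    using that
    by (induction rule: span_induct_alt)
      (use assms(2) in \<open>auto simp: l.zero l.add l.scale br_add_right br_scale_right\<close>)
  have B: "\<Psi> (br u v) = br u (\<Psi> v)" if "v \<in> TB" for v
    using that
    by (induction rule: span_induct_alt)
      (use assms(3) in \<open>auto simp: l.zero l.add l.scale br_add_right br_scale_right\<close>)
  have D: "\<Psi> (br u v) = br u (\<Psi> v)" if "v \<in> D" for v
  proof -
    have "v \<in> span {ang \<alpha> \<beta> |\<alpha> \<beta>. True}" using that ang_span by simp
    then show ?thesis
      by (induction rule: span_induct_alt)
        (use assms(4) in \<open>auto simp: l.zero l.add l.scale br_add_right br_scale_right\<close>)
  qed
  have "\<Psi> (br u (prA v + prB v + prD v)) = br u (\<Psi> (prA v + prB v + prD v))"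
    using A[OF pr_mem(1)] B[OF pr_mem(2)] D[OF pr_mem(3)] by (simp add: l.add br_add_right)
  then show ?thesis using pr_sum[of v] by metis
qed

text \<open>In every bracket formula z can be shifted between the factors because it is central. The
  version with z on the g \<otimes> A factor serves, after a sign change, for brackets with
  \<open>WB u b\<close> on the left.\<close>

lemma multiplication_brackets:
  assumes z: "z \<in> scalars" and lin: "Vector_Spaces.linear sL sL \<Psi>" and m: "multiplies z \<Psi>"
  shows "\<lbrakk>x \<in> g; y \<in> g; a \<in> A; a' \<in> A\<rbrakk> \<Longrightarrow> \<Psi> (br (gA x a) (gA y a')) = br (gA x a) (gA y (mu z a'))"
    and "\<lbrakk>x \<in> g; a \<in> A; b \<in> B\<rbrakk> \<Longrightarrow> \<Psi> (br (gA x a) (WB u b)) = br (gA x a) (WB u (mu z b))"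
    and "\<lbrakk>x \<in> g; a \<in> A; b \<in> B\<rbrakk> \<Longrightarrow> \<Psi> (br (gA x a) (WB u b)) = br (gA x (mu z a)) (WB u b)"
    and "\<lbrakk>b \<in> B; b' \<in> B\<rbrakk> \<Longrightarrow> \<Psi> (br (WB u b) (WB v b')) = br (WB u b) (WB v (mu z b'))"
proof -
  interpret l: Vector_Spaces.linear sL sL \<Psi> by (rule lin)
  note zc = scalarsD(1)[OF z] and zA = scalars_preserve(1)[OF z] and zB = scalars_preserve(2)[OF z]
  note zm = \<aa>.algebra_centreD[OF zc]
  have mg: "\<And>x a. \<lbrakk>x \<in> g; a \<in> A\<rbrakk> \<Longrightarrow> \<Psi> (gA x a) = gA x (mu z a)" and mw: "\<And>w b. b \<in> B \<Longrightarrow> \<Psi> (WB w b) = WB w (mu z b)"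
    and ma: "\<And>\<alpha> \<beta>. \<Psi> (ang \<alpha> \<beta>) = ang \<alpha> (mu z \<beta>)"
    using m unfolding multiplies_by_def by auto
  note ps = l.add l.scale mg mw ma zA zB zm \<aa>.sym_centre[OF zc] g_br
  have "(x \<in> g \<and> y \<in> g \<and> a \<in> A \<and> a' \<in> A \<longrightarrow> \<Psi> (br (gA x a) (gA y a')) = br (gA x a) (gA y (mu z a'))) \<and>
    (x \<in> g \<and> a \<in> A \<and> b \<in> B \<longrightarrow> \<Psi> (br (gA x a) (WB u b)) = br (gA x a) (WB u (mu z b)) \<and>
      \<Psi> (br (gA x a) (WB u b)) = br (gA x (mu z a)) (WB u b)) \<and>
    (b \<in> B \<and> b' \<in> B \<longrightarrow> \<Psi> (br (WB u b) (WB v b')) = br (WB u b) (WB v (mu z b')))"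
  proof (cases rule: type_cases)
    case general
    note G = brackets_generalD[OF general(1)]
    have mem: "\<And>a a'. \<lbrakk>a \<in> A; a' \<in> A\<rbrakk> \<Longrightarrow> mu a a' \<in> A" "\<And>a b. \<lbrakk>a \<in> A; b \<in> B\<rbrakk> \<Longrightarrow> mu a b \<in> B"
      using G(1) unfolding \<aa>.product_respects_parts_def by blast+
    obtain der star where W: "\<And>u v. der u v \<in> g"
      "\<And>u v b b'. \<lbrakk>b \<in> B; b' \<in> B\<rbrakk> \<Longrightarrow> br (WB u b) (WB v b') =
        gA (der u v) (\<aa>.A_part (mu b b')) + WB (star u v) (\<aa>.B_part (mu b b')) + sL (wf u v) (ang b b')"
      by (rule brackets_general_W[OF general(1)]) blast
    have parts: "\<aa>.A_part (mu z c) = mu z (\<aa>.A_part c)" "\<aa>.B_part (mu z c) = mu z (\<aa>.B_part c)" for c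
    proof -
      have "mu z c = mu z (\<aa>.A_part c) + mu z (\<aa>.B_part c)"
        using arg_cong[OF \<aa>.parts_sum[of c], of "mu z"] by (simp only: \<aa>.mu_plus_right)
      then show "\<aa>.A_part (mu z c) = mu z (\<aa>.A_part c)" "\<aa>.B_part (mu z c) = mu z (\<aa>.B_part c)"
        using \<aa>.parts_eq[OF zA[OF \<aa>.parts_mem(1)] zB[OF \<aa>.parts_mem(2)], of c c] by simp_all
    qed
    show ?thesis using G(2,3) mem by (auto simp: ps W parts \<aa>.parts_mem)
  next
    case (A r)
    have sl: "simply_laced T" using A by simp
    note B0 = simply_laced_trivial(1)[OF sl] and AU = A_UNIV[OF sl]
    obtain c where c: "\<And>x y. \<lbrakk>x \<in> g; y \<in> g\<rbrakk> \<Longrightarrow> c x y \<in> g"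
      "\<And>x y a a'. \<lbrakk>x \<in> g; y \<in> g; a \<in> A; a' \<in> A\<rbrakk> \<Longrightarrow> br (gA x a) (gA y a') =
        gA (br x y) (\<aa>.sym a a') + gA (c x y) (\<aa>.skew a a') + sL (killing x y) (ang a a')"
      by (rule brackets_A_form[OF A(3,1)]) blast
    show ?thesis by (auto simp: ps c AU B0 WB_zero_right \<aa>.mu_zero_right l.zero)
  next
    case (C r)
    note inv = \<aa>.involution_parts[OF C_involution[OF C(2)]]
    obtain c e dd s where f: "\<And>x u. x \<in> g \<Longrightarrow> e x u \<in> g" "\<And>u v. dd u v \<in> g"
      "\<And>x y a a'. \<lbrakk>x \<in> g; y \<in> g; a \<in> A; a' \<in> A\<rbrakk> \<Longrightarrow> br (gA x a) (gA y a') =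
        gA (br x y) (\<aa>.sym a a') + WB (c x y) (\<aa>.skew a a') + sL (killing x y) (ang a a')"
      "\<And>x u a b. \<lbrakk>x \<in> g; a \<in> A; b \<in> B\<rbrakk> \<Longrightarrow> br (gA x a) (WB u b) =
        gA (e x u) (\<aa>.skew a b) + WB (act x u) (\<aa>.sym a b)"
      "\<And>u v b b'. \<lbrakk>b \<in> B; b' \<in> B\<rbrakk> \<Longrightarrow> br (WB u b) (WB v b') =
        gA (dd u v) (\<aa>.sym b b') + WB (s u v) (\<aa>.skew b b') + sL (wf u v) (ang b b')"
      by (rule brackets_C_form[OF C(3,1)]) blast
    show ?thesis by (auto simp: ps f inv(1-6))
  qed
  then show "\<lbrakk>x \<in> g; y \<in> g; a \<in> A; a' \<in> A\<rbrakk> \<Longrightarrow> \<Psi> (br (gA x a) (gA y a')) = br (gA x a) (gA y (mu z a'))"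
    and "\<lbrakk>x \<in> g; a \<in> A; b \<in> B\<rbrakk> \<Longrightarrow> \<Psi> (br (gA x a) (WB u b)) = br (gA x a) (WB u (mu z b))"
    and "\<lbrakk>x \<in> g; a \<in> A; b \<in> B\<rbrakk> \<Longrightarrow> \<Psi> (br (gA x a) (WB u b)) = br (gA x (mu z a)) (WB u b)"
    and "\<lbrakk>b \<in> B; b' \<in> B\<rbrakk> \<Longrightarrow> \<Psi> (br (WB u b) (WB v b')) = br (WB u b) (WB v (mu z b'))"
    by blast+
qed

text \<open>K collects the u whose adjoint map commutes with \<Psi>; by the Jacobi identity it is a
  subalgebra. This handles D without a formula for brackets inside D, which would otherwise have to
  be compared with \<Psi>.\<close>

lemma multiplication_in_centroid:
  assumes z: "z \<in> scalars" and lin: "Vector_Spaces.linear sL sL \<Psi>" and m: "multiplies z \<Psi>"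
  shows "\<Psi> \<in> centroid sL br"
proof -
  interpret l: Vector_Spaces.linear sL sL \<Psi> by (rule lin)
  note zA = scalars_preserve(1)[OF z] and zB = scalars_preserve(2)[OF z]
  note mb = multiplication_brackets[OF z lin m]
  have mg: "\<And>x a. \<lbrakk>x \<in> g; a \<in> A\<rbrakk> \<Longrightarrow> \<Psi> (gA x a) = gA x (mu z a)" and mw: "\<And>w b. b \<in> B \<Longrightarrow> \<Psi> (WB w b) = WB w (mu z b)"
    and ma: "\<And>\<alpha> \<beta>. \<Psi> (ang \<alpha> \<beta>) = ang (mu z \<alpha>) \<beta>"
    using m unfolding multiplies_by_def by blast+
  have presA: "dact d a \<in> A" if "d \<in> D" "a \<in> A" for d a using D_preserves that by blast
  have presB: "dact d b \<in> B" if "d \<in> D" "b \<in> B" for d b using D_preserves that by blast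
  define K where "K = {u. \<forall>v. \<Psi> (br u v) = br u (\<Psi> v)}"
  have Ksub: "subspace K"
    unfolding K_def by (auto intro!: subspaceI simp: br_add_left br_scale_left l.zero l.add l.scale)
  have Kbr: "br u v \<in> K" if "u \<in> K" "v \<in> K" for u v
    using that by (simp add: K_def br_br l.diff)
  have KA: "gA x a \<in> K" if "x \<in> g" "a \<in> A" for x a
    unfolding K_def
  proof (intro CollectI allI, rule commute_if_on_generators[OF lin])
    show "\<Psi> (br (gA x a) (gA y a')) = br (gA x a) (\<Psi> (gA y a'))" if "y \<in> g" "a' \<in> A" for y a'
      using mb(1) mg that \<open>x \<in> g\<close> \<open>a \<in> A\<close> by simp
    show "\<Psi> (br (gA x a) (WB w b)) = br (gA x a) (\<Psi> (WB w b))" if "b \<in> B" for w b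
      using mb(2) mw that \<open>x \<in> g\<close> \<open>a \<in> A\<close> by simp
    \<comment> \<open>Up to sign this bracket is x tensored with the image of a under the derivation
      of \<open>ang \<alpha> \<beta>\<close>; replacing \<alpha> by z \<alpha> multiplies the
      derivation by z.\<close>
    show "\<Psi> (br (gA x a) (ang \<alpha> \<beta>)) = br (gA x a) (\<Psi> (ang \<alpha> \<beta>))" for \<alpha> \<beta>
      using that br_anti[of "gA x a" "ang \<alpha> \<beta>"] br_anti[of "gA x a" "ang (mu z \<alpha>) \<beta>"]
      by (simp add: ma D_on_gA[OF ang_D] dact_scalar[OF z] l.neg mg presA[OF ang_D])
  qed
  have KB: "WB w b \<in> K" if "b \<in> B" for w b
    unfolding K_def
  proof (intro CollectI allI, rule commute_if_on_generators[OF lin])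
    show "\<Psi> (br (WB w b) (gA y a)) = br (WB w b) (\<Psi> (gA y a))" if "y \<in> g" "a \<in> A" for y a
      using mb(3)[of y a b w] that \<open>b \<in> B\<close> br_anti[of "WB w b" "gA y a"] br_anti[of "WB w b" "gA y (mu z a)"]
      by (simp add: l.neg mg)
    show "\<Psi> (br (WB w b) (WB w' b')) = br (WB w b) (\<Psi> (WB w' b'))" if "b' \<in> B" for w' b'
      using mb(4) mw that \<open>b \<in> B\<close> by simp
    show "\<Psi> (br (WB w b) (ang \<alpha> \<beta>)) = br (WB w b) (\<Psi> (ang \<alpha> \<beta>))" for \<alpha> \<beta>
      using that br_anti[of "WB w b" "ang \<alpha> \<beta>"] br_anti[of "WB w b" "ang (mu z \<alpha>) \<beta>"]
      by (simp add: ma D_on_WB[OF ang_D] dact_scalar[OF z] l.neg mw presB[OF ang_D])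
  qed
  have TAK: "TA \<subseteq> K" and TBK: "TB \<subseteq> K"
    by (rule span_minimal[OF _ Ksub], use KA KB in blast)+
  \<comment> \<open>\<open>D\<close> lies in the subalgebra generated by \<open>g \<otimes> A\<close> and \<open>W \<otimes> B\<close>\<close>
  have prK: "prD u \<in> K" if "u \<in> K" for u
  proof -
    have "prA u + prB u + prD u - prA u - prB u = prD u" by simp
    then have "u - prA u - prB u = prD u" by (simp only: pr_sum[symmetric])
    moreover have "u - prA u - prB u \<in> K"
      using that TAK TBK pr_mem(1,2)[of u] by (intro subspace_diff[OF Ksub]) auto
    ultimately show ?thesis by simp
  qed
  have AA: "ang a a' \<in> K" if a: "a \<in> A" "a' \<in> A" for a a'
  proof -
    obtain x y where xy: "x \<in> g" "y \<in> g" "killing x y \<noteq> 0" using killing_nonzero by blast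
    have "sL (killing x y) (ang a a') \<in> K"
      using prK[OF Kbr[OF KA[OF xy(1) a(1)] KA[OF xy(2) a(2)]]] prD_gA_gA[OF xy(1,2) a] by simp
    then have "sL (1 / killing x y) (sL (killing x y) (ang a a')) \<in> K" by (rule subspace_scale[OF Ksub])
    then show ?thesis using xy(3) by simp
  qed
  have BB: "ang b b' \<in> K" if b: "b \<in> B" "b' \<in> B" for b b'
  proof (cases "simply_laced T")
    case True
    then have "b = 0" using simply_laced_trivial(1) b by auto
    then show ?thesis using subspace_0[OF Ksub] by (simp add: ang_zero_left)
  next
    case False
    obtain u v where uv: "wf u v \<noteq> 0" using W_form_nonzero[OF False] by blast
    have "sL (wf u v) (ang b b') \<in> K"
      using prK[OF Kbr[OF KB[OF b(1)] KB[OF b(2)]]] prD_WB_WB[OF False b] by metis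
    then have "sL (1 / wf u v) (sL (wf u v) (ang b b')) \<in> K" by (rule subspace_scale[OF Ksub])
    then show ?thesis using uv by simp
  qed
  have angK: "ang \<alpha> \<beta> \<in> K" for \<alpha> \<beta>
  proof -
    obtain a b where ab: "a \<in> A" "b \<in> B" "\<alpha> = a + b" by (rule \<aa>.decompose)
    obtain a' b' where ab': "a' \<in> A" "b' \<in> B" "\<beta> = a' + b'" by (rule \<aa>.decompose)
    show ?thesis
      unfolding ab(3) ab'(3) ang_split[OF ab(1,2) ab'(1,2)]
      using AA BB ab ab' by (intro subspace_add[OF Ksub]) auto
  qed
  have DK: "D \<subseteq> K"
    unfolding ang_span[symmetric] by (rule span_minimal[OF _ Ksub]) (use angK in blast)
  have "prA v + prB v + prD v \<in> K" for v
    using pr_mem[of v] TAK TBK DK by (intro subspace_add[OF Ksub]) auto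
  then have K: "v \<in> K" for v by (simp only: pr_sum[symmetric])
  then have right: "\<Psi> (br u v) = br u (\<Psi> v)" for u v unfolding K_def by blast
  have "\<Psi> (br u v) = br (\<Psi> u) v" for u v
    using right[of v u] br_anti[of u v] br_anti[of "\<Psi> u" v] by (simp add: l.neg)
  then show ?thesis using lin right unfolding centroid_def by blast
qed

text \<open>\<Psi> is assembled from maps on the three summands. On the two tensor summands any
  linear map of the right factor extends; on D the values at all \<open>ang \<alpha> \<beta>\<close>
  are prescribed, and their consistency is condition (b).\<close>

lemma multiplication_exists:
  assumes z: "z \<in> scalars"
  shows "\<exists>\<Psi>. Vector_Spaces.linear sL sL \<Psi> \<and> multiplies z \<Psi>"
proof -
  note zA = scalars_preserve(1)[OF z] and zB = scalars_preserve(2)[OF z]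
  note D = scalarsD(3,4)[OF z]
  have "\<exists>\<Psi>. Vector_Spaces.linear sL sL \<Psi> \<and> (\<forall>x\<in>g. \<forall>a\<in>A. \<Psi> (gA x a) = gA x (mu z a))"
    by (rule tensor_map_extend[OF vector_space_axioms \<aa>.vector_space_axioms vector_space_axioms
          g_subspace \<aa>.subspace_A gA_tensor])
      (use zA in \<open>auto simp: \<aa>.mu_plus_right \<aa>.mu_sc_right\<close>)
  then obtain \<Psi>A where lA: "Vector_Spaces.linear sL sL \<Psi>A" and \<Psi>A: "\<And>x a. \<lbrakk>x \<in> g; a \<in> A\<rbrakk> \<Longrightarrow> \<Psi>A (gA x a) = gA x (mu z a)"
    by blast
  have "\<exists>\<Psi>. Vector_Spaces.linear sL sL \<Psi> \<and> (\<forall>w\<in>UNIV. \<forall>b\<in>B. \<Psi> (WB w b) = WB w (mu z b))"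
    by (rule tensor_map_extend[OF W.vector_space_axioms \<aa>.vector_space_axioms vector_space_axioms
          W.subspace_UNIV \<aa>.subspace_B WB_tensor])
      (use zB in \<open>auto simp: \<aa>.mu_plus_right \<aa>.mu_sc_right\<close>)
  then obtain \<Psi>B where lB: "Vector_Spaces.linear sL sL \<Psi>B" and \<Psi>B: "\<And>w b. b \<in> B \<Longrightarrow> \<Psi>B (WB w b) = WB w (mu z b)"
    by blast
  interpret vp: vector_space_pair sL sL ..
  \<comment> \<open>A basis of D among the values of \<open>ang\<close>: each basis vector has a
    fixed representation by p, and linearity determines the map from there.\<close>
  obtain X where X: "X \<subseteq> {ang \<alpha> \<beta> |\<alpha> \<beta>. True}" "independent X" "{ang \<alpha> \<beta> |\<alpha> \<beta>. True} \<subseteq> span X"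
    using maximal_independent_subset by blast
  have "\<forall>x\<in>X. \<exists>p. x = ang (fst p) (snd p)" using X(1) by force
  then obtain p where p: "\<And>x. x \<in> X \<Longrightarrow> x = ang (fst (p x)) (snd (p x))" by metis
  let ?k = "\<lambda>x. ang (mu z (fst (p x))) (snd (p x))"
  define \<Psi>D where "\<Psi>D = vp.construct X ?k"
  have lD: "Vector_Spaces.linear sL sL \<Psi>D" unfolding \<Psi>D_def by (rule vp.linear_construct[OF X(2)])
  interpret lD: Vector_Spaces.linear sL sL \<Psi>D by (rule lD)
  have \<Psi>D: "\<Psi>D (ang \<alpha> \<beta>) = ang (mu z \<alpha>) \<beta>" for \<alpha> \<beta>
  proof -
    have "ang \<alpha> \<beta> \<in> span X" using X(3) by blast
    then obtain I c where I: "finite I" "I \<subseteq> X" "ang \<alpha> \<beta> = (\<Sum>x\<in>I. sL (c x) x)"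
      by (auto simp: span_explicit)
    have e: "\<Psi>D (ang \<alpha> \<beta>) = (\<Sum>x\<in>I. sL (c x) (?k x))"
      unfolding I(3) lD.sum lD.scale
      by (intro sum.cong refl arg_cong[of _ _ "sL _"]) (use I(2) vp.construct_basis[OF X(2)] in \<open>auto simp: \<Psi>D_def\<close>)
    obtain n :: nat and q where q: "bij_betw q {..<n} I"
      using ex_bij_betw_nat_finite[OF I(1)] by (auto simp: lessThan_atLeast0)
    \<comment> \<open>The expansion of \<open>ang \<alpha> \<beta>\<close> in the basis becomes a
      vanishing sum over \<open>t < Suc n\<close>: the coefficients are absorbed into the first
      arguments, and index n holds the extra term \<open>ang (- \<alpha>) \<beta>\<close>. Condition
      (b) then multiplies it by z.\<close>
    define as where "as t = (if t = n then - \<alpha> else sA (c (q t)) (fst (p (q t))))" for t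
    define bs where "bs t = (if t = n then \<beta> else snd (p (q t)))" for t
    have neg: "ang (- x) y = - ang x y" for x y using ang_scale_left[of "- 1" x y] by simp
    have "(\<Sum>t<n. ang (as t) (bs t)) = (\<Sum>t<n. sL (c (q t)) (q t))"
    proof (rule sum.cong)
      fix t assume t: "t \<in> {..<n}"
      then have "q t \<in> X" using q I(2) by (auto simp: bij_betw_def)
      then show "ang (as t) (bs t) = sL (c (q t)) (q t)"
        using t p[of "q t"] by (simp add: as_def bs_def ang_scale_left)
    qed simp
    also have "\<dots> = ang \<alpha> \<beta>" unfolding I(3) using sum.reindex_bij_betw[OF q, of "\<lambda>x. sL (c x) x"] .
    finally have "(\<Sum>t<Suc n. ang (as t) (bs t)) = 0" by (simp add: as_def bs_def neg)
    then have "(\<Sum>t<Suc n. ang (mu z (as t)) (bs t)) = 0" by (rule D(2))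
    moreover have "(\<Sum>t<n. ang (mu z (as t)) (bs t)) = (\<Sum>t<n. sL (c (q t)) (?k (q t)))"
      by (rule sum.cong) (auto simp: as_def bs_def \<aa>.mu_sc_right ang_scale_left)
    moreover have "\<dots> = \<Psi>D (ang \<alpha> \<beta>)"
      unfolding e using sum.reindex_bij_betw[OF q, of "\<lambda>x. sL (c x) (?k x)"] .
    ultimately show ?thesis by (simp add: as_def bs_def \<aa>.mu_minus_right neg)
  qed
  let ?\<Psi> = "\<lambda>v. \<Psi>A (prA v) + \<Psi>B (prB v) + \<Psi>D (prD v)"
  interpret lA: Vector_Spaces.linear sL sL \<Psi>A by (rule lA)
  interpret lB: Vector_Spaces.linear sL sL \<Psi>B by (rule lB)
  have "Vector_Spaces.linear sL sL ?\<Psi>"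
    by (simp add: Vector_Spaces.linear_iff vector_space_axioms pr_add pr_scale lA.add lA.scale lB.add
        lB.scale lD.add lD.scale scale_right_distrib)
  moreover have "multiplies z ?\<Psi>"
    unfolding multiplies_by_def using D(1)
    by (simp add: pr_simps \<Psi>A \<Psi>B \<Psi>D lA.zero lB.zero lD.zero)
  ultimately show ?thesis by blast
qed

lemma multiplication_unique:
  assumes "Vector_Spaces.linear sL sL \<Psi>" "multiplies z \<Psi>" "Vector_Spaces.linear sL sL \<Psi>'" "multiplies z \<Psi>'"
  shows "\<Psi> = \<Psi>'"
proof
  fix v
  interpret l: Vector_Spaces.linear sL sL \<Psi> by fact
  interpret l': Vector_Spaces.linear sL sL \<Psi>' by fact
  have "\<Psi> u = \<Psi>' u" if "u \<in> TA" for u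
    using that by (induction rule: span_induct_alt)
      (use assms(2,4) in \<open>auto simp: l.zero l'.zero l.add l'.add l.scale l'.scale multiplies_by_def\<close>)
  moreover have "\<Psi> u = \<Psi>' u" if "u \<in> TB" for u
    using that by (induction rule: span_induct_alt)
      (use assms(2,4) in \<open>auto simp: l.zero l'.zero l.add l'.add l.scale l'.scale multiplies_by_def\<close>)
  moreover have "\<Psi> u = \<Psi>' u" if "u \<in> D" for u
  proof -
    have "u \<in> span {ang \<alpha> \<beta> |\<alpha> \<beta>. True}" using that ang_span by simp
    then show ?thesis
    proof (induction rule: span_induct_alt)
      case (step c x y)
      then obtain \<alpha> \<beta> where "x = ang \<alpha> \<beta>" by blast
      then have "\<Psi> x = \<Psi>' x" using assms(2,4) unfolding multiplies_by_def by metis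
      then show ?case using step by (simp add: l.add l'.add l.scale l'.scale)
    qed (simp add: l.zero l'.zero)
  qed
  ultimately have "\<Psi> (prA v + prB v + prD v) = \<Psi>' (prA v + prB v + prD v)"
    using pr_mem[of v] by (simp add: l.add l'.add)
  then show "\<Psi> v = \<Psi>' v" using pr_sum[of v] by metis
qed

text \<open>z is recovered from the values on g, because x is x \<otimes> 1 and is sent to x
  \<otimes> z.\<close>

lemma multiplier_unique:
  assumes "z \<in> scalars" "z' \<in> A" "multiplies z \<Psi>" "\<And>x. x \<in> g \<Longrightarrow> \<Psi> x = gA x z'"
  shows "z = z'"
proof -
  obtain x y where xy: "x \<in> g" "y \<in> g" "br x y \<noteq> 0" using not_abelian by blast
  then have x: "x \<noteq> 0" by auto
  have "\<Psi> (gA x one) = gA x (mu z one)"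
    using assms(3) xy(1) \<aa>.one_in_A unfolding multiplies_by_def by blast
  then have "gA x z = gA x z'" using assms(4)[OF xy(1)] g_embedded[OF xy(1)] by (simp add: \<aa>.unit)
  then show ?thesis using gA_cancel[OF xy(1) x] scalarsD(2)[OF assms(1)] assms(2) by blast
qed

definition multiplication where
  "multiplication z = (SOME \<Psi>. Vector_Spaces.linear sL sL \<Psi> \<and> multiplies z \<Psi>)"

lemma multiplication:
  assumes "z \<in> scalars"
  shows "Vector_Spaces.linear sL sL (multiplication z)" "multiplies z (multiplication z)"
    "multiplication z \<in> centroid sL br"
    "\<lbrakk>x \<in> g; a \<in> A\<rbrakk> \<Longrightarrow> multiplication z (gA x a) = gA x (mu z a)"
proof -
  show *: "Vector_Spaces.linear sL sL (multiplication z)" "multiplies z (multiplication z)"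
    using someI_ex[OF multiplication_exists[OF assms]] unfolding multiplication_def by blast+
  show "multiplication z \<in> centroid sL br" by (rule multiplication_in_centroid[OF assms *])
  show "\<lbrakk>x \<in> g; a \<in> A\<rbrakk> \<Longrightarrow> multiplication z (gA x a) = gA x (mu z a)"
    using *(2) unfolding multiplies_by_def by blast
qed

text \<open>Every centroid element is multiplication by a scalar, which is read off from its values on
  \<open>g \<otimes> 1\<close>; so the scalars inherit their algebra structure from the centroid.\<close>

lemma multiplication_eqI:
  assumes \<chi>: "\<chi> \<in> centroid sL br" and "z \<in> A" "\<And>x. x \<in> g \<Longrightarrow> \<chi> x = gA x z"
  shows "z \<in> scalars \<and> multiplication z = \<chi>"
proof -
  obtain z' where z': "z' \<in> scalars" "multiplies z' \<chi>" using centroid_is_multiplication[OF \<chi>] by blast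
  have "z' = z" by (rule multiplier_unique[OF z'(1) assms(2) z'(2) assms(3)])
  moreover have "Vector_Spaces.linear sL sL \<chi>" using \<chi> by (simp add: centroid_def)
  ultimately show ?thesis using multiplication_unique[OF multiplication(1,2)] z' by blast
qed

section \<open>The algebra structure of the centroid\<close>

lemma centroidI:
  assumes "\<And>x y. \<chi> (x + y) = \<chi> x + \<chi> y" "\<And>c x. \<chi> (sL c x) = sL c (\<chi> x)"
    and "\<And>x y. \<chi> (br x y) = br x (\<chi> y)" "\<And>x y. \<chi> (br x y) = br (\<chi> x) y"
  shows "\<chi> \<in> centroid sL br"
  unfolding centroid_def Vector_Spaces.linear_iff using assms vector_space_axioms by blast

lemma centroid_linear:
  assumes "\<chi> \<in> centroid sL br"
  shows "\<chi> (x + y) = \<chi> x + \<chi> y" "\<chi> (sL c x) = sL c (\<chi> x)"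
  using assms unfolding centroid_def Vector_Spaces.linear_iff by blast+

lemma centroid_add:
  assumes "\<chi> \<in> centroid sL br" "\<chi>' \<in> centroid sL br"
  shows "(\<lambda>v. \<chi> v + \<chi>' v) \<in> centroid sL br"
proof (rule centroidI)
  note l = centroid_linear[OF assms(1)] centroid_linear[OF assms(2)]
  show "\<chi> (x + y) + \<chi>' (x + y) = \<chi> x + \<chi>' x + (\<chi> y + \<chi>' y)" for x y by (simp add: l)
  show "\<chi> (sL c x) + \<chi>' (sL c x) = sL c (\<chi> x + \<chi>' x)" for c x by (simp add: l scale_right_distrib)
  show "\<chi> (br x y) + \<chi>' (br x y) = br x (\<chi> y + \<chi>' y)" for x y
    unfolding br_add_right centroid_br(2)[OF assms(1), symmetric] centroid_br(2)[OF assms(2), symmetric] ..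
  show "\<chi> (br x y) + \<chi>' (br x y) = br (\<chi> x + \<chi>' x) y" for x y
    unfolding br_add_left centroid_br(1)[OF assms(1), symmetric] centroid_br(1)[OF assms(2), symmetric] ..
qed

lemma centroid_scale:
  assumes "\<chi> \<in> centroid sL br"
  shows "(\<lambda>v. sL c (\<chi> v)) \<in> centroid sL br"
proof (rule centroidI)
  note l = centroid_linear[OF assms]
  show "sL c (\<chi> (x + y)) = sL c (\<chi> x) + sL c (\<chi> y)" for x y by (simp add: l scale_right_distrib)
  show "sL c (\<chi> (sL d x)) = sL d (sL c (\<chi> x))" for d x by (simp add: l mult.commute)
  show "sL c (\<chi> (br x y)) = br x (sL c (\<chi> y))" for x y
    unfolding br_scale_right centroid_br(2)[OF assms, symmetric] ..
  show "sL c (\<chi> (br x y)) = br (sL c (\<chi> x)) y" for x y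
    unfolding br_scale_left centroid_br(1)[OF assms, symmetric] ..
qed

lemma centroid_comp:
  assumes "\<chi> \<in> centroid sL br" "\<chi>' \<in> centroid sL br"
  shows "\<chi> \<circ> \<chi>' \<in> centroid sL br"
proof (rule centroidI)
  note l = centroid_linear[OF assms(1)] centroid_linear[OF assms(2)]
  show "(\<chi> \<circ> \<chi>') (x + y) = (\<chi> \<circ> \<chi>') x + (\<chi> \<circ> \<chi>') y" "(\<chi> \<circ> \<chi>') (sL c x) = sL c ((\<chi> \<circ> \<chi>') x)" for c x y
    by (simp_all add: l)
  show "(\<chi> \<circ> \<chi>') (br x y) = br x ((\<chi> \<circ> \<chi>') y)" for x y
    unfolding comp_def centroid_br(2)[OF assms(2), of x y] by (rule centroid_br(2)[OF assms(1)])
  show "(\<chi> \<circ> \<chi>') (br x y) = br ((\<chi> \<circ> \<chi>') x) y" for x y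
    unfolding comp_def centroid_br(1)[OF assms(2), of x y] by (rule centroid_br(1)[OF assms(1)])
qed

lemma centroid_isomorphism: "algebra_isomorphism sA mu one sL scalars (centroid sL br) multiplication"
  unfolding algebra_isomorphism_def
proof (intro conjI ballI allI)
  have on_g: "multiplication z x = gA x z" if "z \<in> scalars" "x \<in> g" for z x
    using multiplication(4)[OF that(1,2) \<aa>.one_in_A] g_embedded[OF that(2)] by (simp add: \<aa>.unit)
  show "bij_betw multiplication scalars (centroid sL br)"
  proof (rule bij_betwI')
    show "multiplication z = multiplication z' \<longleftrightarrow> z = z'" if "z \<in> scalars" "z' \<in> scalars" for z z'
      using multiplier_unique[OF that(1) scalarsD(2)[OF that(2)] multiplication(2)[OF that(1)]] on_g[OF that(2)]
      by auto
    show "multiplication z \<in> centroid sL br" if "z \<in> scalars" for z by (rule multiplication(3)[OF that])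
    show "\<exists>z\<in>scalars. \<chi> = multiplication z" if \<chi>: "\<chi> \<in> centroid sL br" for \<chi>
    proof -
      obtain z where z: "z \<in> scalars" "multiplies z \<chi>" using centroid_is_multiplication[OF \<chi>] by blast
      have "Vector_Spaces.linear sL sL \<chi>" using \<chi> by (simp add: centroid_def)
      then show ?thesis using multiplication_unique[OF multiplication(1,2)[OF z(1)] _ z(2)] z(1) by metis
    qed
  qed
  have idc: "id \<in> centroid sL br" by (rule centroidI) simp_all
  show "one \<in> scalars" "multiplication one = id"
    using multiplication_eqI[OF idc \<aa>.one_in_A] g_embedded by simp_all
  fix z assume z: "z \<in> scalars"
  {
    fix c
    have "sA c z \<in> scalars \<and> multiplication (sA c z) = (\<lambda>v. sL c (multiplication z v))"
      by (rule multiplication_eqI[OF centroid_scale[OF multiplication(3)[OF z]]])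
        (use scalarsD(2)[OF z] on_g[OF z] \<aa>.subspace_scale[OF \<aa>.subspace_A] in \<open>auto simp: gT.tens_scale_right\<close>)
    then show "sA c z \<in> scalars" "multiplication (sA c z) = (\<lambda>v. sL c (multiplication z v))" by blast+
  }
  fix z' assume z': "z' \<in> scalars"
  have "z + z' \<in> scalars \<and> multiplication (z + z') = (\<lambda>v. multiplication z v + multiplication z' v)"
    by (rule multiplication_eqI[OF centroid_add[OF multiplication(3)[OF z] multiplication(3)[OF z']]])
      (use scalarsD(2)[OF z] scalarsD(2)[OF z'] on_g[OF z] on_g[OF z'] \<aa>.subspace_add[OF \<aa>.subspace_A]
        in \<open>auto simp: gT.tens_add_right\<close>)
  then show "z + z' \<in> scalars" "multiplication (z + z') = (\<lambda>v. multiplication z v + multiplication z' v)" by blast+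
  have "mu z z' \<in> scalars \<and> multiplication (mu z z') = multiplication z \<circ> multiplication z'"
    by (rule multiplication_eqI[OF centroid_comp[OF multiplication(3)[OF z] multiplication(3)[OF z']]])
      (use scalars_preserve(1)[OF z] scalarsD(2)[OF z'] on_g[OF z'] multiplication(4)[OF z] in auto)
  then show "mu z z' \<in> scalars" "multiplication (mu z z') = multiplication z \<circ> multiplication z'" by blast+
qed

end

theorem theorem5p15:
  fixes sL :: "'f::field_char_0 \<Rightarrow> 'l::ab_group_add \<Rightarrow> 'l"
    and sA :: "'f \<Rightarrow> 'a::ab_group_add \<Rightarrow> 'a"
    and sW :: "'f \<Rightarrow> 'w::ab_group_add \<Rightarrow> 'w"
    and br :: "'l \<Rightarrow> 'l \<Rightarrow> 'l"
    and mu :: "'a \<Rightarrow> 'a \<Rightarrow> 'a" and one :: 'a and A B :: "'a set"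
    and act :: "'l \<Rightarrow> 'w \<Rightarrow> 'w"
    and g h :: "'l set" and T :: cartan_type and \<pi> :: "nat \<Rightarrow> 'l \<Rightarrow> 'f"
    and gA :: "'l \<Rightarrow> 'a \<Rightarrow> 'l" and WB :: "'w \<Rightarrow> 'a \<Rightarrow> 'l"
    and ang :: "'a \<Rightarrow> 'a \<Rightarrow> 'l" and dact :: "'l \<Rightarrow> 'a \<Rightarrow> 'a" and wf :: "'w \<Rightarrow> 'w \<Rightarrow> 'f"
  assumes "root_graded_lie_algebra sL br sA mu one A B sW act g h T \<pi> gA WB ang dact wf"
  shows "(\<exists>\<Theta>. algebra_isomorphism sA mu one sL (centroid_scalars mu A ang) (centroid sL br) \<Theta> \<and>
              (\<forall>z\<in>centroid_scalars mu A ang. multiplies_by g A B mu gA WB ang z (\<Theta> z))) \<and>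
         (\<forall>z\<in>centroid_scalars mu A ang. \<forall>\<Psi>.
              Vector_Spaces.linear sL sL \<Psi> \<and> multiplies_by g A B mu gA WB ang z \<Psi> \<longrightarrow>
              \<Psi> \<in> centroid sL br) \<and>
         (\<forall>\<chi>\<in>centroid sL br. \<exists>z\<in>centroid_scalars mu A ang. multiplies_by g A B mu gA WB ang z \<chi>)"
proof -
  interpret root_graded_lie_algebra sL br sA mu one A B sW act g h T \<pi> gA WB ang dact wf by fact
  show ?thesis
    using centroid_isomorphism multiplication(2) multiplication_in_centroid centroid_is_multiplication
    by blast
qed

end
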